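(* Let $k$ be a finitely generated field of characteristic zero, $X/k$ a smooth, geometrically connected curve, $x\in X(k)$ a rational point with associated geometric point $\bar x$, and $\ell$ a prime. Let $\alpha\in\mathbb{Z}_\ell^\times$ be an element which is not a root of unity, and let $\sigma\in G_k$ be an element which, for every $i\ge0$, acts on $\mathrm{gr}_W^{-i}\,\mathbb{Q}_\ell[[\pi_1^{\text{ét},\ell}(X_{\bar k},\bar x)]]$ as multiplication by $\alpha^i$, where $W$ is the weight filtration. Then there exists $r>0$ such that $\sigma$ acts topologically diagonalizably on $$\mathbb{Q}_\ell[[\pi_1^{\text{ét},\ell}(X_{\bar k},\bar x)]]^{\le\ell^{-r}},$$ i.e. the span of the $\sigma$-eigenvectors is dense.
   Context: $\pi_1^{\text{ét},\ell}(X_{\bar k},\bar x)$ is the maximal pro-$\ell$ quotient of $\pi_1^{\text{ét}}(X_{\bar k},\bar x)$; $G_k=\mathrm{Gal}(\bar k/k)$ acts on it by conjugation through the section $G_k\to\pi_1^{\text{ét}}(X,\bar x)$ induced by $x$. For a pro-$\ell$ group $G$, $\mathbb{Z}_\ell[[G]]=\varprojlim_U\mathbb{Z}_\ell[G/U]$ over open normal subgroups $U$, with augmentation ideal $\mathscr{I}$, and $\mathbb{Q}_\ell[[G]]:=\varprojlim_n\left(\mathbb{Z}_\ell[[G]]/\mathscr{I}^n\otimes\mathbb{Q}_\ell\right)$, whose augmentation ideal is also denoted $\mathscr{I}$. Weight filtration: let $\overline X$ be the smooth compactification of $X$ and let $\mathscr{J}$ be the kernel of $\mathbb{Q}_\ell[[\pi_1^{\text{ét},\ell}(X_{\bar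 k},\bar x)]]\to\mathbb{Q}_\ell[[\pi_1^{\text{ét},\ell}(\overline X_{\bar k},\bar x)]]$. Set $W^{-i}=\mathbb{Q}_\ell[[\pi_1^{\text{ét},\ell}(X_{\bar k},\bar x)]]$ for $i\le0$ and, for $i>0$, $W^{-i}=\mathscr{I}\cdot W^{-i+1}+\mathscr{J}\cdot W^{-i+2}$; $\mathrm{gr}_W^{-i}=W^{-i}/W^{-i-1}$. Convergent group ring: write $G=\pi_1^{\text{ét},\ell}(X_{\bar k},\bar x)$. For $g\in\mathbb{Q}_\ell[[G]]/\mathscr{I}^n$ let $v_n(g)=-\inf\{v_\ell(s): s\in\mathbb{Q}_\ell,\ s\cdot g\in\mathrm{im}(\mathbb{Z}_\ell[[G]]/\mathscr{I}^n\to\mathbb{Q}_\ell[[G]]/\mathscr{I}^n)\}$ (so $v_n(0)=+\infty$), and let $\pi_n:\mathbb{Q}_\ell[[G]]\to\mathbb{Q}_\ell[[G]]/\mathscr{I}^n$ be the quotient map. For real $r>0$, $\mathbb{Q}_\ell[[G]]^{\le\ell^{-r}}$ is the set of $g\in\mathbb{Q}_\ell[[G]]$ with $v_n(\pi_n(g))+rn\to\infty$ as $n\to\infty$; it is a $G_k$-stable subring. Its topology is the one given by the norm $|g|_r=\sup_n\ell^{-(v_n(\pi_n(g))+rn)}$. *)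

theory Defs
  imports "HOL-Algebra.Algebra" "HOL-Analysis.Analysis"
begin

no_notation Polynomials.var (\<open>X\<index>\<close>)  \<comment> \<open>\<open>X\<close> is a scheme below\<close>
hide_const (open) Divisibility.prime

section \<open>Schemes\<close>

subsection \<open>Sheaves of rings and stalks\<close>

text \<open>Values of \<open>sec\<close> and \<open>res\<close> at sets that are not open are irrelevant.\<close>

record ('p, 's) rspace =
  tp :: "'p topology"
  sec :: "'p set \<Rightarrow> 's ring"
  res :: "'p set \<Rightarrow> 'p set \<Rightarrow> 's \<Rightarrow> 's"

abbreviation pts :: "('p, 's) rspace \<Rightarrow> 'p set" where
  "pts X \<equiv> topspace (tp X)"

definition ringed_space :: "('p, 's) rspace \<Rightarrow> bool" where
  "ringed_space X \<longleftrightarrow>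
     (\<forall>U. openin (tp X) U \<longrightarrow> cring (sec X U) \<and> (\<forall>s\<in>carrier (sec X U). res X U U s = s)) \<and>
     (\<forall>U V. openin (tp X) U \<and> openin (tp X) V \<and> V \<subseteq> U \<longrightarrow>
        res X U V \<in> ring_hom (sec X U) (sec X V)) \<and>
     (\<forall>U V W. openin (tp X) U \<and> openin (tp X) V \<and> openin (tp X) W \<and> V \<subseteq> U \<and> W \<subseteq> V \<longrightarrow>
        (\<forall>s\<in>carrier (sec X U). res X V W (res X U V s) = res X U W s)) \<and>
     (\<forall>\<U> s. (\<forall>U\<in>\<U>. openin (tp X) U \<and> s U \<in> carrier (sec X U)) \<and>
        (\<forall>U\<in>\<U>. \<forall>V\<in>\<U>. res X U (U \<inter> V) (s U) = res X V (U \<inter> V) (s V)) \<longrightarrow>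
        (\<exists>!t. t \<in> carrier (sec X (\<Union>\<U>)) \<and> (\<forall>U\<in>\<U>. res X (\<Union>\<U>) U t = s U)))"

definition germ :: "('p, 's) rspace \<Rightarrow> 'p \<Rightarrow> 'p set \<Rightarrow> 's \<Rightarrow> ('p set \<times> 's) set" where
  "germ X x U s = {(V, t). openin (tp X) V \<and> x \<in> V \<and> t \<in> carrier (sec X V) \<and>
     (\<exists>W. openin (tp X) W \<and> x \<in> W \<and> W \<subseteq> U \<inter> V \<and> res X U W s = res X V W t)}"

definition stalk :: "('p, 's) rspace \<Rightarrow> 'p \<Rightarrow> (('p set \<times> 's) set) ring" where
  "stalk X x = \<lparr>
     carrier = {germ X x U s | U s. openin (tp X) U \<and> x \<in> U \<and> s \<in> carrier (sec X U)},
     monoid.mult = (\<lambda>A B. \<Union>(U, s)\<in>A. \<Union>(V, t)\<in>B.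
       germ X x (U \<inter> V) (res X U (U \<inter> V) s \<otimes>\<^bsub>sec X (U \<inter> V)\<^esub> res X V (U \<inter> V) t)),
     monoid.one = germ X x (pts X) \<one>\<^bsub>sec X (pts X)\<^esub>,
     ring.zero = germ X x (pts X) \<zero>\<^bsub>sec X (pts X)\<^esub>,
     ring.add = (\<lambda>A B. \<Union>(U, s)\<in>A. \<Union>(V, t)\<in>B.
       germ X x (U \<inter> V) (res X U (U \<inter> V) s \<oplus>\<^bsub>sec X (U \<inter> V)\<^esub> res X V (U \<inter> V) t))\<rparr>"

definition local_ring :: "('a, 'm) ring_scheme \<Rightarrow> bool" where
  "local_ring R \<longleftrightarrow> cring R \<and> (\<exists>!M. maximalideal M R)"

definition locally_ringed_space :: "('p, 's) rspace \<Rightarrow> bool" where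
  "locally_ringed_space X \<longleftrightarrow> ringed_space X \<and> (\<forall>x\<in>pts X. local_ring (stalk X x))"

definition open_subspace :: "('p, 's) rspace \<Rightarrow> 'p set \<Rightarrow> ('p, 's) rspace" where
  "open_subspace X U = \<lparr>tp = subtopology (tp X) U, sec = sec X, res = res X\<rparr>"

subsection \<open>Morphisms\<close>

text \<open>All components of a morphism are \<open>undefined\<close> outside their domains, so that equality of
  morphisms is equality of records.\<close>

record ('p, 's, 'q, 't) morph =
  pt :: "'p \<Rightarrow> 'q"
  cm :: "'q set \<Rightarrow> 't \<Rightarrow> 's"

definition preim :: "('p, 's) rspace \<Rightarrow> ('p, 's, 'q, 't) morph \<Rightarrow> 'q set \<Rightarrow> 'p set" where
  "preim X f V = {x \<in> pts X. pt f x \<in> V}"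

definition morphism ::
  "('p, 's) rspace \<Rightarrow> ('q, 't) rspace \<Rightarrow> ('p, 's, 'q, 't) morph \<Rightarrow> bool" where
  "morphism X Y f \<longleftrightarrow>
     continuous_map (tp X) (tp Y) (pt f) \<and> pt f \<in> extensional (pts X) \<and>
     cm f \<in> extensional {V. openin (tp Y) V} \<and>
     (\<forall>V. openin (tp Y) V \<longrightarrow>
        cm f V \<in> ring_hom (sec Y V) (sec X (preim X f V)) \<inter> extensional (carrier (sec Y V))) \<and>
     (\<forall>V W. openin (tp Y) V \<and> openin (tp Y) W \<and> W \<subseteq> V \<longrightarrow>
        (\<forall>t\<in>carrier (sec Y V). cm f W (res Y V W t) = res X (preim X f V) (preim X f W) (cm f V t))) \<and>
     (\<forall>x\<in>pts X. \<forall>V t. openin (tp Y) V \<and> pt f x \<in> V \<and> t \<in> carrier (sec Y V) \<and>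
        germ X x (preim X f V) (cm f V t) \<in> Units (stalk X x) \<longrightarrow>
        germ Y (pt f x) V t \<in> Units (stalk Y (pt f x)))"

definition id_m :: "('p, 's) rspace \<Rightarrow> ('p, 's, 'p, 's) morph" where
  "id_m X = \<lparr>pt = (\<lambda>x\<in>pts X. x), cm = (\<lambda>U\<in>{U. openin (tp X) U}. \<lambda>s\<in>carrier (sec X U). s)\<rparr>"

definition comp_m :: "('p, 's) rspace \<Rightarrow> ('q, 't) rspace \<Rightarrow> ('u, 'v) rspace \<Rightarrow>
    ('q, 't, 'u, 'v) morph \<Rightarrow> ('p, 's, 'q, 't) morph \<Rightarrow> ('p, 's, 'u, 'v) morph" where
  "comp_m X Y Z g f = \<lparr>
     pt = (\<lambda>x\<in>pts X. pt g (pt f x)),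
     cm = (\<lambda>W\<in>{W. openin (tp Z) W}. \<lambda>t\<in>carrier (sec Z W). cm f (preim Y g W) (cm g W t))\<rparr>"

definition isomorphic_rspace :: "('p, 's) rspace \<Rightarrow> ('q, 't) rspace \<Rightarrow> bool" where
  "isomorphic_rspace X Y \<longleftrightarrow> (\<exists>f g. morphism X Y f \<and> morphism Y X g \<and>
     comp_m X Y X g f = id_m X \<and> comp_m Y X Y f g = id_m Y)"

subsection \<open>Spectra and schemes\<close>

definition primes :: "('a, 'm) ring_scheme \<Rightarrow> 'a set set" where
  "primes R = {P. primeideal P R}"

text \<open>The fraction \<open>a/f\<close> in the localization \<open>R\<^sub>P\<close>.\<close>

definition frac_at :: "('a, 'm) ring_scheme \<Rightarrow> 'a set \<Rightarrow> 'a \<Rightarrow> 'a \<Rightarrow> ('a \<times> 'a) set" where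
  "frac_at R P a f = {(b, g). b \<in> carrier R \<and> g \<in> carrier R - P \<and>
     (\<exists>u\<in>carrier R - P. u \<otimes>\<^bsub>R\<^esub> (g \<otimes>\<^bsub>R\<^esub> a) = u \<otimes>\<^bsub>R\<^esub> (f \<otimes>\<^bsub>R\<^esub> b))}"

definition localization_at :: "('a, 'm) ring_scheme \<Rightarrow> 'a set \<Rightarrow> (('a \<times> 'a) set) ring" where
  "localization_at R P = \<lparr>
     carrier = {frac_at R P a f | a f. a \<in> carrier R \<and> f \<in> carrier R - P},
     monoid.mult = (\<lambda>A B. \<Union>(a, f)\<in>A. \<Union>(b, g)\<in>B. frac_at R P (a \<otimes>\<^bsub>R\<^esub> b) (f \<otimes>\<^bsub>R\<^esub> g)),
     monoid.one = frac_at R P \<one>\<^bsub>R\<^esub> \<one>\<^bsub>R\<^esub>,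
     ring.zero = frac_at R P \<zero>\<^bsub>R\<^esub> \<one>\<^bsub>R\<^esub>,
     ring.add = (\<lambda>A B. \<Union>(a, f)\<in>A. \<Union>(b, g)\<in>B.
       frac_at R P (a \<otimes>\<^bsub>R\<^esub> g \<oplus>\<^bsub>R\<^esub> b \<otimes>\<^bsub>R\<^esub> f) (f \<otimes>\<^bsub>R\<^esub> g))\<rparr>"

definition zariski :: "('a, 'm) ring_scheme \<Rightarrow> ('a set) topology" where
  "zariski R = topology_generated_by {{P \<in> primes R. f \<notin> P} | f. f \<in> carrier R}"

definition spec_sections ::
  "('a, 'm) ring_scheme \<Rightarrow> 'a set set \<Rightarrow> ('a set \<Rightarrow> ('a \<times> 'a) set) set" where
  "spec_sections R U = {s \<in> (\<Pi>\<^sub>E P\<in>U. carrier (localization_at R P)).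
     \<forall>P\<in>U. \<exists>V a f. openin (zariski R) V \<and> P \<in> V \<and> V \<subseteq> U \<and> a \<in> carrier R \<and> f \<in> carrier R \<and>
       (\<forall>Q\<in>V. f \<notin> Q \<and> s Q = frac_at R Q a f)}"

type_synonym 'a spec = "('a set, 'a set \<Rightarrow> ('a \<times> 'a) set) rspace"

definition Spec :: "('a, 'm) ring_scheme \<Rightarrow> 'a spec" where
  "Spec R = \<lparr>tp = zariski R,
     sec = (\<lambda>U. \<lparr>carrier = spec_sections R U,
        monoid.mult = (\<lambda>s t. \<lambda>P\<in>U. s P \<otimes>\<^bsub>localization_at R P\<^esub> t P),
        monoid.one = (\<lambda>P\<in>U. \<one>\<^bsub>localization_at R P\<^esub>),
        ring.zero = (\<lambda>P\<in>U. \<zero>\<^bsub>localization_at R P\<^esub>),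
        ring.add = (\<lambda>s t. \<lambda>P\<in>U. s P \<oplus>\<^bsub>localization_at R P\<^esub> t P)\<rparr>),
     res = (\<lambda>U V s. restrict s V)\<rparr>"

text \<open>The morphism \<open>Spec B \<rightarrow> Spec A\<close> of a ring homomorphism \<open>h : A \<rightarrow> B\<close>.\<close>

definition Spec_map :: "('a, 'm) ring_scheme \<Rightarrow> ('b, 'n) ring_scheme \<Rightarrow> ('a \<Rightarrow> 'b) \<Rightarrow>
    ('b set, 'b set \<Rightarrow> ('b \<times> 'b) set, 'a set, 'a set \<Rightarrow> ('a \<times> 'a) set) morph" where
  "Spec_map A B h = \<lparr>
     pt = (\<lambda>Q\<in>primes B. {a \<in> carrier A. h a \<in> Q}),
     cm = (\<lambda>U\<in>{U. openin (zariski A) U}. \<lambda>s\<in>spec_sections A U.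
       \<lambda>Q\<in>{Q \<in> primes B. {a \<in> carrier A. h a \<in> Q} \<in> U}.
         \<Union>(a, f)\<in>s {a \<in> carrier A. h a \<in> Q}. frac_at B Q (h a) (h f))\<rparr>"

text \<open>A locally ringed space isomorphic to some spectrum is isomorphic to the spectrum of its ring
  of global sections.\<close>

definition affine_scheme :: "('p, 's) rspace \<Rightarrow> bool" where
  "affine_scheme X \<longleftrightarrow> locally_ringed_space X \<and> isomorphic_rspace X (Spec (sec X (pts X)))"

definition affine_open :: "('p, 's) rspace \<Rightarrow> 'p set \<Rightarrow> bool" where
  "affine_open X U \<longleftrightarrow> openin (tp X) U \<and> affine_scheme (open_subspace X U)"

definition scheme :: "('p, 's) rspace \<Rightarrow> bool" where
  "scheme X \<longleftrightarrow> locally_ringed_space X \<and> (\<forall>x\<in>pts X. \<exists>U. affine_open X U \<and> x \<in> U)"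

subsection \<open>Schemes over a field\<close>

text \<open>\<open>k\<close> is a field throughout; a \<open>k\<close>-scheme is a scheme \<open>X\<close> with a morphism \<open>pX : X \<rightarrow> Spec k\<close>.\<close>

type_synonym ('p, 's, 'a) structure_morph =
  "('p, 's, 'a set, 'a set \<Rightarrow> ('a \<times> 'a) set) morph"

definition scheme_over ::
  "('a, 'm) ring_scheme \<Rightarrow> ('p, 's) rspace \<Rightarrow> ('p, 's, 'a) structure_morph \<Rightarrow> bool" where
  "scheme_over k X pX \<longleftrightarrow> scheme X \<and> morphism X (Spec k) pX"

text \<open>The resulting homomorphism from \<open>k\<close> to the ring of sections over \<open>U\<close>.\<close>

definition scalar_hom :: "('a, 'm) ring_scheme \<Rightarrow> ('p, 's) rspace \<Rightarrow>
    ('p, 's, 'a) structure_morph \<Rightarrow> 'p set \<Rightarrow> 'a \<Rightarrow> 's" where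
  "scalar_hom k X pX U c =
     res X (pts X) U (cm pX (primes k) (\<lambda>P\<in>primes k. frac_at k P c \<one>\<^bsub>k\<^esub>))"

text \<open>The canonical map from the tensor product of \<open>A\<close> and \<open>B\<close> over the field \<open>k\<close> to \<open>C\<close> is bijective:
  the first clause is surjectivity; since every tensor can be written with \<open>k\<close>-linearly independent
  right factors, the second is injectivity.\<close>

definition is_tensor_product :: "('a, 'k) ring_scheme \<Rightarrow> ('s, 'l) ring_scheme \<Rightarrow>
    ('t, 'm) ring_scheme \<Rightarrow> ('a \<Rightarrow> 't) \<Rightarrow> ('v, 'n) ring_scheme \<Rightarrow> ('s \<Rightarrow> 'v) \<Rightarrow> ('t \<Rightarrow> 'v) \<Rightarrow> bool"
where
  "is_tensor_product k A B \<iota> C u v \<longleftrightarrow>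
     (\<forall>c\<in>carrier C. \<exists>n a b. a \<in> {..<n::nat} \<rightarrow> carrier A \<and> b \<in> {..<n} \<rightarrow> carrier B \<and>
        c = (\<Oplus>\<^bsub>C\<^esub>i\<in>{..<n}. u (a i) \<otimes>\<^bsub>C\<^esub> v (b i))) \<and>
     (\<forall>n a b. a \<in> {..<n::nat} \<rightarrow> carrier A \<and> b \<in> {..<n} \<rightarrow> carrier B \<and>
        (\<forall>c\<in>{..<n} \<rightarrow> carrier k. (\<Oplus>\<^bsub>B\<^esub>i\<in>{..<n}. \<iota> (c i) \<otimes>\<^bsub>B\<^esub> b i) = \<zero>\<^bsub>B\<^esub> \<longrightarrow>
           (\<forall>i<n. c i = \<zero>\<^bsub>k\<^esub>)) \<and>
        (\<Oplus>\<^bsub>C\<^esub>i\<in>{..<n}. u (a i) \<otimes>\<^bsub>C\<^esub> v (b i)) = \<zero>\<^bsub>C\<^esub> \<longrightarrow>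
        (\<forall>i<n. a i = \<zero>\<^bsub>A\<^esub>))"

text \<open>The fibre product over \<open>k\<close> is described on affine opens rather than by its universal property,
  because a definition cannot quantify over test schemes of all types.\<close>

definition fibre_product :: "('a, 'm) ring_scheme \<Rightarrow>
    ('p, 's) rspace \<Rightarrow> ('p, 's, 'a) structure_morph \<Rightarrow>
    ('q, 't) rspace \<Rightarrow> ('q, 't, 'a) structure_morph \<Rightarrow>
    ('u, 'v) rspace \<Rightarrow> ('u, 'v, 'p, 's) morph \<Rightarrow> ('u, 'v, 'q, 't) morph \<Rightarrow> bool" where
  "fibre_product k X pX Y pY Z f g \<longleftrightarrow>
     scheme Z \<and> morphism Z X f \<and> morphism Z Y g \<and>
     comp_m Z X (Spec k) pX f = comp_m Z Y (Spec k) pY g \<and>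
     (\<forall>U V. affine_open X U \<and> affine_open Y V \<longrightarrow>
        (let W = preim Z f U \<inter> preim Z g V in
         affine_open Z W \<and>
         is_tensor_product k (sec X U) (sec Y V) (scalar_hom k Y pY V) (sec Z W)
           (\<lambda>a. res Z (preim Z f U) W (cm f U a)) (\<lambda>b. res Z (preim Z g V) W (cm g V b))))"

definition finite_type :: "('a, 'm) ring_scheme \<Rightarrow> ('p, 's) rspace \<Rightarrow>
    ('p, 's, 'a) structure_morph \<Rightarrow> bool" where
  "finite_type k X pX \<longleftrightarrow> (\<exists>\<U>. finite \<U> \<and> \<Union>\<U> = pts X \<and> (\<forall>U\<in>\<U>. affine_open X U \<and>
     (\<exists>S. finite S \<and> S \<subseteq> carrier (sec X U) \<and>
        generate_ring (sec X U) (scalar_hom k X pX U ` carrier k \<union> S) = carrier (sec X U))))"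

definition closed_immersion ::
  "('p, 's) rspace \<Rightarrow> ('q, 't) rspace \<Rightarrow> ('p, 's, 'q, 't) morph \<Rightarrow> bool" where
  "closed_immersion X Y f \<longleftrightarrow> morphism X Y f \<and>
     embedding_map (tp X) (tp Y) (pt f) \<and> closedin (tp Y) (pt f ` pts X) \<and>
     (\<forall>x\<in>pts X. \<forall>A\<in>carrier (stalk X x). \<exists>V t. openin (tp Y) V \<and> pt f x \<in> V \<and>
        t \<in> carrier (sec Y V) \<and> A = germ X x (preim X f V) (cm f V t))"

definition open_immersion ::
  "('p, 's) rspace \<Rightarrow> ('q, 't) rspace \<Rightarrow> ('p, 's, 'q, 't) morph \<Rightarrow> bool" where
  "open_immersion X Y f \<longleftrightarrow> morphism X Y f \<and>
     embedding_map (tp X) (tp Y) (pt f) \<and> openin (tp Y) (pt f ` pts X) \<and>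
     (\<forall>V. openin (tp Y) V \<and> V \<subseteq> pt f ` pts X \<longrightarrow>
        bij_betw (cm f V) (carrier (sec Y V)) (carrier (sec X (preim X f V))))"

text \<open>In the next two definitions the auxiliary schemes live in the same types as \<open>X\<close>. For \<open>X\<close> of
  finite type and of positive dimension over an infinite field this is no restriction: every scheme of
  finite type over \<open>k\<close> has at most as many points and sections as these types, and universal
  closedness may be tested on affine spaces.\<close>

definition separated :: "('a, 'm) ring_scheme \<Rightarrow> ('p, 's) rspace \<Rightarrow>
    ('p, 's, 'a) structure_morph \<Rightarrow> bool" where
  "separated k X pX \<longleftrightarrow> (\<forall>(Z :: ('p, 's) rspace) f g \<Delta>.
     fibre_product k X pX X pX Z f g \<and> morphism X Z \<Delta> \<and>
     comp_m X Z X f \<Delta> = id_m X \<and> comp_m X Z X g \<Delta> = id_m X \<longrightarrow> closed_immersion X Z \<Delta>)"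

definition universally_closed :: "('a, 'm) ring_scheme \<Rightarrow> ('p, 's) rspace \<Rightarrow>
    ('p, 's, 'a) structure_morph \<Rightarrow> bool" where
  "universally_closed k X pX \<longleftrightarrow> (\<forall>(T :: ('p, 's) rspace) pT (Z :: ('p, 's) rspace) f g.
     scheme_over k T pT \<and> fibre_product k X pX T pT Z f g \<longrightarrow> closed_map (tp Z) (tp T) (pt g))"

definition proper_over :: "('a, 'm) ring_scheme \<Rightarrow> ('p, 's) rspace \<Rightarrow>
    ('p, 's, 'a) structure_morph \<Rightarrow> bool" where
  "proper_over k X pX \<longleftrightarrow> separated k X pX \<and> finite_type k X pX \<and> universally_closed k X pX"

subsection \<open>Smooth curves\<close>

definition irreducible_closed :: "'p topology \<Rightarrow> 'p set \<Rightarrow> bool" where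
  "irreducible_closed T Z \<longleftrightarrow> closedin T Z \<and> Z \<noteq> {} \<and>
     (\<forall>A B. closedin T A \<and> closedin T B \<and> Z \<subseteq> A \<union> B \<longrightarrow> Z \<subseteq> A \<or> Z \<subseteq> B)"

definition krull_dim :: "'p topology \<Rightarrow> 'p set \<Rightarrow> enat" where
  "krull_dim T Y = Sup {enat n | n. \<exists>Z. (\<forall>i\<le>n. irreducible_closed T (Z i) \<and> Z i \<subseteq> Y) \<and>
     (\<forall>i<n. Z i \<subset> Z (Suc i))}"

definition pure_dim :: "'p topology \<Rightarrow> enat \<Rightarrow> bool" where
  "pure_dim T d \<longleftrightarrow> (\<forall>Y. irreducible_closed T Y \<and> (\<forall>Z. irreducible_closed T Z \<and> Y \<subseteq> Z \<longrightarrow> Z = Y) \<longrightarrow>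
     krull_dim T Y = d)"

definition ring_dim :: "('a, 'm) ring_scheme \<Rightarrow> enat" where
  "ring_dim R = Sup {enat n | n. \<exists>P. (\<forall>i\<le>n. P i \<in> primes R) \<and> (\<forall>i<n. P i \<subset> P (Suc i))}"

definition regular_local_ring :: "('a, 'm) ring_scheme \<Rightarrow> bool" where
  "regular_local_ring R \<longleftrightarrow> local_ring R \<and> noetherian_ring R \<and>
     (\<exists>S. finite S \<and> S \<subseteq> carrier R \<and> enat (card S) = ring_dim R \<and> maximalideal (Idl\<^bsub>R\<^esub> S) R)"

definition regular_scheme :: "('p, 's) rspace \<Rightarrow> bool" where
  "regular_scheme X \<longleftrightarrow> (\<forall>x\<in>pts X. regular_local_ring (stalk X x))"

definition curve :: "('a, 'm) ring_scheme \<Rightarrow> ('p, 's) rspace \<Rightarrow>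
    ('p, 's, 'a) structure_morph \<Rightarrow> bool" where
  "curve k X pX \<longleftrightarrow> scheme_over k X pX \<and> separated k X pX \<and> finite_type k X pX \<and>
     pts X \<noteq> {} \<and> pure_dim (tp X) 1"

text \<open>From here on \<open>L\<close> is an algebraic closure of its subfield \<open>K\<close>; the field \<open>K\<close> itself is the ring
  \<open>sub L K\<close>. The base change of \<open>X\<close> to \<open>L\<close> is \<open>Xb\<close>, with projections \<open>pXb\<close> to \<open>Spec L\<close> and \<open>q\<close> to \<open>X\<close>.\<close>

abbreviation sub :: "'a ring \<Rightarrow> 'a set \<Rightarrow> 'a ring" where
  "sub L K \<equiv> L\<lparr>carrier := K\<rparr>"

definition base_change :: "'a ring \<Rightarrow> 'a set \<Rightarrow> ('p, 's) rspace \<Rightarrow> ('p, 's, 'a) structure_morph \<Rightarrow>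
    ('q, 't) rspace \<Rightarrow> ('q, 't, 'a) structure_morph \<Rightarrow> ('q, 't, 'p, 's) morph \<Rightarrow> bool" where
  "base_change L K X pX Xb pXb q \<longleftrightarrow>
     fibre_product (sub L K) X pX (Spec L) (Spec_map (sub L K) L (\<lambda>c. c)) Xb q pXb"

text \<open>Smoothness of \<open>X\<close> over \<open>K\<close> is regularity of the base change to an algebraic closure;
  geometric connectedness is its connectedness.\<close>

definition smooth_curve :: "'a ring \<Rightarrow> 'a set \<Rightarrow> ('p, 's) rspace \<Rightarrow> ('p, 's, 'a) structure_morph \<Rightarrow>
    ('q, 't) rspace \<Rightarrow> ('q, 't, 'a) structure_morph \<Rightarrow> ('q, 't, 'p, 's) morph \<Rightarrow> bool" where
  "smooth_curve L K X pX Xb pXb q \<longleftrightarrow>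
     curve (sub L K) X pX \<and> base_change L K X pX Xb pXb q \<and> regular_scheme Xb"

definition smooth_geom_connected_curve :: "'a ring \<Rightarrow> 'a set \<Rightarrow>
    ('p, 's) rspace \<Rightarrow> ('p, 's, 'a) structure_morph \<Rightarrow>
    ('q, 't) rspace \<Rightarrow> ('q, 't, 'a) structure_morph \<Rightarrow> ('q, 't, 'p, 's) morph \<Rightarrow> bool" where
  "smooth_geom_connected_curve L K X pX Xb pXb q \<longleftrightarrow>
     smooth_curve L K X pX Xb pXb q \<and> connected_space (tp Xb)"

text \<open>\<open>C\<close> is the smooth compactification of \<open>X\<close> via \<open>j : X \<rightarrow> C\<close>, and \<open>jb : Xb \<rightarrow> Cb\<close> is the base
  change of \<open>j\<close>.\<close>

definition smooth_compactification :: "'a ring \<Rightarrow> 'a set \<Rightarrow>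
    ('p, 's) rspace \<Rightarrow> ('p, 's, 'a) structure_morph \<Rightarrow>
    ('q, 't) rspace \<Rightarrow> ('q, 't, 'a) structure_morph \<Rightarrow> ('q, 't, 'p, 's) morph \<Rightarrow>
    ('c, 'd) rspace \<Rightarrow> ('c, 'd, 'a) structure_morph \<Rightarrow>
    ('e, 'f) rspace \<Rightarrow> ('e, 'f, 'a) structure_morph \<Rightarrow> ('e, 'f, 'c, 'd) morph \<Rightarrow>
    ('p, 's, 'c, 'd) morph \<Rightarrow> ('q, 't, 'e, 'f) morph \<Rightarrow> bool" where
  "smooth_compactification L K X pX Xb pXb q C pC Cb pCb qC j jb \<longleftrightarrow>
     smooth_curve L K C pC Cb pCb qC \<and> proper_over (sub L K) C pC \<and>
     open_immersion X C j \<and> comp_m X C (Spec (sub L K)) pC j = pX \<and>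
     tp C closure_of (pt j ` pts X) = pts C \<and>
     morphism Xb Cb jb \<and> comp_m Xb Cb (Spec L) pCb jb = pXb \<and>
     comp_m Xb Cb C qC jb = comp_m Xb X C j q"

section \<open>The etale fundamental group\<close>

subsection \<open>Finite etale covers\<close>

definition algebra_basis :: "('a, 'm) ring_scheme \<Rightarrow> ('b, 'n) ring_scheme \<Rightarrow> ('a \<Rightarrow> 'b) \<Rightarrow>
    nat \<Rightarrow> (nat \<Rightarrow> 'b) \<Rightarrow> bool" where
  "algebra_basis A B h n w \<longleftrightarrow> w \<in> {..<n} \<rightarrow> carrier B \<and>
     (\<forall>b\<in>carrier B. \<exists>!c. c \<in> {..<n} \<rightarrow>\<^sub>E carrier A \<and>
        b = (\<Oplus>\<^bsub>B\<^esub>i\<in>{..<n}. h (c i) \<otimes>\<^bsub>B\<^esub> w i))"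

definition basis_coeff :: "('a, 'm) ring_scheme \<Rightarrow> ('b, 'n) ring_scheme \<Rightarrow> ('a \<Rightarrow> 'b) \<Rightarrow>
    nat \<Rightarrow> (nat \<Rightarrow> 'b) \<Rightarrow> 'b \<Rightarrow> nat \<Rightarrow> 'a" where
  "basis_coeff A B h n w b = (THE c. c \<in> {..<n} \<rightarrow>\<^sub>E carrier A \<and>
     b = (\<Oplus>\<^bsub>B\<^esub>i\<in>{..<n}. h (c i) \<otimes>\<^bsub>B\<^esub> w i))"

definition alg_trace :: "('a, 'm) ring_scheme \<Rightarrow> ('b, 'n) ring_scheme \<Rightarrow> ('a \<Rightarrow> 'b) \<Rightarrow>
    nat \<Rightarrow> (nat \<Rightarrow> 'b) \<Rightarrow> 'b \<Rightarrow> 'a" where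
  "alg_trace A B h n w b = (\<Oplus>\<^bsub>A\<^esub>i\<in>{..<n}. basis_coeff A B h n w (b \<otimes>\<^bsub>B\<^esub> w i) i)"

text \<open>\<open>B\<close> is free of finite rank over \<open>A\<close> and the trace form identifies it with its \<open>A\<close>-dual.\<close>

definition free_separable :: "('a, 'm) ring_scheme \<Rightarrow> ('b, 'n) ring_scheme \<Rightarrow> ('a \<Rightarrow> 'b) \<Rightarrow> bool" where
  "free_separable A B h \<longleftrightarrow> (\<exists>n w. algebra_basis A B h n w \<and>
     (\<forall>l\<in>carrier B \<rightarrow> carrier A.
        (\<forall>x\<in>carrier B. \<forall>y\<in>carrier B. l (x \<oplus>\<^bsub>B\<^esub> y) = l x \<oplus>\<^bsub>A\<^esub> l y) \<and>
        (\<forall>a\<in>carrier A. \<forall>x\<in>carrier B. l (h a \<otimes>\<^bsub>B\<^esub> x) = a \<otimes>\<^bsub>A\<^esub> l x) \<longrightarrow>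
        (\<exists>!b. b \<in> carrier B \<and> (\<forall>x\<in>carrier B. l x = alg_trace A B h n w (b \<otimes>\<^bsub>B\<^esub> x)))))"

text \<open>Finite etale morphisms are those given, locally on the base, by free separable algebras.\<close>

definition finite_etale ::
  "('q, 't) rspace \<Rightarrow> ('p, 's) rspace \<Rightarrow> ('q, 't, 'p, 's) morph \<Rightarrow> bool" where
  "finite_etale Y X f \<longleftrightarrow> scheme Y \<and> morphism Y X f \<and>
     (\<forall>x\<in>pts X. \<exists>U. x \<in> U \<and> affine_open X U \<and> affine_open Y (preim Y f U) \<and>
        free_separable (sec X U) (sec Y (preim Y f U)) (cm f U))"

text \<open>Covers of \<open>X\<close> are taken in the types of \<open>X\<close>. A scheme finite over a positive-dimensional scheme of
  finite type over an infinite field has no more points and sections than the latter, so that every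
  finite etale cover is isomorphic to one of these.\<close>

type_synonym ('p, 's) cover = "('p, 's) rspace \<times> ('p, 's, 'p, 's) morph"

definition covers :: "('p, 's) rspace \<Rightarrow> ('p, 's) cover set" where
  "covers X = {(Y, f). finite_etale Y X f}"

subsection \<open>Fibre functor and fundamental group\<close>

type_synonym ('a, 'p, 's) geom_point = "('a set, 'a set \<Rightarrow> ('a \<times> 'a) set, 'p, 's) morph"

definition fib :: "'a ring \<Rightarrow> ('p, 's) rspace \<Rightarrow> ('a, 'p, 's) geom_point \<Rightarrow>
    ('p, 's) cover \<Rightarrow> ('a, 'p, 's) geom_point set" where
  "fib L X xb = (\<lambda>(Y, f). {y. morphism (Spec L) Y y \<and> comp_m (Spec L) Y X f y = xb})"

definition cover_maps :: "('p, 's) rspace \<Rightarrow> ('p, 's) cover \<Rightarrow> ('p, 's) cover \<Rightarrow>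
    ('p, 's, 'p, 's) morph set" where
  "cover_maps X = (\<lambda>(Y, f) (Z, g). {h. morphism Y Z h \<and> comp_m Y Z X g h = f})"

record 'g topgroup = "'g monoid" +
  gtop :: "'g topology"

type_synonym ('a, 'p, 's) fibre_auto =
  "('p, 's) cover \<Rightarrow> ('a, 'p, 's) geom_point \<Rightarrow> ('a, 'p, 's) geom_point"

definition fibre_autos :: "'a ring \<Rightarrow> ('p, 's) rspace \<Rightarrow> ('a, 'p, 's) geom_point \<Rightarrow>
    ('a, 'p, 's) fibre_auto set" where
  "fibre_autos L X xb = {\<tau> \<in> (\<Pi>\<^sub>E c\<in>covers X. Bij (fib L X xb c)).
     \<forall>c\<in>covers X. \<forall>d\<in>covers X. \<forall>h\<in>cover_maps X c d. \<forall>y\<in>fib L X xb c.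
       \<tau> d (comp_m (Spec L) (fst c) (fst d) h y) = comp_m (Spec L) (fst c) (fst d) h (\<tau> c y)}"

text \<open>The automorphism group of the fibre functor, with the coarsest topology for which its actions on
  the (discrete) fibres are continuous.\<close>

definition pi1 :: "'a ring \<Rightarrow> ('p, 's) rspace \<Rightarrow> ('a, 'p, 's) geom_point \<Rightarrow>
    ('a, 'p, 's) fibre_auto topgroup" where
  "pi1 L X xb = \<lparr>carrier = fibre_autos L X xb,
     monoid.mult = (\<lambda>\<tau> \<rho>. \<lambda>c\<in>covers X. \<tau> c \<otimes>\<^bsub>BijGroup (fib L X xb c)\<^esub> \<rho> c),
     monoid.one = (\<lambda>c\<in>covers X. \<one>\<^bsub>BijGroup (fib L X xb c)\<^esub>),
     gtop = topology_generated_by (insert (fibre_autos L X xb)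
       {{\<tau> \<in> fibre_autos L X xb. \<tau> c y = z} | c y z.
          c \<in> covers X \<and> y \<in> fib L X xb c \<and> z \<in> fib L X xb c})\<rparr>"

text \<open>\<open>F\<close> is the homomorphism of fundamental groups induced by \<open>m : X' \<rightarrow> X\<close>, where \<open>X'\<close> has base point
  \<open>xb'\<close>, and \<open>X\<close> has base point \<open>m \<circ> xb'\<close>. A morphism \<open>h\<close> over \<open>m\<close> from a cover of \<open>X'\<close> to a cover of \<open>X\<close>
  factors through the pullback of the latter, whose fibre is that of the latter.\<close>

definition pi1_induced :: "'a ring \<Rightarrow> ('q, 't) rspace \<Rightarrow> ('a, 'q, 't) geom_point \<Rightarrow>
    ('p, 's) rspace \<Rightarrow> ('q, 't, 'p, 's) morph \<Rightarrow>
    (('a, 'q, 't) fibre_auto \<Rightarrow> ('a, 'p, 's) fibre_auto) \<Rightarrow> bool" where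
  "pi1_induced L X' xb' X m F \<longleftrightarrow>
     (let xb = comp_m (Spec L) X' X m xb' in
      F \<in> hom (pi1 L X' xb') (pi1 L X xb) \<and>
      continuous_map (gtop (pi1 L X' xb')) (gtop (pi1 L X xb)) F \<and>
      (\<forall>\<tau>\<in>carrier (pi1 L X' xb'). \<forall>(Y', f')\<in>covers X'. \<forall>(Y, f)\<in>covers X. \<forall>h.
         morphism Y' Y h \<and> comp_m Y' Y X f h = comp_m Y' X' X m f' \<longrightarrow>
         (\<forall>y\<in>fib L X' xb' (Y', f').
            comp_m (Spec L) Y' Y h (\<tau> (Y', f') y) = F \<tau> (Y, f) (comp_m (Spec L) Y' Y h y))))"

subsection \<open>Galois action\<close>

definition Gal :: "'a ring \<Rightarrow> 'a set \<Rightarrow> ('a \<Rightarrow> 'a) set" where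
  "Gal L K = {\<sigma> \<in> ring_iso L L. \<forall>c\<in>K. \<sigma> c = c}"

definition rational_point :: "'a ring \<Rightarrow> 'a set \<Rightarrow> ('p, 's) rspace \<Rightarrow>
    ('p, 's, 'a) structure_morph \<Rightarrow> ('a, 'p, 's) geom_point \<Rightarrow> bool" where
  "rational_point L K X pX x \<longleftrightarrow> morphism (Spec (sub L K)) X x \<and>
     comp_m (Spec (sub L K)) X (Spec (sub L K)) pX x = id_m (Spec (sub L K))"

definition geom_point_of :: "'a ring \<Rightarrow> 'a set \<Rightarrow> ('p, 's) rspace \<Rightarrow>
    ('a, 'p, 's) geom_point \<Rightarrow> ('a, 'p, 's) geom_point" where
  "geom_point_of L K X x =
     comp_m (Spec L) (Spec (sub L K)) X x (Spec_map (sub L K) L (\<lambda>c. c))"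

text \<open>\<open>G\<^sub>K\<close> acts on the geometric points of the fibre over a rational point by precomposition with
  \<open>Spec \<sigma>\<close>. This is the section \<open>G\<^sub>K \<rightarrow> \<pi>\<^sub>1(X, xb)\<close> induced by the rational point.\<close>

definition galois_section :: "'a ring \<Rightarrow> ('p, 's) rspace \<Rightarrow> ('a, 'p, 's) geom_point \<Rightarrow>
    ('a \<Rightarrow> 'a) \<Rightarrow> ('a, 'p, 's) fibre_auto" where
  "galois_section L X xb \<sigma> =
     (\<lambda>c\<in>covers X. \<lambda>y\<in>fib L X xb c. comp_m (Spec L) (Spec L) (fst c) y (Spec_map L L \<sigma>))"

text \<open>\<open>\<phi>\<close> is the automorphism of the geometric fundamental group that corresponds to conjugation by the
  image of \<open>\<sigma>\<close> in \<open>\<pi>\<^sub>1(X, xb)\<close> under the (injective) homomorphism \<open>I\<close> induced by \<open>q : Xb \<rightarrow> X\<close>.\<close>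

definition galois_conjugation :: "'a ring \<Rightarrow> ('p, 's) rspace \<Rightarrow> ('q, 't) rspace \<Rightarrow>
    ('q, 't, 'p, 's) morph \<Rightarrow> ('a, 'q, 't) geom_point \<Rightarrow> ('a \<Rightarrow> 'a) \<Rightarrow>
    (('a, 'q, 't) fibre_auto \<Rightarrow> ('a, 'q, 't) fibre_auto) \<Rightarrow> bool" where
  "galois_conjugation L X Xb q xbb \<sigma> \<phi> \<longleftrightarrow>
     (let P = pi1 L Xb xbb; xb = comp_m (Spec L) Xb X q xbb; Q = pi1 L X xb;
          s = galois_section L X xb \<sigma> in
      \<phi> \<in> iso P P \<and> homeomorphic_map (gtop P) (gtop P) \<phi> \<and>
      (\<exists>I. pi1_induced L Xb xbb X q I \<and>
         (\<forall>\<tau>\<in>carrier P. I (\<phi> \<tau>) = s \<otimes>\<^bsub>Q\<^esub> I \<tau> \<otimes>\<^bsub>Q\<^esub> inv\<^bsub>Q\<^esub> s)))"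

section \<open>Pro-\<open>l\<close> completed group rings\<close>

subsection \<open>Maximal pro-\<open>l\<close> quotient\<close>

text \<open>Open subgroups of a profinite group automatically have finite index.\<close>

definition open_normal :: "'g topgroup \<Rightarrow> 'g set set" where
  "open_normal G = {U. U \<lhd> G \<and> openin (gtop G) U \<and> finite (rcosets\<^bsub>G\<^esub> U)}"

definition pro_kernel :: "nat \<Rightarrow> 'g topgroup \<Rightarrow> 'g set" where
  "pro_kernel l G = \<Inter>{U \<in> open_normal G. \<exists>m. card (rcosets\<^bsub>G\<^esub> U) = l ^ m}"

definition max_pro :: "nat \<Rightarrow> 'g topgroup \<Rightarrow> ('g set) topgroup" where
  "max_pro l G = (let N = pro_kernel l G in
     \<lparr>carrier = carrier (G Mod N), monoid.mult = monoid.mult (G Mod N), monoid.one = monoid.one (G Mod N),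
      gtop = topology (\<lambda>V. V \<subseteq> carrier (G Mod N) \<and> openin (gtop G) (\<Union>V))\<rparr>)"

text \<open>The map induced on maximal pro-\<open>l\<close> quotients by a continuous homomorphism into \<open>H\<close>.\<close>

definition max_pro_map :: "nat \<Rightarrow> 'h topgroup \<Rightarrow> ('g \<Rightarrow> 'h) \<Rightarrow> 'g set \<Rightarrow> 'h set" where
  "max_pro_map l H f C = pro_kernel l H <#>\<^bsub>H\<^esub> (f ` C)"

subsection \<open>The rings \<open>\<int>\<^sub>l\<close> and \<open>\<int>\<^sub>l[[G]]\<close>\<close>

definition Zl :: "nat \<Rightarrow> (nat \<Rightarrow> int) ring" where
  "Zl l = \<lparr>
     carrier = {x. \<forall>n. 0 \<le> x n \<and> x n < int l ^ n \<and> x (Suc n) mod int l ^ n = x n},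
     monoid.mult = (\<lambda>x y n. (x n * y n) mod int l ^ n),
     monoid.one = (\<lambda>n. 1 mod int l ^ n),
     ring.zero = (\<lambda>n. 0),
     ring.add = (\<lambda>x y n. (x n + y n) mod int l ^ n)\<rparr>"

definition group_ring :: "('r, 'm) ring_scheme \<Rightarrow> ('g, 'n) monoid_scheme \<Rightarrow> ('g \<Rightarrow> 'r) ring" where
  "group_ring R G = \<lparr>
     carrier = carrier G \<rightarrow>\<^sub>E carrier R,
     monoid.mult = (\<lambda>x y. \<lambda>c\<in>carrier G.
       \<Oplus>\<^bsub>R\<^esub>a\<in>carrier G. x a \<otimes>\<^bsub>R\<^esub> y (inv\<^bsub>G\<^esub> a \<otimes>\<^bsub>G\<^esub> c)),
     monoid.one = (\<lambda>c\<in>carrier G. if c = \<one>\<^bsub>G\<^esub> then \<one>\<^bsub>R\<^esub> else \<zero>\<^bsub>R\<^esub>),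
     ring.zero = (\<lambda>c\<in>carrier G. \<zero>\<^bsub>R\<^esub>),
     ring.add = (\<lambda>x y. \<lambda>c\<in>carrier G. x c \<oplus>\<^bsub>R\<^esub> y c)\<rparr>"

definition Zl_group_ring :: "nat \<Rightarrow> 'g topgroup \<Rightarrow> ('g set \<Rightarrow> 'g set \<Rightarrow> nat \<Rightarrow> int) ring" where
  "Zl_group_ring l G = (let R = (\<lambda>U. group_ring (Zl l) (G Mod U)) in \<lparr>
     carrier = {x \<in> (\<Pi>\<^sub>E U\<in>open_normal G. carrier (R U)).
       \<forall>U\<in>open_normal G. \<forall>V\<in>open_normal G. V \<subseteq> U \<longrightarrow>
         (\<forall>c\<in>rcosets\<^bsub>G\<^esub> U. x U c = (\<Oplus>\<^bsub>Zl l\<^esub>d\<in>{d \<in> rcosets\<^bsub>G\<^esub> V. d \<subseteq> c}. x V d))},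
     monoid.mult = (\<lambda>x y. \<lambda>U\<in>open_normal G. x U \<otimes>\<^bsub>R U\<^esub> y U),
     monoid.one = (\<lambda>U\<in>open_normal G. \<one>\<^bsub>R U\<^esub>),
     ring.zero = (\<lambda>U\<in>open_normal G. \<zero>\<^bsub>R U\<^esub>),
     ring.add = (\<lambda>x y. \<lambda>U\<in>open_normal G. x U \<oplus>\<^bsub>R U\<^esub> y U)\<rparr>)"

definition Zl_const :: "nat \<Rightarrow> 'g topgroup \<Rightarrow> (nat \<Rightarrow> int) \<Rightarrow> 'g set \<Rightarrow> 'g set \<Rightarrow> nat \<Rightarrow> int" where
  "Zl_const l G a = (\<lambda>U\<in>open_normal G. \<lambda>c\<in>rcosets\<^bsub>G\<^esub> U. if c = U then a else \<zero>\<^bsub>Zl l\<^esub>)"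

text \<open>The augmentation is the component at \<open>U = G\<close>, in \<open>\<int>\<^sub>l[G/G] = \<int>\<^sub>l\<close>.\<close>

definition aug_ideal :: "nat \<Rightarrow> 'g topgroup \<Rightarrow> ('g set \<Rightarrow> 'g set \<Rightarrow> nat \<Rightarrow> int) set" where
  "aug_ideal l G = {x \<in> carrier (Zl_group_ring l G). x (carrier G) (carrier G) = \<zero>\<^bsub>Zl l\<^esub>}"

primrec ideal_pow :: "('a, 'm) ring_scheme \<Rightarrow> 'a set \<Rightarrow> nat \<Rightarrow> 'a set" where
  "ideal_pow R I 0 = carrier R"
| "ideal_pow R I (Suc n) = ideal_prod R (ideal_pow R I n) I"

abbreviation aug_pow :: "nat \<Rightarrow> 'g topgroup \<Rightarrow> nat \<Rightarrow> ('g set \<Rightarrow> 'g set \<Rightarrow> nat \<Rightarrow> int) set" where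
  "aug_pow l G n \<equiv> ideal_pow (Zl_group_ring l G) (aug_ideal l G) n"

definition Zl_quot :: "nat \<Rightarrow> 'g topgroup \<Rightarrow> nat \<Rightarrow> (('g set \<Rightarrow> 'g set \<Rightarrow> nat \<Rightarrow> int) set) ring" where
  "Zl_quot l G n = Zl_group_ring l G Quot aug_pow l G n"

text \<open>Push-forward along a continuous homomorphism \<open>f : G \<rightarrow> H\<close>.\<close>

definition Zl_map :: "nat \<Rightarrow> 'g topgroup \<Rightarrow> 'h topgroup \<Rightarrow> ('g \<Rightarrow> 'h) \<Rightarrow>
    ('g set \<Rightarrow> 'g set \<Rightarrow> nat \<Rightarrow> int) \<Rightarrow> 'h set \<Rightarrow> 'h set \<Rightarrow> nat \<Rightarrow> int" where
  "Zl_map l G H f x = (\<lambda>V\<in>open_normal H. \<lambda>c\<in>rcosets\<^bsub>H\<^esub> V.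
     let U = {g \<in> carrier G. f g \<in> V} in
     \<Oplus>\<^bsub>Zl l\<^esub>d\<in>{d \<in> rcosets\<^bsub>G\<^esub> U. f ` d \<subseteq> c}. x U d)"

subsection \<open>Rationalization, \<open>\<rat>\<^sub>l\<close> and \<open>\<rat>\<^sub>l[[G]]\<close>\<close>

text \<open>\<open>M \<otimes> \<rat>\<^sub>l\<close> for a \<open>\<int>\<^sub>l\<close>-module \<open>M\<close>, realized as \<open>M[1/l]\<close>; \<open>ell_frac l M a j\<close> is \<open>a/l\<^sup>j\<close>.\<close>

definition ell_frac :: "nat \<Rightarrow> ('a, 'm) ring_scheme \<Rightarrow> 'a \<Rightarrow> nat \<Rightarrow> ('a \<times> nat) set" where
  "ell_frac l M a j = {(b, m). b \<in> carrier M \<and>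
     (\<exists>i. [(l ^ (i + m))] \<cdot>\<^bsub>M\<^esub> a = [(l ^ (i + j))] \<cdot>\<^bsub>M\<^esub> b)}"

definition rationalize :: "nat \<Rightarrow> ('a, 'm) ring_scheme \<Rightarrow> (('a \<times> nat) set) ring" where
  "rationalize l M = \<lparr>
     carrier = {ell_frac l M a j | a j. a \<in> carrier M},
     monoid.mult = (\<lambda>A B. \<Union>(a, j)\<in>A. \<Union>(b, m)\<in>B. ell_frac l M (a \<otimes>\<^bsub>M\<^esub> b) (j + m)),
     monoid.one = ell_frac l M \<one>\<^bsub>M\<^esub> 0,
     ring.zero = ell_frac l M \<zero>\<^bsub>M\<^esub> 0,
     ring.add = (\<lambda>A B. \<Union>(a, j)\<in>A. \<Union>(b, m)\<in>B.
       ell_frac l M ([(l ^ m)] \<cdot>\<^bsub>M\<^esub> a \<oplus>\<^bsub>M\<^esub> [(l ^ j)] \<cdot>\<^bsub>M\<^esub> b) (j + m))\<rparr>"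

definition rationalize_map :: "nat \<Rightarrow> ('b, 'm) ring_scheme \<Rightarrow> ('a \<Rightarrow> 'b) \<Rightarrow> ('a \<times> nat) set \<Rightarrow>
    ('b \<times> nat) set" where
  "rationalize_map l M h A = (\<Union>(a, j)\<in>A. ell_frac l M (h a) j)"

abbreviation Ql :: "nat \<Rightarrow> (((nat \<Rightarrow> int) \<times> nat) set) ring" where
  "Ql l \<equiv> rationalize l (Zl l)"

text \<open>An element \<open>a\<close> of \<open>\<int>\<^sub>l\<close> is divisible by \<open>l\<^sup>i\<close> iff \<open>a i = 0\<close>.\<close>

definition Ql_val :: "nat \<Rightarrow> ((nat \<Rightarrow> int) \<times> nat) set \<Rightarrow> ereal" where
  "Ql_val l s = Sup {ereal (real i - real j) | i j. \<exists>a. (a, j) \<in> s \<and> a i = 0}"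

type_synonym 'g Zl_elem = "'g set \<Rightarrow> 'g set \<Rightarrow> nat \<Rightarrow> int"
type_synonym 'g Ql_elem = "nat \<Rightarrow> ('g Zl_elem set \<times> nat) set"

abbreviation Ql_quot :: "nat \<Rightarrow> 'g topgroup \<Rightarrow> nat \<Rightarrow> (('g Zl_elem set \<times> nat) set) ring" where
  "Ql_quot l G n \<equiv> rationalize l (Zl_quot l G n)"

definition Ql_group_ring :: "nat \<Rightarrow> 'g topgroup \<Rightarrow> 'g Ql_elem ring" where
  "Ql_group_ring l G = \<lparr>
     carrier = {g. \<forall>n. g n \<in> carrier (Ql_quot l G n) \<and>
       rationalize_map l (Zl_quot l G n)
         (\<lambda>C. aug_pow l G n <+>\<^bsub>Zl_group_ring l G\<^esub> C) (g (Suc n)) = g n},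
     monoid.mult = (\<lambda>g h n. g n \<otimes>\<^bsub>Ql_quot l G n\<^esub> h n),
     monoid.one = (\<lambda>n. \<one>\<^bsub>Ql_quot l G n\<^esub>),
     ring.zero = (\<lambda>n. \<zero>\<^bsub>Ql_quot l G n\<^esub>),
     ring.add = (\<lambda>g h n. g n \<oplus>\<^bsub>Ql_quot l G n\<^esub> h n)\<rparr>"

text \<open>The map \<open>\<rat>\<^sub>l \<rightarrow> \<int>\<^sub>l[[G]]/I\<^sup>n \<otimes> \<rat>\<^sub>l\<close> and the structure map of the \<open>\<rat>\<^sub>l\<close>-algebra \<open>\<rat>\<^sub>l[[G]]\<close>.\<close>

definition Ql_quot_const :: "nat \<Rightarrow> 'g topgroup \<Rightarrow> nat \<Rightarrow> ((nat \<Rightarrow> int) \<times> nat) set \<Rightarrow>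
    ('g Zl_elem set \<times> nat) set" where
  "Ql_quot_const l G n = rationalize_map l (Zl_quot l G n)
     (\<lambda>a. aug_pow l G n +>\<^bsub>Zl_group_ring l G\<^esub> Zl_const l G a)"

definition Ql_const :: "nat \<Rightarrow> 'g topgroup \<Rightarrow> ((nat \<Rightarrow> int) \<times> nat) set \<Rightarrow> 'g Ql_elem" where
  "Ql_const l G s = (\<lambda>n. Ql_quot_const l G n s)"

definition Ql_scale :: "nat \<Rightarrow> 'g topgroup \<Rightarrow> ((nat \<Rightarrow> int) \<times> nat) set \<Rightarrow> 'g Ql_elem \<Rightarrow> 'g Ql_elem" where
  "Ql_scale l G s g = Ql_const l G s \<otimes>\<^bsub>Ql_group_ring l G\<^esub> g"

definition Ql_map :: "nat \<Rightarrow> 'g topgroup \<Rightarrow> 'h topgroup \<Rightarrow> ('g \<Rightarrow> 'h) \<Rightarrow> 'g Ql_elem \<Rightarrow> 'h Ql_elem" where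
  "Ql_map l G H f g = (\<lambda>n. rationalize_map l (Zl_quot l H n)
     (\<lambda>C. aug_pow l H n <+>\<^bsub>Zl_group_ring l H\<^esub> (Zl_map l G H f ` C)) (g n))"

text \<open>The augmentation of \<open>\<rat>\<^sub>l[[G]]\<close> is the component at \<open>n = 1\<close>, in \<open>\<int>\<^sub>l[[G]]/I \<otimes> \<rat>\<^sub>l = \<rat>\<^sub>l\<close>.\<close>

definition Ql_aug_ideal :: "nat \<Rightarrow> 'g topgroup \<Rightarrow> 'g Ql_elem set" where
  "Ql_aug_ideal l G = {g \<in> carrier (Ql_group_ring l G). g 1 = \<zero>\<^bsub>Ql_quot l G 1\<^esub>}"

subsection \<open>Weight filtration\<close>

text \<open>\<open>weight_filtration R I J i\<close> is \<open>W\<^sup>-\<^sup>i\<close> for \<open>i \<ge> 0\<close>; for \<open>i = 1\<close> the last summand involves \<open>W\<^sup>1 = R\<close>.\<close>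

fun weight_filtration :: "('a, 'm) ring_scheme \<Rightarrow> 'a set \<Rightarrow> 'a set \<Rightarrow> nat \<Rightarrow> 'a set" where
  "weight_filtration R I J 0 = carrier R"
| "weight_filtration R I J (Suc 0) = ideal_prod R I (carrier R) <+>\<^bsub>R\<^esub> ideal_prod R J (carrier R)"
| "weight_filtration R I J (Suc (Suc i)) =
     ideal_prod R I (weight_filtration R I J (Suc i)) <+>\<^bsub>R\<^esub>
     ideal_prod R J (weight_filtration R I J i)"

definition Ql_kernel :: "nat \<Rightarrow> 'g topgroup \<Rightarrow> 'h topgroup \<Rightarrow> ('g \<Rightarrow> 'h) \<Rightarrow> 'g Ql_elem set" where
  "Ql_kernel l G H f =
     {g \<in> carrier (Ql_group_ring l G). Ql_map l G H f g = \<zero>\<^bsub>Ql_group_ring l H\<^esub>}"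

text \<open>The endomorphism \<open>T\<close> induces multiplication by \<open>\<alpha>\<^sup>i\<close> on \<open>W i / W (i + 1)\<close> for every \<open>i\<close>.\<close>

definition acts_on_gr_by_powers :: "nat \<Rightarrow> 'g topgroup \<Rightarrow> (nat \<Rightarrow> 'g Ql_elem set) \<Rightarrow>
    ('g Ql_elem \<Rightarrow> 'g Ql_elem) \<Rightarrow> (nat \<Rightarrow> int) \<Rightarrow> bool" where
  "acts_on_gr_by_powers l G W T \<alpha> \<longleftrightarrow> (\<forall>i. \<forall>w\<in>W i.
     T w \<ominus>\<^bsub>Ql_group_ring l G\<^esub> Ql_scale l G (ell_frac l (Zl l) (\<alpha> [^]\<^bsub>Zl l\<^esub> i) 0) w \<in> W (Suc i))"

subsection \<open>Convergent group rings\<close>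

text \<open>The quotient \<open>\<rat>\<^sub>l[[G]]/I\<^sup>n\<close> is taken to be \<open>\<int>\<^sub>l[[G]]/I\<^sup>n \<otimes> \<rat>\<^sub>l\<close>, the \<open>n\<close>-th term of the inverse system
  defining \<open>\<rat>\<^sub>l[[G]]\<close> (for topologically finitely generated \<open>G\<close> the two agree); then \<open>\<pi>\<^sub>n\<close> is
  \<open>g \<mapsto> g n\<close>. As \<open>v\<^sub>n\<close> takes the value \<open>\<infinity>\<close> at \<open>0\<close>, valuations and norms are extended reals.\<close>

definition quot_val :: "nat \<Rightarrow> 'g topgroup \<Rightarrow> nat \<Rightarrow> ('g Zl_elem set \<times> nat) set \<Rightarrow> ereal" where
  "quot_val l G n g = - Inf {Ql_val l s | s. s \<in> carrier (Ql l) \<and>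
     Ql_quot_const l G n s \<otimes>\<^bsub>Ql_quot l G n\<^esub> g
       \<in> {ell_frac l (Zl_quot l G n) C 0 | C. C \<in> carrier (Zl_quot l G n)}}"

definition convergent_ring :: "nat \<Rightarrow> 'g topgroup \<Rightarrow> real \<Rightarrow> 'g Ql_elem set" where
  "convergent_ring l G r = {g \<in> carrier (Ql_group_ring l G).
     (\<lambda>n. quot_val l G n (g n) + ereal (r * real n)) \<longlonglongrightarrow> \<infinity>}"

definition ell_powr_neg :: "nat \<Rightarrow> ereal \<Rightarrow> ereal" where
  "ell_powr_neg l v = (if v = \<infinity> then 0 else if v = -\<infinity> then \<infinity>
     else ereal (real l powr - real_of_ereal v))"

definition convergent_norm :: "nat \<Rightarrow> 'g topgroup \<Rightarrow> real \<Rightarrow> 'g Ql_elem \<Rightarrow> ereal" where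
  "convergent_norm l G r g = (SUP n. ell_powr_neg l (quot_val l G n (g n) + ereal (r * real n)))"

definition eigenvectors :: "nat \<Rightarrow> 'g topgroup \<Rightarrow> real \<Rightarrow> ('g Ql_elem \<Rightarrow> 'g Ql_elem) \<Rightarrow>
    'g Ql_elem set" where
  "eigenvectors l G r T = {g \<in> convergent_ring l G r. g \<noteq> \<zero>\<^bsub>Ql_group_ring l G\<^esub> \<and>
     (\<exists>s\<in>carrier (Ql l). T g = Ql_scale l G s g)}"

definition Ql_span :: "nat \<Rightarrow> 'g topgroup \<Rightarrow> 'g Ql_elem set \<Rightarrow> 'g Ql_elem set" where
  "Ql_span l G E = {(\<Oplus>\<^bsub>Ql_group_ring l G\<^esub>i\<in>{..<m}. Ql_scale l G (s i) (e i)) | m s e.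
     s \<in> {..<m::nat} \<rightarrow> carrier (Ql l) \<and> e \<in> {..<m} \<rightarrow> E}"

definition topologically_diagonalizable :: "nat \<Rightarrow> 'g topgroup \<Rightarrow> real \<Rightarrow>
    ('g Ql_elem \<Rightarrow> 'g Ql_elem) \<Rightarrow> bool" where
  "topologically_diagonalizable l G r T \<longleftrightarrow>
     (\<forall>g\<in>convergent_ring l G r. \<forall>\<epsilon>>0. \<exists>h\<in>Ql_span l G (eigenvectors l G r T).
        convergent_norm l G r (g \<ominus>\<^bsub>Ql_group_ring l G\<^esub> h) < ereal \<epsilon>)"

section \<open>Fields\<close>

definition finitely_generated_field :: "('a, 'm) ring_scheme \<Rightarrow> bool" where
  "finitely_generated_field F \<longleftrightarrow> field F \<and>
     (\<exists>S. finite S \<and> S \<subseteq> carrier F \<and> generate_field F S = carrier F)"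

definition char_zero :: "('a, 'm) ring_scheme \<Rightarrow> bool" where
  "char_zero F \<longleftrightarrow> (\<forall>n::nat. n > 0 \<longrightarrow> [n] \<cdot>\<^bsub>F\<^esub> \<one>\<^bsub>F\<^esub> \<noteq> \<zero>\<^bsub>F\<^esub>)"

end

theory Submission
  imports Defs "HOL-Number_Theory.Residues"
begin

text \<open>
  Let \<open>I\<close> be the augmentation ideal and \<open>V\<^sub>n = \<int>\<^sub>l[[G]]/I\<^sup>n \<otimes> \<rat>\<^sub>l\<close>. The ideal \<open>J\<close> lies in \<open>I\<close>, because the
  augmentation factors through the group ring of the compactification (\<open>Ql_kernel_subset\<close>). In a product of
  elements of \<open>I\<close> and \<open>J\<close> every factor has weight at most 2, so \<open>W\<^bsup>-2n\<^esup>\<close> vanishes in \<open>V\<^sub>n\<close>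
  (\<open>weight_filtration_vanishes\<close>), and the product of \<open>\<sigma> - \<alpha>\<^sup>i\<close> over \<open>i < 2n\<close> annihilates \<open>V\<^sub>n\<close>. Since \<open>\<alpha>\<close> is
  not a root of unity, \<open>V\<^sub>n\<close> is the sum of the eigenspaces of \<open>\<sigma>\<close> for \<open>1, \<alpha>, \<dots>, \<alpha>\<^bsup>2n-1\<^esup>\<close>.

  The point is to control the denominators of the eigencomponents of an integral element. They come from
  divisions by \<open>\<alpha>\<^sup>j - \<alpha>\<^sup>i\<close>. Lifting the exponent bounds the valuation of \<open>\<alpha>\<^sup>m - 1\<close> by a constant plus that of
  \<open>m\<close> (\<open>power_minus_one_dvd_ell_power\<close>), and the valuations of \<open>1, \<dots>, M\<close> add up to at most \<open>M\<close>
  (\<open>sum_multiplicity_le\<close>). So the denominators in \<open>V\<^sub>n\<close> are at most \<open>l\<^bsup>cn\<^esup>\<close> for a constant \<open>c\<close>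
  (\<open>eigen_decomposition\<close>). Eigencomponents are unique (\<open>eigen_independent\<close>), hence compatible for varying \<open>n\<close>,
  and define eigenvectors in \<open>\<rat>\<^sub>l[[G]]\<close> (\<open>eigen_components\<close>). Because of the bound these lie in the
  convergent ring for every \<open>r > c\<close>, and for \<open>r = c + 1\<close> their span is dense
  (\<open>endo_topologically_diagonalizable\<close>).

  For this argument \<open>\<sigma>\<close> has to act on every \<open>V\<^sub>n\<close> by a \<open>\<rat>\<^sub>l\<close>-linear map that preserves integrality and is
  compatible with the projections. All maps between completed group rings are therefore described by
  push-forward along homomorphisms of finite quotient groups (\<open>push_forward_hom\<close>), which are ring
  homomorphisms compatible with augmentations. That Galois conjugation and the inclusion into the
  compactification are instances is seen on maximal pro-\<open>l\<close> quotients (\<open>max_pro_map_hom\<close>).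
\<close>

section \<open>Localization of a ring at \<open>l\<close>\<close>

context ring
begin

lemma ell_smult_ell_smult:
  assumes "a \<in> carrier R"
  shows "[(l ^ x :: nat)] \<cdot> ([(l ^ y :: nat)] \<cdot> a) = [(l ^ (x + y))] \<cdot> a"
  using assms by (simp add: add.nat_pow_pow power_add mult.commute)

lemma ell_smult_mult_ell_smult:
  assumes "a \<in> carrier R" "b \<in> carrier R"
  shows "[(l ^ x :: nat)] \<cdot> a \<otimes> [(l ^ y :: nat)] \<cdot> b = [(l ^ (x + y))] \<cdot> (a \<otimes> b)"
proof -
  have "[(l ^ x)] \<cdot> a \<otimes> [(l ^ y)] \<cdot> b = [(l ^ x)] \<cdot> (a \<otimes> [(l ^ y)] \<cdot> b)"
    using assms by (intro add_pow_ldistr) auto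
  also have "a \<otimes> [(l ^ y)] \<cdot> b = [(l ^ y)] \<cdot> (a \<otimes> b)"
    using assms by (intro add_pow_rdistr) auto
  finally show ?thesis using assms by (simp add: ell_smult_ell_smult)
qed

lemma ell_frac_refl: "a \<in> carrier R \<Longrightarrow> (a, j) \<in> ell_frac l R a j"
  by (auto simp: ell_frac_def)

text \<open>Equality of fractions is transitive even in the presence of \<open>l\<close>-torsion, because the definition
  allows both sides to be multiplied by a further power of \<open>l\<close>.\<close>

lemma ell_frac_subset:
  assumes "a \<in> carrier R" "b \<in> carrier R" "[(l ^ (i + m) :: nat)] \<cdot> a = [(l ^ (i + j))] \<cdot> b"
  shows "ell_frac l R a j \<subseteq> ell_frac l R b m"
proof clarify
  fix c p assume "(c, p) \<in> ell_frac l R a j"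
  then obtain k where c: "c \<in> carrier R" and k: "[(l ^ (k + p))] \<cdot> a = [(l ^ (k + j))] \<cdot> c"
    by (auto simp: ell_frac_def)
  have "[(l ^ ((i + k + j) + p))] \<cdot> b = [(l ^ (k + p))] \<cdot> ([(l ^ (i + j))] \<cdot> b)"
    using assms by (simp add: ell_smult_ell_smult ac_simps)
  also have "\<dots> = [(l ^ (i + m))] \<cdot> ([(l ^ (k + p))] \<cdot> a)"
    using assms(1,2) by (simp add: assms(3)[symmetric] ell_smult_ell_smult ac_simps)
  also have "\<dots> = [(l ^ ((i + k + j) + m))] \<cdot> c"
    using c by (simp add: k ell_smult_ell_smult ac_simps)
  finally show "(c, p) \<in> ell_frac l R b m"
    using c by (auto simp: ell_frac_def)
qed

lemma ell_frac_eq_iff: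
  assumes "a \<in> carrier R" "b \<in> carrier R"
  shows "ell_frac l R a j = ell_frac l R b m \<longleftrightarrow> (\<exists>i. [(l ^ (i + m))] \<cdot> a = [(l ^ (i + j))] \<cdot> b)"
proof
  assume "ell_frac l R a j = ell_frac l R b m"
  then have "(b, m) \<in> ell_frac l R a j" using assms by (simp add: ell_frac_refl)
  then show "\<exists>i. [(l ^ (i + m))] \<cdot> a = [(l ^ (i + j))] \<cdot> b" by (auto simp: ell_frac_def)
next
  assume "\<exists>i. [(l ^ (i + m))] \<cdot> a = [(l ^ (i + j))] \<cdot> b"
  then obtain i where "[(l ^ (i + m))] \<cdot> a = [(l ^ (i + j))] \<cdot> b" by auto
  then show "ell_frac l R a j = ell_frac l R b m"
    using assms ell_frac_subset[of a b l i m j] ell_frac_subset[of b a l i j m] by auto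
qed

lemma ell_frac_expand:
  assumes "a \<in> carrier R"
  shows "ell_frac l R a j = ell_frac l R ([(l ^ k)] \<cdot> a) (j + k)"
  unfolding ell_frac_eq_iff[OF assms add.nat_pow_closed[OF assms]]
  using assms by (intro exI[of _ 0]) (simp add: ell_smult_ell_smult)

lemma rationalize_carrierE:
  assumes "A \<in> carrier (rationalize l R)"
  obtains a j where "a \<in> carrier R" "A = ell_frac l R a j"
  using assms by (auto simp: rationalize_def)

lemma ell_frac_closed: "a \<in> carrier R \<Longrightarrow> ell_frac l R a j \<in> carrier (rationalize l R)"
  by (auto simp: rationalize_def)

text \<open>The operations are unions over all representatives of the two fractions. The terms of such a union
  all coincide, so that one pair of representatives computes it.\<close>

lemma rationalize_mult:
  assumes a: "a \<in> carrier R" and b: "b \<in> carrier R"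
  shows "ell_frac l R a j \<otimes>\<^bsub>rationalize l R\<^esub> ell_frac l R b m = ell_frac l R (a \<otimes> b) (j + m)"
proof -
  have eq: "ell_frac l R (a' \<otimes> b') (j' + m') = ell_frac l R (a \<otimes> b) (j + m)"
    if a': "(a', j') \<in> ell_frac l R a j" and b': "(b', m') \<in> ell_frac l R b m" for a' j' b' m'
  proof -
    obtain i where i: "a' \<in> carrier R" "[(l ^ (i + j'))] \<cdot> a = [(l ^ (i + j))] \<cdot> a'"
      using a' by (auto simp: ell_frac_def)
    obtain k where k: "b' \<in> carrier R" "[(l ^ (k + m'))] \<cdot> b = [(l ^ (k + m))] \<cdot> b'"
      using b' by (auto simp: ell_frac_def)
    have "[(l ^ ((i + j') + (k + m')))] \<cdot> (a \<otimes> b) = [(l ^ (i + j'))] \<cdot> a \<otimes> [(l ^ (k + m'))] \<cdot> b"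
      using a b by (rule ell_smult_mult_ell_smult[symmetric])
    also have "\<dots> = [(l ^ ((i + j) + (k + m)))] \<cdot> (a' \<otimes> b')"
      unfolding i k using i k by (simp only: ell_smult_mult_ell_smult)
    finally have "[(l ^ ((i + k) + (j + m)))] \<cdot> (a' \<otimes> b') = [(l ^ ((i + k) + (j' + m')))] \<cdot> (a \<otimes> b)"
      by (simp add: ac_simps)
    then show ?thesis using a b i k by (subst ell_frac_eq_iff) auto
  qed
  have "(\<Union>(b', m')\<in>ell_frac l R b m. ell_frac l R (a' \<otimes> b') (j' + m')) = ell_frac l R (a \<otimes> b) (j + m)"
    if "(a', j') \<in> ell_frac l R a j" for a' j'
    using that b by (intro SUP_eq_const) (auto simp: eq dest: ell_frac_refl[of b m l])
  then have "(\<Union>(a', j')\<in>ell_frac l R a j. \<Union>(b', m')\<in>ell_frac l R b m.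
      ell_frac l R (a' \<otimes> b') (j' + m')) = ell_frac l R (a \<otimes> b) (j + m)"
    using a by (intro SUP_eq_const) (auto dest: ell_frac_refl[of a j l])
  then show ?thesis by (simp add: rationalize_def)
qed

lemma rationalize_add_gen:
  assumes a: "a \<in> carrier R" and b: "b \<in> carrier R"
  shows "ell_frac l R a j \<oplus>\<^bsub>rationalize l R\<^esub> ell_frac l R b m =
    ell_frac l R ([(l ^ m)] \<cdot> a \<oplus> [(l ^ j)] \<cdot> b) (j + m)"
proof -
  have eq: "ell_frac l R ([(l ^ m')] \<cdot> a' \<oplus> [(l ^ j')] \<cdot> b') (j' + m') =
      ell_frac l R ([(l ^ m)] \<cdot> a \<oplus> [(l ^ j)] \<cdot> b) (j + m)"
    if a': "(a', j') \<in> ell_frac l R a j" and b': "(b', m') \<in> ell_frac l R b m" for a' j' b' m'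
  proof -
    obtain i where i: "a' \<in> carrier R" "[(l ^ (i + j'))] \<cdot> a = [(l ^ (i + j))] \<cdot> a'"
      using a' by (auto simp: ell_frac_def)
    obtain k where k: "b' \<in> carrier R" "[(l ^ (k + m'))] \<cdot> b = [(l ^ (k + m))] \<cdot> b'"
      using b' by (auto simp: ell_frac_def)
    have 1: "[(l ^ (i + k + j + m + m'))] \<cdot> a' = [(l ^ (i + k + j' + m' + m))] \<cdot> a"
      using arg_cong[OF i(2), of "\<lambda>z. [(l ^ (k + m + m'))] \<cdot> z"] i(1) a
      by (simp add: ell_smult_ell_smult ac_simps)
    have 2: "[(l ^ (i + k + j + m + j'))] \<cdot> b' = [(l ^ (i + k + j' + m' + j))] \<cdot> b"
      using arg_cong[OF k(2), of "\<lambda>z. [(l ^ (i + j + j'))] \<cdot> z"] k(1) b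
      by (simp add: ell_smult_ell_smult ac_simps)
    have "[(l ^ ((i + k) + (j + m)))] \<cdot> ([(l ^ m')] \<cdot> a' \<oplus> [(l ^ j')] \<cdot> b')
        = [(l ^ (i + k + j + m + m'))] \<cdot> a' \<oplus> [(l ^ (i + k + j + m + j'))] \<cdot> b'"
      using i k by (simp add: add.nat_pow_distrib ell_smult_ell_smult ac_simps)
    also have "\<dots> = [(l ^ ((i + k) + (j' + m')))] \<cdot> ([(l ^ m)] \<cdot> a \<oplus> [(l ^ j)] \<cdot> b)"
      unfolding 1 2 using a b by (simp add: add.nat_pow_distrib ell_smult_ell_smult ac_simps)
    finally show ?thesis using a b i k by (subst ell_frac_eq_iff) auto
  qed
  have "(\<Union>(b', m')\<in>ell_frac l R b m. ell_frac l R ([(l ^ m')] \<cdot> a' \<oplus> [(l ^ j')] \<cdot> b') (j' + m')) =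
      ell_frac l R ([(l ^ m)] \<cdot> a \<oplus> [(l ^ j)] \<cdot> b) (j + m)"
    if "(a', j') \<in> ell_frac l R a j" for a' j'
    using that b by (intro SUP_eq_const) (auto simp: eq dest: ell_frac_refl[of b m l])
  then have "(\<Union>(a', j')\<in>ell_frac l R a j. \<Union>(b', m')\<in>ell_frac l R b m.
      ell_frac l R ([(l ^ m')] \<cdot> a' \<oplus> [(l ^ j')] \<cdot> b') (j' + m')) =
      ell_frac l R ([(l ^ m)] \<cdot> a \<oplus> [(l ^ j)] \<cdot> b) (j + m)"
    using a by (intro SUP_eq_const) (auto dest: ell_frac_refl[of a j l])
  then show ?thesis by (simp add: rationalize_def)
qed

lemma rationalize_add:
  assumes "a \<in> carrier R" "b \<in> carrier R"
  shows "ell_frac l R a j \<oplus>\<^bsub>rationalize l R\<^esub> ell_frac l R b j = ell_frac l R (a \<oplus> b) j"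
proof -
  have "[(l ^ j)] \<cdot> a \<oplus> [(l ^ j)] \<cdot> b = [(l ^ j)] \<cdot> (a \<oplus> b)"
    using assms by (simp add: add.nat_pow_distrib)
  then show ?thesis
    using assms by (simp add: rationalize_add_gen ell_frac_expand[of "a \<oplus> b" l j j])
qed

lemma rationalize_one: "\<one>\<^bsub>rationalize l R\<^esub> = ell_frac l R \<one> 0"
  by (simp add: rationalize_def)

lemma rationalize_zero: "\<zero>\<^bsub>rationalize l R\<^esub> = ell_frac l R \<zero> j"
proof -
  have "ell_frac l R \<zero> 0 = ell_frac l R \<zero> j" by (subst ell_frac_expand[of _ _ _ j]) simp_all
  then show ?thesis by (simp add: rationalize_def)
qed

text \<open>The ring axioms need only be checked on fractions with a common denominator.\<close>

lemma rationalize_carrierE2: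
  assumes "A \<in> carrier (rationalize l R)" "B \<in> carrier (rationalize l R)"
  obtains a b j where "a \<in> carrier R" "b \<in> carrier R" "A = ell_frac l R a j" "B = ell_frac l R b j"
proof -
  obtain a j where a: "a \<in> carrier R" "A = ell_frac l R a j" by (rule rationalize_carrierE[OF assms(1)])
  obtain b k where b: "b \<in> carrier R" "B = ell_frac l R b k" by (rule rationalize_carrierE[OF assms(2)])
  show ?thesis
    using that[of "[(l ^ k)] \<cdot> a" "[(l ^ j)] \<cdot> b" "j + k"] a b
      ell_frac_expand[of a l j k] ell_frac_expand[of b l k j] by (simp add: add.commute)
qed

lemma rationalize_carrierE3:
  assumes "A \<in> carrier (rationalize l R)" "B \<in> carrier (rationalize l R)" "C \<in> carrier (rationalize l R)"
  obtains a b c j where "a \<in> carrier R" "b \<in> carrier R" "c \<in> carrier R"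
    "A = ell_frac l R a j" "B = ell_frac l R b j" "C = ell_frac l R c j"
proof -
  obtain a b j where a: "a \<in> carrier R" "b \<in> carrier R" "A = ell_frac l R a j" "B = ell_frac l R b j"
    by (rule rationalize_carrierE2[OF assms(1,2)])
  obtain c k where c: "c \<in> carrier R" "C = ell_frac l R c k" by (rule rationalize_carrierE[OF assms(3)])
  show ?thesis
    using that[of "[(l ^ k)] \<cdot> a" "[(l ^ k)] \<cdot> b" "[(l ^ j)] \<cdot> c" "j + k"] a c
      ell_frac_expand[of a l j k] ell_frac_expand[of b l j k] ell_frac_expand[of c l k j]
    by (simp add: add.commute)
qed

lemma rationalize_is_ring: "ring (rationalize l R)"
proof (rule ringI)
  let ?Q = "rationalize l R"
  show "abelian_group ?Q"
  proof (rule abelian_groupI)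
    fix A B assume AB: "A \<in> carrier ?Q" "B \<in> carrier ?Q"
    obtain a b j where ab: "a \<in> carrier R" "b \<in> carrier R" "A = ell_frac l R a j" "B = ell_frac l R b j"
      by (rule rationalize_carrierE2[OF AB])
    then show "A \<oplus>\<^bsub>?Q\<^esub> B \<in> carrier ?Q" by (simp add: rationalize_add ell_frac_closed)
    show "A \<oplus>\<^bsub>?Q\<^esub> B = B \<oplus>\<^bsub>?Q\<^esub> A" using ab by (simp add: rationalize_add a_comm)
    show "\<exists>Y\<in>carrier ?Q. Y \<oplus>\<^bsub>?Q\<^esub> A = \<zero>\<^bsub>?Q\<^esub>"
      using ab by (intro bexI[of _ "ell_frac l R (\<ominus> a) j"])
        (auto simp: rationalize_add ell_frac_closed l_neg rationalize_zero[of l j])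
    show "\<zero>\<^bsub>?Q\<^esub> \<oplus>\<^bsub>?Q\<^esub> A = A"
      using ab by (simp add: rationalize_zero[of l j] rationalize_add)
  next
    fix A B C assume ABC: "A \<in> carrier ?Q" "B \<in> carrier ?Q" "C \<in> carrier ?Q"
    obtain a b c j where "a \<in> carrier R" "b \<in> carrier R" "c \<in> carrier R"
      "A = ell_frac l R a j" "B = ell_frac l R b j" "C = ell_frac l R c j"
      by (rule rationalize_carrierE3[OF ABC])
    then show "A \<oplus>\<^bsub>?Q\<^esub> B \<oplus>\<^bsub>?Q\<^esub> C = A \<oplus>\<^bsub>?Q\<^esub> (B \<oplus>\<^bsub>?Q\<^esub> C)"
      by (simp add: rationalize_add a_assoc)
  qed (simp add: rationalize_zero[of l 0] ell_frac_closed)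
  show "monoid ?Q"
  proof (rule monoidI)
    fix A B assume AB: "A \<in> carrier ?Q" "B \<in> carrier ?Q"
    obtain a b j where ab: "a \<in> carrier R" "b \<in> carrier R" "A = ell_frac l R a j" "B = ell_frac l R b j"
      by (rule rationalize_carrierE2[OF AB])
    then show "A \<otimes>\<^bsub>?Q\<^esub> B \<in> carrier ?Q" by (simp add: rationalize_mult ell_frac_closed)
    show "\<one>\<^bsub>?Q\<^esub> \<otimes>\<^bsub>?Q\<^esub> A = A" "A \<otimes>\<^bsub>?Q\<^esub> \<one>\<^bsub>?Q\<^esub> = A"
      using ab by (simp_all add: rationalize_mult rationalize_one)
  next
    fix A B C assume ABC: "A \<in> carrier ?Q" "B \<in> carrier ?Q" "C \<in> carrier ?Q"
    obtain a b c j where "a \<in> carrier R" "b \<in> carrier R" "c \<in> carrier R"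
      "A = ell_frac l R a j" "B = ell_frac l R b j" "C = ell_frac l R c j"
      by (rule rationalize_carrierE3[OF ABC])
    then show "A \<otimes>\<^bsub>?Q\<^esub> B \<otimes>\<^bsub>?Q\<^esub> C = A \<otimes>\<^bsub>?Q\<^esub> (B \<otimes>\<^bsub>?Q\<^esub> C)"
      by (simp add: rationalize_mult m_assoc ac_simps)
  qed (simp add: rationalize_one ell_frac_closed)
  fix A B C assume ABC: "A \<in> carrier ?Q" "B \<in> carrier ?Q" "C \<in> carrier ?Q"
  obtain a b c j where "a \<in> carrier R" "b \<in> carrier R" "c \<in> carrier R"
    "A = ell_frac l R a j" "B = ell_frac l R b j" "C = ell_frac l R c j"
    by (rule rationalize_carrierE3[OF ABC])
  then show "(A \<oplus>\<^bsub>?Q\<^esub> B) \<otimes>\<^bsub>?Q\<^esub> C = A \<otimes>\<^bsub>?Q\<^esub> C \<oplus>\<^bsub>?Q\<^esub> B \<otimes>\<^bsub>?Q\<^esub> C"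
    "C \<otimes>\<^bsub>?Q\<^esub> (A \<oplus>\<^bsub>?Q\<^esub> B) = C \<otimes>\<^bsub>?Q\<^esub> A \<oplus>\<^bsub>?Q\<^esub> C \<otimes>\<^bsub>?Q\<^esub> B"
    by (simp_all add: rationalize_mult rationalize_add l_distr r_distr)
qed

lemma ell_frac_minus:
  assumes "a \<in> carrier R"
  shows "\<ominus>\<^bsub>rationalize l R\<^esub> ell_frac l R a j = ell_frac l R (\<ominus> a) j"
proof -
  interpret Q: ring "rationalize l R" by (rule rationalize_is_ring)
  show ?thesis
    using assms by (intro Q.minus_equality)
      (simp_all add: rationalize_add l_neg ell_frac_closed rationalize_zero[of l j])
qed

lemma ell_frac_diff:
  assumes "a \<in> carrier R" "b \<in> carrier R"
  shows "ell_frac l R a j \<ominus>\<^bsub>rationalize l R\<^esub> ell_frac l R b j = ell_frac l R (a \<ominus> b) j"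
  using assms by (simp add: a_minus_def ell_frac_minus rationalize_add)

end

lemma (in cring) rationalize_is_cring: "cring (rationalize l R)"
proof -
  interpret Q: ring "rationalize l R" by (rule rationalize_is_ring)
  show ?thesis
  proof unfold_locales
    fix A B assume AB: "A \<in> carrier (rationalize l R)" "B \<in> carrier (rationalize l R)"
    obtain a b j where "a \<in> carrier R" "b \<in> carrier R" "A = ell_frac l R a j" "B = ell_frac l R b j"
      by (rule rationalize_carrierE2[OF AB])
    then show "A \<otimes>\<^bsub>rationalize l R\<^esub> B = B \<otimes>\<^bsub>rationalize l R\<^esub> A"
      by (simp add: rationalize_mult m_comm)
  qed
qed

context ring_hom_ring
begin

lemma hom_add_pow_nat: "a \<in> carrier R \<Longrightarrow> h ([(n::nat)] \<cdot>\<^bsub>R\<^esub> a) = [n] \<cdot>\<^bsub>S\<^esub> h a"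
  by (induction n) auto

lemma rationalize_map_ell_frac:
  assumes a: "a \<in> carrier R"
  shows "rationalize_map l S h (ell_frac l R a j) = ell_frac l S (h a) j"
proof -
  have "ell_frac l S (h b) m = ell_frac l S (h a) j" if mem: "(b, m) \<in> ell_frac l R a j" for b m
  proof -
    obtain i where b: "b \<in> carrier R" and i: "[(l ^ (i + m))] \<cdot>\<^bsub>R\<^esub> a = [(l ^ (i + j))] \<cdot>\<^bsub>R\<^esub> b"
      using mem by (auto simp: ell_frac_def)
    have "[(l ^ (i + m))] \<cdot>\<^bsub>S\<^esub> h a = [(l ^ (i + j))] \<cdot>\<^bsub>S\<^esub> h b"
      using arg_cong[OF i, of h] a b by (simp add: hom_add_pow_nat)
    then show ?thesis using a b by (subst S.ell_frac_eq_iff) (auto intro: exI[of _ i])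
  qed
  then show ?thesis
    unfolding rationalize_map_def
    using a by (intro SUP_eq_const) (auto dest: R.ell_frac_refl[of a j l])
qed

lemma rationalize_map_hom:
  "ring_hom_ring (rationalize l R) (rationalize l S) (rationalize_map l S h)"
proof (rule ring_hom_ringI2)
  show "rationalize_map l S h \<in> ring_hom (rationalize l R) (rationalize l S)"
  proof (rule ring_hom_memI)
    fix A B assume AB: "A \<in> carrier (rationalize l R)" "B \<in> carrier (rationalize l R)"
    obtain a b j where "a \<in> carrier R" "b \<in> carrier R" "A = ell_frac l R a j" "B = ell_frac l R b j"
      by (rule R.rationalize_carrierE2[OF AB])
    then show "rationalize_map l S h (A \<otimes>\<^bsub>rationalize l R\<^esub> B) =
        rationalize_map l S h A \<otimes>\<^bsub>rationalize l S\<^esub> rationalize_map l S h B"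
      "rationalize_map l S h (A \<oplus>\<^bsub>rationalize l R\<^esub> B) =
        rationalize_map l S h A \<oplus>\<^bsub>rationalize l S\<^esub> rationalize_map l S h B"
      "rationalize_map l S h A \<in> carrier (rationalize l S)"
      by (simp_all add: R.rationalize_mult R.rationalize_add rationalize_map_ell_frac
          S.rationalize_mult S.rationalize_add S.ell_frac_closed)
  qed (simp add: R.rationalize_one S.rationalize_one rationalize_map_ell_frac)
qed (rule R.rationalize_is_ring S.rationalize_is_ring)+

end

section \<open>The \<open>l\<close>-adic integers\<close>

text \<open>Only multiples of \<open>p\<close> contribute, and \<open>p j\<close> has one factor \<open>p\<close> more than \<open>j\<close>. Hence the sum up to
  \<open>M\<close> is \<open>\<lfloor>M/p\<rfloor>\<close> plus the sum up to \<open>\<lfloor>M/p\<rfloor>\<close>.\<close>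

lemma sum_multiplicity_le:
  fixes p :: nat
  assumes p: "prime p"
  shows "(\<Sum>m=1..M. multiplicity p m) \<le> M"
proof (induction M rule: less_induct)
  case (less M)
  show ?case
  proof (cases "M = 0")
    case False
    have l1: "1 < p" using p by (rule prime_gt_1_nat)
    have lt: "M div p < M" using False l1 by simp
    have set_eq: "{m \<in> {1..M}. p dvd m} = (*) p ` {1..M div p}"
    proof (intro equalityI subsetI)
      fix m assume m: "m \<in> {m \<in> {1..M}. p dvd m}"
      then obtain j where "m = p * j" by blast
      with m have j: "m = p * j" "1 \<le> m" "m \<le> M" by auto
      then have "1 \<le> j" by (cases j) auto
      moreover have "j \<le> M div p" using j l1 by (metis div_le_mono nonzero_mult_div_cancel_left not_one_less_zero)
      ultimately show "m \<in> (*) p ` {1..M div p}" using j by auto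
    next
      fix m assume "m \<in> (*) p ` {1..M div p}"
      then obtain j where "m = p * j" "j \<in> {1..M div p}" by (rule imageE)
      then have j: "m = p * j" "1 \<le> j" "j \<le> M div p" by auto
      have "p * j \<le> M" using mult_le_mono2[OF j(3), of p] times_div_less_eq_dividend[of p M] by linarith
      then show "m \<in> {m \<in> {1..M}. p dvd m}" using j l1 by auto
    qed
    have "(\<Sum>m=1..M. multiplicity p m) = (\<Sum>m\<in>{m \<in> {1..M}. p dvd m}. multiplicity p m)"
      by (intro sum.mono_neutral_right) (auto simp: not_dvd_imp_multiplicity_0)
    also have "\<dots> = (\<Sum>j=1..M div p. multiplicity p (p * j))"
      unfolding set_eq using l1 by (subst sum.reindex) (auto simp: inj_on_def)
    also have "\<dots> = (\<Sum>j=1..M div p. Suc (multiplicity p j))"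
      using p l1 by (intro sum.cong refl) (auto intro!: multiplicity_times_same)
    also have "\<dots> = M div p + (\<Sum>j=1..M div p. multiplicity p j)"
      using sum.distrib[of "\<lambda>_. 1" "multiplicity p" "{1..M div p}"] by simp
    also have "\<dots> \<le> M div p + M div p" using less.IH[OF lt] by simp
    also have "\<dots> \<le> M"
      using mult_le_mono1[of 2 p "M div p"] times_div_less_eq_dividend[of p M] l1 by linarith
    finally show ?thesis .
  qed simp
qed

lemma Zl_simps:
  "x \<in> carrier (Zl l) \<longleftrightarrow> (\<forall>n. 0 \<le> x n \<and> x n < int l ^ n \<and> x (Suc n) mod int l ^ n = x n)"
  "(x \<otimes>\<^bsub>Zl l\<^esub> y) n = (x n * y n) mod int l ^ n"
  "\<one>\<^bsub>Zl l\<^esub> n = 1 mod int l ^ n"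
  "\<zero>\<^bsub>Zl l\<^esub> n = 0"
  "(x \<oplus>\<^bsub>Zl l\<^esub> y) n = (x n + y n) mod int l ^ n"
  by (simp_all add: Zl_def)

lemma Zl_mod [simp]: "x \<in> carrier (Zl l) \<Longrightarrow> x n mod int l ^ n = x n"
  by (simp add: Zl_simps)

lemma Zl_carrierI:
  assumes "l > 0" "\<And>n. x (Suc n) mod int l ^ n = y n mod int l ^ n" "\<And>n. x n = y n mod int l ^ n"
  shows "x \<in> carrier (Zl l)"
  using assms by (auto simp: Zl_simps)

lemma Zl_mod_le:
  assumes x: "x \<in> carrier (Zl l)" and "m \<le> n"
  shows "x n mod int l ^ m = x m"
  using \<open>m \<le> n\<close>
proof (induction n rule: dec_induct)
  case base show ?case using x by simp
next
  case (step n)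
  have "x (Suc n) mod int l ^ m = (x (Suc n) mod int l ^ n) mod int l ^ m"
    using step by (simp add: mod_mod_cancel le_imp_power_dvd)
  then show ?case using x step by (simp add: Zl_simps)
qed

lemma Zl_eqI:
  assumes "x \<in> carrier (Zl l)" "y \<in> carrier (Zl l)" "\<And>n. [x n = y n] (mod int l ^ n)"
  shows "x = y"
proof
  fix n show "x n = y n" using assms(3)[of n] assms(1,2) by (simp add: cong_def)
qed

locale prime_number =
  fixes l :: nat
  assumes prime_l: "prime l"
begin

lemma l_gt: "l > 0" "l > 1"
  using prime_gt_0_nat[OF prime_l] prime_gt_1_nat[OF prime_l] by auto

lemma Zl_compat:
  assumes "\<And>n. [f (Suc n) = f n] (mod int l ^ n)"
  shows "(\<lambda>n. f n mod int l ^ n) \<in> carrier (Zl l)"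
proof (rule Zl_carrierI[where y = f])
  fix n
  show "f (Suc n) mod int l ^ Suc n mod int l ^ n = f n mod int l ^ n"
    using assms[of n] by (simp add: mod_mod_cancel le_imp_power_dvd cong_def)
qed (use l_gt in auto)

lemma Zl_cong_Suc: "x \<in> carrier (Zl l) \<Longrightarrow> [x (Suc n) = x n] (mod int l ^ n)"
  by (simp add: Zl_simps cong_def)

lemma Zl_is_cring: "cring (Zl l)"
proof (rule cringI)
  show "abelian_group (Zl l)"
  proof (rule abelian_groupI)
    fix x y assume xy: "x \<in> carrier (Zl l)" "y \<in> carrier (Zl l)"
    show "x \<oplus>\<^bsub>Zl l\<^esub> y \<in> carrier (Zl l)"
      using Zl_compat[of "\<lambda>n. x n + y n"] cong_add[OF Zl_cong_Suc Zl_cong_Suc, OF xy]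
      by (simp add: Zl_def)
    show "\<exists>z\<in>carrier (Zl l). z \<oplus>\<^bsub>Zl l\<^esub> x = \<zero>\<^bsub>Zl l\<^esub>"
    proof (rule bexI)
      show "(\<lambda>n. (- x n) mod int l ^ n) \<oplus>\<^bsub>Zl l\<^esub> x = \<zero>\<^bsub>Zl l\<^esub>"
        by (rule ext) (simp add: Zl_simps mod_simps)
      show "(\<lambda>n. (- x n) mod int l ^ n) \<in> carrier (Zl l)"
        using Zl_cong_Suc[OF xy(1)] by (intro Zl_compat) (simp add: cong_minus_minus_iff)
    qed
  qed (auto simp: fun_eq_iff Zl_simps mod_simps ac_simps l_gt)
  show "comm_monoid (Zl l)"
  proof (rule comm_monoidI)
    fix x y assume xy: "x \<in> carrier (Zl l)" "y \<in> carrier (Zl l)"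
    show "x \<otimes>\<^bsub>Zl l\<^esub> y \<in> carrier (Zl l)"
      using Zl_compat[of "\<lambda>n. x n * y n"] cong_mult[OF Zl_cong_Suc Zl_cong_Suc, OF xy]
      by (simp add: Zl_def)
  next
    show "\<one>\<^bsub>Zl l\<^esub> \<in> carrier (Zl l)" using Zl_compat[of "\<lambda>_. 1"] by (simp add: Zl_def)
  next
    fix x y z show "x \<otimes>\<^bsub>Zl l\<^esub> y \<otimes>\<^bsub>Zl l\<^esub> z = x \<otimes>\<^bsub>Zl l\<^esub> (y \<otimes>\<^bsub>Zl l\<^esub> z)"
      by (rule ext) (simp add: Zl_simps mod_simps ac_simps)
  next
    fix x assume "x \<in> carrier (Zl l)"
    then show "\<one>\<^bsub>Zl l\<^esub> \<otimes>\<^bsub>Zl l\<^esub> x = x" by (intro ext) (simp add: Zl_simps(2,3) mod_simps)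
  next
    fix x y show "x \<otimes>\<^bsub>Zl l\<^esub> y = y \<otimes>\<^bsub>Zl l\<^esub> x" by (rule ext) (simp add: Zl_simps ac_simps)
  qed
  fix x y z show "(x \<oplus>\<^bsub>Zl l\<^esub> y) \<otimes>\<^bsub>Zl l\<^esub> z = x \<otimes>\<^bsub>Zl l\<^esub> z \<oplus>\<^bsub>Zl l\<^esub> y \<otimes>\<^bsub>Zl l\<^esub> z"
    by (rule ext) (simp add: Zl_simps mod_simps distrib_right)
qed

sublocale Zl: cring "Zl l"
  by (rule Zl_is_cring)

lemma Zl_minus:
  assumes "x \<in> carrier (Zl l)"
  shows "(\<ominus>\<^bsub>Zl l\<^esub> x) n = (- x n) mod int l ^ n"
proof -
  have "(\<lambda>n. (- x n) mod int l ^ n) \<in> carrier (Zl l)"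
    using Zl_cong_Suc[OF assms] by (intro Zl_compat) (simp add: cong_minus_minus_iff)
  moreover have "(\<lambda>n. (- x n) mod int l ^ n) \<oplus>\<^bsub>Zl l\<^esub> x = \<zero>\<^bsub>Zl l\<^esub>"
    by (rule ext) (simp add: Zl_simps mod_simps)
  ultimately have "\<ominus>\<^bsub>Zl l\<^esub> x = (\<lambda>n. (- x n) mod int l ^ n)"
    using assms by (intro Zl.minus_equality) auto
  then show ?thesis by simp
qed

lemma Zl_add_pow: "([(k::nat)] \<cdot>\<^bsub>Zl l\<^esub> x) n = (int k * x n) mod int l ^ n"
  by (induction k) (auto simp: Zl_simps(4,5) mod_simps algebra_simps)

lemma finsum_Zl:
  assumes "f \<in> A \<rightarrow> carrier (Zl l)" "finite A"
  shows "(\<Oplus>\<^bsub>Zl l\<^esub>a\<in>A. f a) n = (\<Sum>a\<in>A. f a n) mod int l ^ n"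
  using assms(2,1) by (induction A) (auto simp: Zl_simps(4,5) mod_simps)

text \<open>Division by \<open>l\<^sup>i\<close> costs \<open>i\<close> digits of precision: the \<open>n\<close>-th term of the quotient comes from
  the term with index \<open>n + i\<close>.\<close>

lemma Zl_dvdE:
  assumes x: "x \<in> carrier (Zl l)" and xi: "x i = 0"
  obtains y where "y \<in> carrier (Zl l)" "x = [(l ^ i :: nat)] \<cdot>\<^bsub>Zl l\<^esub> y"
proof -
  define z where "z n = x (n + i) div int l ^ i" for n
  have z: "x (n + i) = int l ^ i * z n" for n
  proof -
    have "x (n + i) mod int l ^ i = 0" using Zl_mod_le[OF x, of i "n + i"] xi by simp
    then show ?thesis unfolding z_def by (simp add: mod_eq_0_iff_dvd)
  qed
  have cong: "[z (Suc n) = z n] (mod int l ^ n)" for n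
  proof -
    have "[int l ^ i * z (Suc n) = int l ^ i * z n] (mod int l ^ i * int l ^ n)"
      using Zl_cong_Suc[OF x, of "n + i"] by (simp add: z[symmetric] power_add[symmetric] add.commute)
    then show ?thesis using l_gt by (simp add: cong_iff_dvd_diff right_diff_distrib[symmetric])
  qed
  show ?thesis
  proof
    show y: "(\<lambda>n. z n mod int l ^ n) \<in> carrier (Zl l)" using cong by (rule Zl_compat)
    show "x = [(l ^ i)] \<cdot>\<^bsub>Zl l\<^esub> (\<lambda>n. z n mod int l ^ n)"
    proof (rule Zl_eqI[OF x])
      fix n
      have "x n = x (n + i) mod int l ^ n" using Zl_mod_le[OF x, of n "n + i"] by simp
      then show "[x n = ([(l ^ i)] \<cdot>\<^bsub>Zl l\<^esub> (\<lambda>n. z n mod int l ^ n)) n] (mod int l ^ n)"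
        by (simp add: z Zl_add_pow cong_def mod_simps)
    qed (use y in auto)
  qed
qed

text \<open>An inverse exists modulo every \<open>l\<^sup>n\<close>; being unique there, these inverses are coherent.\<close>

lemma Zl_UnitsI:
  assumes x: "x \<in> carrier (Zl l)" and x1: "x 1 \<noteq> 0"
  shows "x \<in> Units (Zl l)"
proof -
  have cop: "coprime (x n) (int l ^ n)" for n
  proof (cases n)
    case (Suc m)
    have "x n mod int l = x 1" using Zl_mod_le[OF x, of 1 n] Suc by simp
    then have "\<not> int l dvd x n" using x1 by (auto simp: dvd_eq_mod_eq_0)
    then show ?thesis using prime_l by (simp add: prime_imp_coprime coprime_commute)
  qed simp
  have "\<exists>y. [x n * y = 1] (mod int l ^ n)" for n using cong_solve_coprime_int[OF cop] .
  then obtain y where y: "\<And>n. [x n * y n = 1] (mod int l ^ n)" by metis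
  have "[y (Suc n) = y n] (mod int l ^ n)" for n
  proof -
    have 1: "[x (Suc n) * y (Suc n) = 1] (mod int l ^ n)"
      using y[of "Suc n"] by (rule cong_dvd_modulus) (simp add: le_imp_power_dvd)
    have "[x n * y (Suc n) = x (Suc n) * y (Suc n)] (mod int l ^ n)"
      using Zl_cong_Suc[OF x] by (intro cong_mult) (auto intro: cong_sym)
    then have "[x n * y (Suc n) = x n * y n] (mod int l ^ n)"
      using 1 y[of n] by (meson cong_sym cong_trans)
    then show ?thesis using cop by (simp add: cong_mult_lcancel)
  qed
  then have yc: "(\<lambda>n. y n mod int l ^ n) \<in> carrier (Zl l)" by (rule Zl_compat)
  have "x \<otimes>\<^bsub>Zl l\<^esub> (\<lambda>n. y n mod int l ^ n) = \<one>\<^bsub>Zl l\<^esub>"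
    using y by (auto simp: fun_eq_iff Zl_simps(2,3) mod_simps cong_def)
  then show ?thesis using x yc Zl.m_comm[OF x yc] unfolding Units_def by auto
qed

lemma Zl_one_at: "n > 0 \<Longrightarrow> \<one>\<^bsub>Zl l\<^esub> n = 1"
  using l_gt by (simp add: Zl_simps(3) one_less_power)

text \<open>The valuation is the largest index at which the sequence vanishes.\<close>

lemma Zl_nonzeroE:
  assumes x: "x \<in> carrier (Zl l)" and "x \<noteq> \<zero>\<^bsub>Zl l\<^esub>"
  obtains k u where "u \<in> Units (Zl l)" "x = [(l ^ k :: nat)] \<cdot>\<^bsub>Zl l\<^esub> u" "x k = 0"
proof -
  obtain n where n: "x n \<noteq> 0" using assms(2) by (auto simp: fun_eq_iff Zl_simps(4))
  have x0: "x 0 = 0" using x[unfolded Zl_simps(1), THEN spec[of _ 0]] by simp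
  define k where "k = (GREATEST k. x k = 0)"
  have bd: "m \<le> n" if "x m = 0" for m
  proof (rule ccontr)
    assume "\<not> m \<le> n"
    then have "x m mod int l ^ n = x n" using x by (intro Zl_mod_le) auto
    then show False using that n by simp
  qed
  have k: "x k = 0" unfolding k_def using x0 bd by (rule GreatestI_nat)
  have Sk: "x (Suc k) \<noteq> 0" using bd Greatest_le_nat[of "\<lambda>k. x k = 0" "Suc k" n] unfolding k_def by fastforce
  obtain u where u: "u \<in> carrier (Zl l)" "x = [(l ^ k)] \<cdot>\<^bsub>Zl l\<^esub> u" using Zl_dvdE[OF x k] .
  have "u 1 \<noteq> 0"
  proof
    assume "u 1 = 0"
    then obtain w where "w \<in> carrier (Zl l)" "u = [(l ^ 1)] \<cdot>\<^bsub>Zl l\<^esub> w" by (rule Zl_dvdE[OF u(1)])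
    then have "x = [(l ^ Suc k)] \<cdot>\<^bsub>Zl l\<^esub> w" using u Zl.ell_smult_ell_smult[of w l k 1] by simp
    then show False using Sk by (simp add: Zl_add_pow del: power_Suc)
  qed
  then show ?thesis using that[of u k] u k Zl_UnitsI by blast
qed

subsection \<open>Lifting the exponent\<close>

text \<open>The cofactor is the geometric sum \<open>1 + b + \<dots> + b\<^bsup>m-1\<^esup>\<close>, whose \<open>m\<close> terms are all congruent to 1.\<close>

lemma pow_minus_one_factor:
  assumes b: "b \<in> carrier (Zl l)" and be: "b e = 1 mod int l ^ e"
  obtains s where "s \<in> carrier (Zl l)"
    "b [^]\<^bsub>Zl l\<^esub> m \<ominus>\<^bsub>Zl l\<^esub> \<one>\<^bsub>Zl l\<^esub> = (b \<ominus>\<^bsub>Zl l\<^esub> \<one>\<^bsub>Zl l\<^esub>) \<otimes>\<^bsub>Zl l\<^esub> s"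
    "s e = int m mod int l ^ e"
proof -
  have "\<exists>s\<in>carrier (Zl l). b [^]\<^bsub>Zl l\<^esub> m \<ominus>\<^bsub>Zl l\<^esub> \<one>\<^bsub>Zl l\<^esub> =
      (b \<ominus>\<^bsub>Zl l\<^esub> \<one>\<^bsub>Zl l\<^esub>) \<otimes>\<^bsub>Zl l\<^esub> s \<and> s e = int m mod int l ^ e"
  proof (induction m)
    case 0
    show ?case
    proof (intro bexI conjI)
      show "b [^]\<^bsub>Zl l\<^esub> (0::nat) \<ominus>\<^bsub>Zl l\<^esub> \<one>\<^bsub>Zl l\<^esub> = (b \<ominus>\<^bsub>Zl l\<^esub> \<one>\<^bsub>Zl l\<^esub>) \<otimes>\<^bsub>Zl l\<^esub> \<zero>\<^bsub>Zl l\<^esub>"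
        using b by (simp add: a_minus_def Zl.r_neg)
      show "\<zero>\<^bsub>Zl l\<^esub> e = int 0 mod int l ^ e" by (simp add: Zl_simps(4))
    qed simp
  next
    case (Suc m)
    then obtain s where s: "s \<in> carrier (Zl l)"
      "b [^]\<^bsub>Zl l\<^esub> m \<ominus>\<^bsub>Zl l\<^esub> \<one>\<^bsub>Zl l\<^esub> = (b \<ominus>\<^bsub>Zl l\<^esub> \<one>\<^bsub>Zl l\<^esub>) \<otimes>\<^bsub>Zl l\<^esub> s" "s e = int m mod int l ^ e"
      by auto
    have pw: "b [^]\<^bsub>Zl l\<^esub> m = (b \<ominus>\<^bsub>Zl l\<^esub> \<one>\<^bsub>Zl l\<^esub>) \<otimes>\<^bsub>Zl l\<^esub> s \<oplus>\<^bsub>Zl l\<^esub> \<one>\<^bsub>Zl l\<^esub>"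
      using b s(1) by (simp add: s(2)[symmetric]) (simp add: a_minus_def Zl.a_assoc Zl.l_neg)
    have "b [^]\<^bsub>Zl l\<^esub> Suc m \<ominus>\<^bsub>Zl l\<^esub> \<one>\<^bsub>Zl l\<^esub> =
        (b \<ominus>\<^bsub>Zl l\<^esub> \<one>\<^bsub>Zl l\<^esub>) \<otimes>\<^bsub>Zl l\<^esub> (b \<otimes>\<^bsub>Zl l\<^esub> s \<oplus>\<^bsub>Zl l\<^esub> \<one>\<^bsub>Zl l\<^esub>)"
      using b s(1) by (simp add: pw) algebra
    moreover have "(b \<otimes>\<^bsub>Zl l\<^esub> s \<oplus>\<^bsub>Zl l\<^esub> \<one>\<^bsub>Zl l\<^esub>) e = int (Suc m) mod int l ^ e"
      by (simp add: Zl_simps(2,3,5) be s(3) mod_simps add.commute)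
    ultimately show ?case using b s(1) by (intro bexI[of _ "b \<otimes>\<^bsub>Zl l\<^esub> s \<oplus>\<^bsub>Zl l\<^esub> \<one>\<^bsub>Zl l\<^esub>"]) auto
  qed
  then show ?thesis using that by auto
qed

lemma Zl_pow_at: "(b [^]\<^bsub>Zl l\<^esub> (m::nat)) n = (b n ^ m) mod int l ^ n"
  by (induction m) (auto simp: Zl_simps(2,3) mod_simps mult.commute)

text \<open>The valuation of \<open>b\<^sup>m - 1\<close> exceeds that of \<open>b - 1\<close> by at most that of \<open>m\<close>. If \<open>l\<close> does not divide \<open>m\<close>,
  the geometric sum is congruent to \<open>m\<close> modulo \<open>l\<close>, a unit; for \<open>m = l\<close> it is congruent to \<open>l\<close> modulo
  \<open>l\<^sup>2\<close>, a unit times \<open>l\<close>. The last point requires \<open>b\<close> to be 1 modulo \<open>l\<^sup>2\<close>, and then holds for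
  \<open>l = 2\<close> as well.\<close>

lemma lifting_the_exponent:
  assumes "b \<in> carrier (Zl l)" "b 2 = 1" "m > 0"
  shows "\<exists>t\<in>carrier (Zl l). (b [^]\<^bsub>Zl l\<^esub> m \<ominus>\<^bsub>Zl l\<^esub> \<one>\<^bsub>Zl l\<^esub>) \<otimes>\<^bsub>Zl l\<^esub> t =
    [(l ^ multiplicity l m)] \<cdot>\<^bsub>Zl l\<^esub> (b \<ominus>\<^bsub>Zl l\<^esub> \<one>\<^bsub>Zl l\<^esub>)"
  using assms
proof (induction m arbitrary: b rule: less_induct)
  case (less m)
  note b = less.prems(1)
  have b1: "b 1 = 1" using Zl_mod_le[OF b, of 1 2] less.prems(2) l_gt by simp
  define d where "d = b \<ominus>\<^bsub>Zl l\<^esub> \<one>\<^bsub>Zl l\<^esub>"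
  have d: "d \<in> carrier (Zl l)" using b by (simp add: d_def)
  show ?case
  proof (cases "l dvd m")
    case False
    obtain s where s: "s \<in> carrier (Zl l)"
      "b [^]\<^bsub>Zl l\<^esub> m \<ominus>\<^bsub>Zl l\<^esub> \<one>\<^bsub>Zl l\<^esub> = d \<otimes>\<^bsub>Zl l\<^esub> s" "s 1 = int m mod int l ^ 1"
      using pow_minus_one_factor[OF b, of 1 m] b1 l_gt unfolding d_def by auto
    have "s \<in> Units (Zl l)"
      using s False by (intro Zl_UnitsI) (auto simp: zmod_int[symmetric] dvd_eq_mod_eq_0)
    then have "(b [^]\<^bsub>Zl l\<^esub> m \<ominus>\<^bsub>Zl l\<^esub> \<one>\<^bsub>Zl l\<^esub>) \<otimes>\<^bsub>Zl l\<^esub> inv\<^bsub>Zl l\<^esub> s = d"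
      using s d by (simp add: Zl.m_assoc)
    then show ?thesis
      using \<open>s \<in> Units (Zl l)\<close> False d
      by (intro bexI[of _ "inv\<^bsub>Zl l\<^esub> s"]) (simp_all add: not_dvd_imp_multiplicity_0 d_def)
  next
    case True
    then obtain m' where m': "m = l * m'" by blast
    have m'0: "m' > 0" "m' < m" using less.prems(3) m' l_gt by auto
    define b' where "b' = b [^]\<^bsub>Zl l\<^esub> l"
    have b': "b' \<in> carrier (Zl l)" using b by (simp add: b'_def)
    have "b' 2 = 1" using Zl_one_at[of 2] l_gt less.prems(2)
      by (simp add: b'_def Zl_pow_at Zl_simps(3))
    then obtain t where t: "t \<in> carrier (Zl l)"
      "(b' [^]\<^bsub>Zl l\<^esub> m' \<ominus>\<^bsub>Zl l\<^esub> \<one>\<^bsub>Zl l\<^esub>) \<otimes>\<^bsub>Zl l\<^esub> t =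
        [(l ^ multiplicity l m')] \<cdot>\<^bsub>Zl l\<^esub> (b' \<ominus>\<^bsub>Zl l\<^esub> \<one>\<^bsub>Zl l\<^esub>)"
      using less.IH[OF m'0(2) b'] m'0 by auto
    have "b 2 = 1 mod int l ^ 2" using less.prems(2) Zl_one_at[of 2] by (simp add: Zl_simps(3))
    then obtain s where s: "s \<in> carrier (Zl l)"
      "b' \<ominus>\<^bsub>Zl l\<^esub> \<one>\<^bsub>Zl l\<^esub> = d \<otimes>\<^bsub>Zl l\<^esub> s" "s 2 = int l mod int l ^ 2"
      unfolding b'_def d_def by (rule pow_minus_one_factor[OF b])
    have s2: "s 2 = int l" using s(3) l_gt by (simp add: power2_eq_square)
    have "s 1 = 0" using Zl_mod_le[OF s(1), of 1 2] s2 by simp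
    then obtain u where u: "u \<in> carrier (Zl l)" "s = [(l ^ 1)] \<cdot>\<^bsub>Zl l\<^esub> u" by (rule Zl_dvdE[OF s(1)])
    \<comment> \<open>\<open>s\<close> has valuation exactly 1\<close>
    have "u 1 \<noteq> 0"
    proof
      assume "u 1 = 0"
      then obtain w where w: "w \<in> carrier (Zl l)" "u = [(l ^ 1)] \<cdot>\<^bsub>Zl l\<^esub> w" by (rule Zl_dvdE[OF u(1)])
      then have "s = [(l ^ 2)] \<cdot>\<^bsub>Zl l\<^esub> w" using u Zl.ell_smult_ell_smult[of w l 1 1]
        by (simp add: numeral_2_eq_2)
      then show False using s2 l_gt by (simp add: Zl_add_pow)
    qed
    then have uU: "u \<in> Units (Zl l)" using u by (intro Zl_UnitsI)
    have iu: "inv\<^bsub>Zl l\<^esub> u \<in> carrier (Zl l)" "u \<otimes>\<^bsub>Zl l\<^esub> inv\<^bsub>Zl l\<^esub> u = \<one>\<^bsub>Zl l\<^esub>" using uU by auto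
    define v where "v = multiplicity l m'"
    have v: "multiplicity l m = v + 1"
      using m' m'0 l_gt by (simp add: v_def multiplicity_times_same)
    have pw: "b [^]\<^bsub>Zl l\<^esub> m = b' [^]\<^bsub>Zl l\<^esub> m'" using b by (simp add: b'_def m' Zl.nat_pow_pow)
    have bm: "b' [^]\<^bsub>Zl l\<^esub> m' \<ominus>\<^bsub>Zl l\<^esub> \<one>\<^bsub>Zl l\<^esub> \<in> carrier (Zl l)" using b' by simp
    have "(b [^]\<^bsub>Zl l\<^esub> m \<ominus>\<^bsub>Zl l\<^esub> \<one>\<^bsub>Zl l\<^esub>) \<otimes>\<^bsub>Zl l\<^esub> (t \<otimes>\<^bsub>Zl l\<^esub> inv\<^bsub>Zl l\<^esub> u) =
        [(l ^ v)] \<cdot>\<^bsub>Zl l\<^esub> (d \<otimes>\<^bsub>Zl l\<^esub> s) \<otimes>\<^bsub>Zl l\<^esub> inv\<^bsub>Zl l\<^esub> u"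
      unfolding pw using bm t iu by (simp add: Zl.m_assoc[symmetric] s(2) v_def)
    also have "\<dots> = [(l ^ v)] \<cdot>\<^bsub>Zl l\<^esub> (d \<otimes>\<^bsub>Zl l\<^esub> (s \<otimes>\<^bsub>Zl l\<^esub> inv\<^bsub>Zl l\<^esub> u))"
      using d s(1) iu by (simp add: Zl.add_pow_ldistr Zl.m_assoc)
    also have "s \<otimes>\<^bsub>Zl l\<^esub> inv\<^bsub>Zl l\<^esub> u = [(l ^ 1)] \<cdot>\<^bsub>Zl l\<^esub> \<one>\<^bsub>Zl l\<^esub>"
      unfolding u(2) using iu u(1) by (subst Zl.add_pow_ldistr) simp_all
    also have "d \<otimes>\<^bsub>Zl l\<^esub> [(l ^ 1)] \<cdot>\<^bsub>Zl l\<^esub> \<one>\<^bsub>Zl l\<^esub> = [(l ^ 1)] \<cdot>\<^bsub>Zl l\<^esub> d"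
      using d by (subst Zl.add_pow_rdistr) simp_all
    also have "[(l ^ v)] \<cdot>\<^bsub>Zl l\<^esub> ([(l ^ 1)] \<cdot>\<^bsub>Zl l\<^esub> d) = [(l ^ (v + 1))] \<cdot>\<^bsub>Zl l\<^esub> d"
      using d by (rule Zl.ell_smult_ell_smult)
    finally show ?thesis
      using t iu unfolding v d_def by (intro bexI[of _ "t \<otimes>\<^bsub>Zl l\<^esub> inv\<^bsub>Zl l\<^esub> u"]) auto
  qed
qed

text \<open>Some power of a unit is congruent to 1 modulo \<open>l\<^sup>2\<close>, so that \<open>v(\<alpha>\<^sup>m - 1)\<close> is at most a constant
  plus \<open>v(m)\<close>; summed over \<open>m \<le> M\<close> this is linear in \<open>M\<close>.\<close>

lemma power_minus_one_dvd_ell_power: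
  assumes a: "\<alpha> \<in> Units (Zl l)" and nr: "\<forall>n>0. \<alpha> [^]\<^bsub>Zl l\<^esub> (n::nat) \<noteq> \<one>\<^bsub>Zl l\<^esub>"
  obtains k where "\<And>m. m > 0 \<Longrightarrow> \<exists>t\<in>carrier (Zl l). (\<alpha> [^]\<^bsub>Zl l\<^esub> m \<ominus>\<^bsub>Zl l\<^esub> \<one>\<^bsub>Zl l\<^esub>) \<otimes>\<^bsub>Zl l\<^esub> t =
    [(l ^ (k + multiplicity l m))] \<cdot>\<^bsub>Zl l\<^esub> \<one>\<^bsub>Zl l\<^esub>"
proof -
  have ac: "\<alpha> \<in> carrier (Zl l)" and inv: "inv\<^bsub>Zl l\<^esub> \<alpha> \<in> carrier (Zl l)"
    "\<alpha> \<otimes>\<^bsub>Zl l\<^esub> inv\<^bsub>Zl l\<^esub> \<alpha> = \<one>\<^bsub>Zl l\<^esub>"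
    using a by auto
  have "[\<alpha> 2 * (inv\<^bsub>Zl l\<^esub> \<alpha>) 2 = 1] (mod int (l ^ 2))"
    using fun_cong[OF inv(2), of 2] by (simp add: Zl_simps(2,3) cong_def)
  then have "coprime (\<alpha> 2) (int (l ^ 2))" unfolding coprime_iff_invertible_int by blast
  then have "coprime (nat (\<alpha> 2)) (l ^ 2)"
    using ac by (metis Zl_simps(1) coprime_int_iff nat_0_le)
  define d where "d = totient (l ^ 2)"
  have d0: "d > 0" using l_gt by (simp add: d_def)
  have "[nat (\<alpha> 2) ^ d = 1] (mod (l ^ 2))"
    unfolding d_def by (rule euler_theorem) fact
  then have "[int (nat (\<alpha> 2) ^ d) = int 1] (mod int (l ^ 2))" by (simp only: cong_int_iff)
  moreover have "0 \<le> \<alpha> 2" using ac by (simp add: Zl_simps(1))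
  ultimately have e: "[\<alpha> 2 ^ d = 1] (mod (int l ^ 2))" by simp
  define b where "b = \<alpha> [^]\<^bsub>Zl l\<^esub> d"
  have b: "b \<in> carrier (Zl l)" using ac by (simp add: b_def)
  have b2: "b 2 = 1"
    using e Zl_one_at[of 2] by (simp add: b_def Zl_pow_at cong_def Zl_simps(3))
  have "b \<ominus>\<^bsub>Zl l\<^esub> \<one>\<^bsub>Zl l\<^esub> \<noteq> \<zero>\<^bsub>Zl l\<^esub>"
    using nr d0 b by (simp add: Zl.r_right_minus_eq b_def)
  then obtain k u where u: "u \<in> Units (Zl l)" "b \<ominus>\<^bsub>Zl l\<^esub> \<one>\<^bsub>Zl l\<^esub> = [(l ^ k)] \<cdot>\<^bsub>Zl l\<^esub> u"
    using b by (elim Zl_nonzeroE[rotated]) auto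
  have iu: "inv\<^bsub>Zl l\<^esub> u \<in> carrier (Zl l)" "u \<otimes>\<^bsub>Zl l\<^esub> inv\<^bsub>Zl l\<^esub> u = \<one>\<^bsub>Zl l\<^esub>" "u \<in> carrier (Zl l)"
    using u by auto
  show ?thesis
  proof (rule that)
    fix m :: nat assume m: "m > 0"
    define v where "v = multiplicity l m"
    obtain t where t: "t \<in> carrier (Zl l)" "(b [^]\<^bsub>Zl l\<^esub> m \<ominus>\<^bsub>Zl l\<^esub> \<one>\<^bsub>Zl l\<^esub>) \<otimes>\<^bsub>Zl l\<^esub> t =
        [(l ^ v)] \<cdot>\<^bsub>Zl l\<^esub> ([(l ^ k)] \<cdot>\<^bsub>Zl l\<^esub> u)"
      using lifting_the_exponent[OF b b2 m] u by (auto simp: v_def)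
    have am: "\<alpha> [^]\<^bsub>Zl l\<^esub> m \<in> carrier (Zl l)" using ac by simp
    \<comment> \<open>\<open>\<alpha>\<^sup>m - 1\<close> divides \<open>\<alpha>\<^bsup>dm\<^esup> - 1 = b\<^sup>m - 1\<close>; exponent 0 makes the congruence condition empty\<close>
    obtain s where s: "s \<in> carrier (Zl l)" "(\<alpha> [^]\<^bsub>Zl l\<^esub> m) [^]\<^bsub>Zl l\<^esub> d \<ominus>\<^bsub>Zl l\<^esub> \<one>\<^bsub>Zl l\<^esub> =
        (\<alpha> [^]\<^bsub>Zl l\<^esub> m \<ominus>\<^bsub>Zl l\<^esub> \<one>\<^bsub>Zl l\<^esub>) \<otimes>\<^bsub>Zl l\<^esub> s"
      using pow_minus_one_factor[OF am, of 0 d] am[unfolded Zl_simps(1), THEN spec[of _ 0]] by auto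
    have pw: "b [^]\<^bsub>Zl l\<^esub> m = (\<alpha> [^]\<^bsub>Zl l\<^esub> m) [^]\<^bsub>Zl l\<^esub> d"
      using ac by (simp add: b_def Zl.nat_pow_pow mult.commute)
    have c: "\<alpha> [^]\<^bsub>Zl l\<^esub> m \<ominus>\<^bsub>Zl l\<^esub> \<one>\<^bsub>Zl l\<^esub> \<in> carrier (Zl l)" using am by simp
    have "(\<alpha> [^]\<^bsub>Zl l\<^esub> m \<ominus>\<^bsub>Zl l\<^esub> \<one>\<^bsub>Zl l\<^esub>) \<otimes>\<^bsub>Zl l\<^esub> (s \<otimes>\<^bsub>Zl l\<^esub> t \<otimes>\<^bsub>Zl l\<^esub> inv\<^bsub>Zl l\<^esub> u)
        = ((b [^]\<^bsub>Zl l\<^esub> m \<ominus>\<^bsub>Zl l\<^esub> \<one>\<^bsub>Zl l\<^esub>) \<otimes>\<^bsub>Zl l\<^esub> t) \<otimes>\<^bsub>Zl l\<^esub> inv\<^bsub>Zl l\<^esub> u"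
      unfolding pw s(2) using c s(1) t(1) iu by (simp add: Zl.m_assoc)
    also have "\<dots> = [(l ^ (v + k))] \<cdot>\<^bsub>Zl l\<^esub> (u \<otimes>\<^bsub>Zl l\<^esub> inv\<^bsub>Zl l\<^esub> u)"
      using iu by (simp add: t(2) Zl.ell_smult_ell_smult Zl.add_pow_ldistr)
    finally show "\<exists>t\<in>carrier (Zl l). (\<alpha> [^]\<^bsub>Zl l\<^esub> m \<ominus>\<^bsub>Zl l\<^esub> \<one>\<^bsub>Zl l\<^esub>) \<otimes>\<^bsub>Zl l\<^esub> t =
        [(l ^ (k + multiplicity l m))] \<cdot>\<^bsub>Zl l\<^esub> \<one>\<^bsub>Zl l\<^esub>"
      using s(1) t(1) iu by (intro bexI[of _ "s \<otimes>\<^bsub>Zl l\<^esub> t \<otimes>\<^bsub>Zl l\<^esub> inv\<^bsub>Zl l\<^esub> u"]) (auto simp: v_def add.commute)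
  qed
qed

end

section \<open>Group rings of finite groups over the \<open>l\<close>-adic integers\<close>

lemma (in group) inv_mult_cancel_left [simp]:
  "a \<in> carrier G \<Longrightarrow> c \<in> carrier G \<Longrightarrow> inv a \<otimes> (a \<otimes> c) = c"
  "a \<in> carrier G \<Longrightarrow> c \<in> carrier G \<Longrightarrow> a \<otimes> (inv a \<otimes> c) = c"
  by (simp_all add: m_assoc[symmetric])

lemma (in group) inv_mult_eq_one_iff:
  assumes "a \<in> carrier G" "c \<in> carrier G"
  shows "inv a \<otimes> c = \<one> \<longleftrightarrow> a = c"
  using assms by (metis inv_closed inv_mult_cancel_left(2) l_inv r_one)

definition push_forward :: "nat \<Rightarrow> ('g, 'm) monoid_scheme \<Rightarrow> ('h, 'n) monoid_scheme \<Rightarrow> ('g \<Rightarrow> 'h) \<Rightarrow>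
    ('g \<Rightarrow> nat \<Rightarrow> int) \<Rightarrow> 'h \<Rightarrow> nat \<Rightarrow> int" where
  "push_forward l A B p x = (\<lambda>b\<in>carrier B. \<Oplus>\<^bsub>Zl l\<^esub>a\<in>{a \<in> carrier A. p a = b}. x a)"

definition group_ring_const :: "nat \<Rightarrow> ('g, 'm) monoid_scheme \<Rightarrow> (nat \<Rightarrow> int) \<Rightarrow> 'g \<Rightarrow> nat \<Rightarrow> int" where
  "group_ring_const l A s = (\<lambda>c\<in>carrier A. if c = \<one>\<^bsub>A\<^esub> then s else \<zero>\<^bsub>Zl l\<^esub>)"

context prime_number
begin

lemma group_ring_simps:
  "carrier (group_ring (Zl l) A) = carrier A \<rightarrow>\<^sub>E carrier (Zl l)"
  "\<one>\<^bsub>group_ring (Zl l) A\<^esub> = group_ring_const l A \<one>\<^bsub>Zl l\<^esub>"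
  "\<zero>\<^bsub>group_ring (Zl l) A\<^esub> = (\<lambda>c\<in>carrier A. \<zero>\<^bsub>Zl l\<^esub>)"
  "x \<oplus>\<^bsub>group_ring (Zl l) A\<^esub> y = (\<lambda>c\<in>carrier A. x c \<oplus>\<^bsub>Zl l\<^esub> y c)"
  by (simp_all add: group_ring_def group_ring_const_def)

lemma group_ring_eqI:
  assumes "x \<in> carrier A \<rightarrow>\<^sub>E carrier (Zl l)" "y \<in> carrier A \<rightarrow>\<^sub>E carrier (Zl l)"
    "\<And>c n. c \<in> carrier A \<Longrightarrow> [x c n = y c n] (mod int l ^ n)"
  shows "x = y"
  using assms(1,2) by (rule PiE_ext) (use assms in \<open>auto intro!: Zl_eqI\<close>)

lemma push_forward_closed:
  assumes "x \<in> carrier A \<rightarrow>\<^sub>E carrier (Zl l)"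
  shows "push_forward l A B p x \<in> carrier B \<rightarrow>\<^sub>E carrier (Zl l)"
  unfolding push_forward_def using assms by (auto intro!: Zl.finsum_closed)

lemma push_forward_at:
  assumes "x \<in> carrier A \<rightarrow>\<^sub>E carrier (Zl l)" "finite (carrier A)" "b \<in> carrier B"
  shows "push_forward l A B p x b n = (\<Sum>a\<in>{a \<in> carrier A. p a = b}. x a n) mod int l ^ n"
  using assms by (auto simp: push_forward_def finsum_Zl Pi_def PiE_def)

lemma push_forward_comp:
  assumes x: "x \<in> carrier A \<rightarrow>\<^sub>E carrier (Zl l)" and fin: "finite (carrier A)" "finite (carrier B)"
    and p: "p \<in> carrier A \<rightarrow> carrier B" and r: "\<And>a. a \<in> carrier A \<Longrightarrow> r a = q (p a)"
  shows "push_forward l B C q (push_forward l A B p x) = push_forward l A C r x"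
proof (rule group_ring_eqI)
  fix c n assume c: "c \<in> carrier C"
  have "push_forward l B C q (push_forward l A B p x) c n =
      (\<Sum>b\<in>{b \<in> carrier B. q b = c}. push_forward l A B p x b n) mod int l ^ n"
    using c fin x by (intro push_forward_at push_forward_closed)
  also have "\<dots> = (\<Sum>b\<in>{b \<in> carrier B. q b = c}. \<Sum>a\<in>{a \<in> {a \<in> carrier A. r a = c}. p a = b}. x a n)
      mod int l ^ n"
    using x fin p r by (simp add: push_forward_at mod_simps) (auto intro!: arg_cong[of _ _ "\<lambda>z. z mod _"] sum.cong)
  also have "(\<Sum>b\<in>{b \<in> carrier B. q b = c}. \<Sum>a\<in>{a \<in> {a \<in> carrier A. r a = c}. p a = b}. x a n) =
      (\<Sum>a\<in>{a \<in> carrier A. r a = c}. x a n)"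
    using fin p r by (intro sum.group) auto
  finally show "[push_forward l B C q (push_forward l A B p x) c n = push_forward l A C r x c n] (mod int l ^ n)"
    using x c fin by (simp add: push_forward_at)
qed (intro push_forward_closed x)+

end

locale finite_group_ring = prime_number + group A for A (structure) +
  assumes fin: "finite (carrier A)"
begin

abbreviation "ZA \<equiv> group_ring (Zl l) A"

lemma group_ring_mult_closed:
  assumes "x \<in> carrier A \<rightarrow>\<^sub>E carrier (Zl l)" "y \<in> carrier A \<rightarrow>\<^sub>E carrier (Zl l)"
  shows "x \<otimes>\<^bsub>ZA\<^esub> y \<in> carrier A \<rightarrow>\<^sub>E carrier (Zl l)"
  using assms by (auto simp: group_ring_def intro!: Zl.finsum_closed)

text \<open>Evaluation at \<open>n\<close> turns identities between sums in \<open>\<int>\<^sub>l\<close> into congruences modulo \<open>l\<^sup>n\<close> between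
  finite sums of integers.\<close>

lemma group_ring_mult_at:
  assumes "x \<in> carrier A \<rightarrow>\<^sub>E carrier (Zl l)" "y \<in> carrier A \<rightarrow>\<^sub>E carrier (Zl l)" "c \<in> carrier A"
  shows "(x \<otimes>\<^bsub>ZA\<^esub> y) c n = (\<Sum>a\<in>carrier A. x a n * y (inv a \<otimes> c) n) mod int l ^ n"
proof -
  have "(\<lambda>a. x a \<otimes>\<^bsub>Zl l\<^esub> y (inv a \<otimes> c)) \<in> carrier A \<rightarrow> carrier (Zl l)"
    using assms by (auto intro!: Zl.m_closed)
  then show ?thesis using assms fin by (simp add: group_ring_def finsum_Zl Zl_simps(2) mod_simps)
qed

lemma group_ring_const_closed:
  "s \<in> carrier (Zl l) \<Longrightarrow> group_ring_const l A s \<in> carrier A \<rightarrow>\<^sub>E carrier (Zl l)"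
  by (auto simp: group_ring_const_def)

lemma group_ring_const_mult:
  assumes s: "s \<in> carrier (Zl l)" and x: "x \<in> carrier A \<rightarrow>\<^sub>E carrier (Zl l)"
  shows "group_ring_const l A s \<otimes>\<^bsub>ZA\<^esub> x = (\<lambda>c\<in>carrier A. s \<otimes>\<^bsub>Zl l\<^esub> x c)" (is "?L = ?R")
proof (rule group_ring_eqI)
  fix c n assume c: "c \<in> carrier A"
  have "(\<Sum>a\<in>carrier A. group_ring_const l A s a n * x (inv a \<otimes> c) n) =
      (\<Sum>a\<in>carrier A. if a = \<one> then s n * x c n else 0)"
    using c by (intro sum.cong refl) (auto simp: group_ring_const_def Zl_simps)
  also have "\<dots> = s n * x c n" using fin by (simp add: sum.delta)
  finally show "[?L c n = ?R c n] (mod int l ^ n)"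
    using s x c by (simp add: group_ring_mult_at group_ring_const_closed Zl_simps(2))
qed (use s x in \<open>auto intro!: group_ring_mult_closed group_ring_const_closed\<close>)

lemma group_ring_mult_one:
  assumes x: "x \<in> carrier A \<rightarrow>\<^sub>E carrier (Zl l)"
  shows "x \<otimes>\<^bsub>ZA\<^esub> group_ring_const l A \<one>\<^bsub>Zl l\<^esub> = x" (is "?L = ?R")
proof (rule group_ring_eqI)
  fix c n assume c: "c \<in> carrier A"
  have "(\<Sum>a\<in>carrier A. x a n * group_ring_const l A \<one>\<^bsub>Zl l\<^esub> (inv a \<otimes> c) n) =
      (\<Sum>a\<in>carrier A. if a = c then x c n * \<one>\<^bsub>Zl l\<^esub> n else 0)"
    using c by (intro sum.cong refl)
      (auto simp: group_ring_const_def Zl_simps(4) inv_mult_eq_one_iff)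
  also have "\<dots> = x c n * \<one>\<^bsub>Zl l\<^esub> n" using fin c by (simp add: sum.delta)
  finally show "[?L c n = ?R c n] (mod int l ^ n)"
    using x c by (simp add: group_ring_mult_at group_ring_const_closed Zl_simps(3) cong_def mod_simps)
qed (use x in \<open>auto intro!: group_ring_mult_closed group_ring_const_closed\<close>)

lemma group_ring_assoc:
  assumes x: "x \<in> carrier A \<rightarrow>\<^sub>E carrier (Zl l)" and y: "y \<in> carrier A \<rightarrow>\<^sub>E carrier (Zl l)"
    and z: "z \<in> carrier A \<rightarrow>\<^sub>E carrier (Zl l)"
  shows "(x \<otimes>\<^bsub>ZA\<^esub> y) \<otimes>\<^bsub>ZA\<^esub> z = x \<otimes>\<^bsub>ZA\<^esub> (y \<otimes>\<^bsub>ZA\<^esub> z)" (is "?L = ?R")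
proof (rule group_ring_eqI)
  fix c n assume c: "c \<in> carrier A"
  have "(\<Sum>a\<in>carrier A. (\<Sum>b\<in>carrier A. x b n * y (inv b \<otimes> a) n) * z (inv a \<otimes> c) n) =
      (\<Sum>b\<in>carrier A. \<Sum>a\<in>carrier A. x b n * (y (inv b \<otimes> a) n * z (inv a \<otimes> c) n))"
    by (simp add: sum_distrib_right mult.assoc) (rule sum.swap)
  also have "\<dots> = (\<Sum>b\<in>carrier A. \<Sum>a\<in>carrier A. x b n * (y a n * z (inv a \<otimes> (inv b \<otimes> c)) n))"
  proof (rule sum.cong[OF refl])
    fix b assume b: "b \<in> carrier A"
    show "(\<Sum>a\<in>carrier A. x b n * (y (inv b \<otimes> a) n * z (inv a \<otimes> c) n)) =
        (\<Sum>a\<in>carrier A. x b n * (y a n * z (inv a \<otimes> (inv b \<otimes> c)) n))"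
      by (rule sum.reindex_bij_witness[of _ "\<lambda>a. b \<otimes> a" "\<lambda>a. inv b \<otimes> a"])
        (use b c in \<open>auto simp: inv_mult_group m_assoc\<close>)
  qed
  also have "\<dots> = (\<Sum>b\<in>carrier A. x b n * (\<Sum>a\<in>carrier A. y a n * z (inv a \<otimes> (inv b \<otimes> c)) n))"
    by (simp add: sum_distrib_left)
  finally have key: "(\<Sum>a\<in>carrier A. (\<Sum>b\<in>carrier A. x b n * y (inv b \<otimes> a) n) * z (inv a \<otimes> c) n) = \<dots>" .
  have "[?L c n = (\<Sum>a\<in>carrier A. (\<Sum>b\<in>carrier A. x b n * y (inv b \<otimes> a) n) * z (inv a \<otimes> c) n)] (mod int l ^ n)"
    using x y z c by (simp add: group_ring_mult_at group_ring_mult_closed cong_def)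
      (intro cong_sum[unfolded cong_def] cong_mult[unfolded cong_def], simp_all)
  moreover have "[?R c n = (\<Sum>b\<in>carrier A. x b n * (\<Sum>a\<in>carrier A. y a n * z (inv a \<otimes> (inv b \<otimes> c)) n))] (mod int l ^ n)"
    using x y z c by (simp add: group_ring_mult_at group_ring_mult_closed cong_def)
      (intro cong_sum[unfolded cong_def] cong_mult[unfolded cong_def], simp_all)
  ultimately show "[?L c n = ?R c n] (mod int l ^ n)" unfolding key by (meson cong_sym cong_trans)
qed (use x y z in \<open>auto intro!: group_ring_mult_closed\<close>)

lemma group_ring_is_ring: "ring ZA"
proof (rule ringI)
  show "abelian_group ZA"
  proof (rule abelian_groupI)
    fix x assume "x \<in> carrier ZA"
    then show "\<exists>y\<in>carrier ZA. y \<oplus>\<^bsub>ZA\<^esub> x = \<zero>\<^bsub>ZA\<^esub>"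
      by (intro bexI[of _ "\<lambda>c\<in>carrier A. \<ominus>\<^bsub>Zl l\<^esub> x c"])
        (auto simp: group_ring_simps intro!: restrict_ext Zl.l_neg)
  next
    fix x assume "x \<in> carrier ZA"
    then show "\<zero>\<^bsub>ZA\<^esub> \<oplus>\<^bsub>ZA\<^esub> x = x"
      by (auto simp: group_ring_simps fun_eq_iff PiE_iff extensional_def)
  qed (auto simp: group_ring_simps fun_eq_iff Zl.add.m_ac PiE_iff)
  show "monoid ZA"
  proof (rule monoidI)
    show "\<one>\<^bsub>ZA\<^esub> \<in> carrier ZA" by (simp add: group_ring_simps group_ring_const_closed)
  next
    fix x assume "x \<in> carrier ZA"
    then show "\<one>\<^bsub>ZA\<^esub> \<otimes>\<^bsub>ZA\<^esub> x = x" "x \<otimes>\<^bsub>ZA\<^esub> \<one>\<^bsub>ZA\<^esub> = x"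
      by (auto simp: group_ring_simps group_ring_const_mult group_ring_mult_one
          fun_eq_iff PiE_iff extensional_def)
  qed (simp_all add: group_ring_simps(1) group_ring_mult_closed group_ring_assoc)
  fix x y z assume "x \<in> carrier ZA" "y \<in> carrier ZA" "z \<in> carrier ZA"
  then have xyz: "x \<in> carrier A \<rightarrow>\<^sub>E carrier (Zl l)" "y \<in> carrier A \<rightarrow>\<^sub>E carrier (Zl l)"
      "z \<in> carrier A \<rightarrow>\<^sub>E carrier (Zl l)"
    by (simp_all add: group_ring_simps(1))
  have cl: "u \<oplus>\<^bsub>ZA\<^esub> v \<in> carrier A \<rightarrow>\<^sub>E carrier (Zl l)"
    if "u \<in> carrier A \<rightarrow>\<^sub>E carrier (Zl l)" "v \<in> carrier A \<rightarrow>\<^sub>E carrier (Zl l)" for u v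
    using that by (auto simp: group_ring_simps)
  have at: "(u \<oplus>\<^bsub>ZA\<^esub> v) c n = (u c n + v c n) mod int l ^ n" if "c \<in> carrier A" for u v c n
    using that by (simp add: group_ring_simps Zl_simps(5))
  show "(x \<oplus>\<^bsub>ZA\<^esub> y) \<otimes>\<^bsub>ZA\<^esub> z = x \<otimes>\<^bsub>ZA\<^esub> z \<oplus>\<^bsub>ZA\<^esub> y \<otimes>\<^bsub>ZA\<^esub> z" (is "?L = ?R")
  proof (rule group_ring_eqI)
    fix c n assume c: "c \<in> carrier A"
    have "[?L c n = (\<Sum>a\<in>carrier A. (x a n + y a n) * z (inv a \<otimes> c) n)] (mod int l ^ n)"
      using xyz c by (simp add: group_ring_mult_at cl at cong_def)
        (intro cong_sum[unfolded cong_def] cong_mult[unfolded cong_def], simp_all)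
    moreover have "[?R c n = (\<Sum>a\<in>carrier A. (x a n + y a n) * z (inv a \<otimes> c) n)] (mod int l ^ n)"
      using xyz c by (simp add: group_ring_mult_at at cong_def mod_simps distrib_right sum.distrib)
    ultimately show "[?L c n = ?R c n] (mod int l ^ n)" by (meson cong_sym cong_trans)
  qed (use xyz in \<open>auto intro!: group_ring_mult_closed cl\<close>)
  show "z \<otimes>\<^bsub>ZA\<^esub> (x \<oplus>\<^bsub>ZA\<^esub> y) = z \<otimes>\<^bsub>ZA\<^esub> x \<oplus>\<^bsub>ZA\<^esub> z \<otimes>\<^bsub>ZA\<^esub> y" (is "?L = ?R")
  proof (rule group_ring_eqI)
    fix c n assume c: "c \<in> carrier A"
    have "[?L c n = (\<Sum>a\<in>carrier A. z a n * (x (inv a \<otimes> c) n + y (inv a \<otimes> c) n))] (mod int l ^ n)"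
      using xyz c by (simp add: group_ring_mult_at cl at cong_def)
        (intro cong_sum[unfolded cong_def] cong_mult[unfolded cong_def], simp_all)
    moreover have "[?R c n = (\<Sum>a\<in>carrier A. z a n * (x (inv a \<otimes> c) n + y (inv a \<otimes> c) n))] (mod int l ^ n)"
      using xyz c by (simp add: group_ring_mult_at at cong_def mod_simps distrib_left sum.distrib)
    ultimately show "[?L c n = ?R c n] (mod int l ^ n)" by (meson cong_sym cong_trans)
  qed (use xyz in \<open>auto intro!: group_ring_mult_closed cl\<close>)
qed

lemma group_ring_const_hom: "group_ring_const l A \<in> ring_hom (Zl l) ZA"
proof (rule ring_hom_memI)
  fix s t assume st: "s \<in> carrier (Zl l)" "t \<in> carrier (Zl l)"
  show "group_ring_const l A (s \<otimes>\<^bsub>Zl l\<^esub> t) = group_ring_const l A s \<otimes>\<^bsub>ZA\<^esub> group_ring_const l A t"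
    unfolding group_ring_const_mult[OF st(1) group_ring_const_closed[OF st(2)]]
    using st by (auto simp: group_ring_const_def intro!: restrict_ext)
  show "group_ring_const l A (s \<oplus>\<^bsub>Zl l\<^esub> t) = group_ring_const l A s \<oplus>\<^bsub>ZA\<^esub> group_ring_const l A t"
    using st by (auto simp: group_ring_simps fun_eq_iff group_ring_const_def)
qed (auto simp: group_ring_simps group_ring_const_closed)

end

locale finite_group_ring_hom = A?: finite_group_ring l A + B?: finite_group_ring l B
  for l and A :: "('g, 'm) monoid_scheme" and B :: "('h, 'n) monoid_scheme" +
  fixes p assumes p: "p \<in> hom A B"
begin

lemma push_forward_const:
  assumes s: "s \<in> carrier (Zl l)"
  shows "push_forward l A B p (group_ring_const l A s) = group_ring_const l B s" (is "?L = ?R")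
proof (rule group_ring_eqI)
  interpret group_hom A B p using p by unfold_locales
  fix b n assume b: "b \<in> carrier B"
  have "(\<Sum>a\<in>{a \<in> carrier A. p a = b}. group_ring_const l A s a n) =
      (\<Sum>a\<in>{a \<in> carrier A. p a = b}. if a = \<one>\<^bsub>A\<^esub> then s n else 0)"
    by (intro sum.cong refl) (auto simp: group_ring_const_def Zl_simps(4))
  also have "\<dots> = (if b = \<one>\<^bsub>B\<^esub> then s n else 0)"
    using A.fin by (subst sum.delta) auto
  finally show "[?L b n = ?R b n] (mod int l ^ n)"
    using s b A.fin by (simp add: push_forward_at A.group_ring_const_closed)
      (simp add: group_ring_const_def Zl_simps(4))
qed (use s in \<open>auto intro!: push_forward_closed A.group_ring_const_closed B.group_ring_const_closed\<close>)

text \<open>With \<open>c = a e\<close>, the condition \<open>p c = b\<close> on the pairs \<open>(a, c)\<close> becomes \<open>p e = (p a)\<^sup>-\<^sup>1 b\<close>; the sum over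
  \<open>a\<close> is then split according to \<open>p a\<close>.\<close>

lemma push_forward_mult:
  assumes x: "x \<in> carrier A \<rightarrow>\<^sub>E carrier (Zl l)" and y: "y \<in> carrier A \<rightarrow>\<^sub>E carrier (Zl l)"
  shows "push_forward l A B p (x \<otimes>\<^bsub>A.ZA\<^esub> y) = push_forward l A B p x \<otimes>\<^bsub>B.ZA\<^esub> push_forward l A B p y"
    (is "?L = ?R")
proof (rule group_ring_eqI)
  interpret group_hom A B p using p by unfold_locales
  fix b n assume b: "b \<in> carrier B"
  let ?F = "\<lambda>b. {a \<in> carrier A. p a = b}"
  have "(\<Sum>c\<in>?F b. \<Sum>a\<in>carrier A. x a n * y (inv\<^bsub>A\<^esub> a \<otimes>\<^bsub>A\<^esub> c) n) =
      (\<Sum>a\<in>carrier A. \<Sum>c\<in>?F b. x a n * y (inv\<^bsub>A\<^esub> a \<otimes>\<^bsub>A\<^esub> c) n)"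
    by (rule sum.swap)
  also have "\<dots> = (\<Sum>a\<in>carrier A. \<Sum>e\<in>?F (inv\<^bsub>B\<^esub> p a \<otimes>\<^bsub>B\<^esub> b). x a n * y e n)"
  proof (rule sum.cong[OF refl])
    fix a assume a: "a \<in> carrier A"
    show "(\<Sum>c\<in>?F b. x a n * y (inv\<^bsub>A\<^esub> a \<otimes>\<^bsub>A\<^esub> c) n) =
        (\<Sum>e\<in>?F (inv\<^bsub>B\<^esub> p a \<otimes>\<^bsub>B\<^esub> b). x a n * y e n)"
      by (rule sum.reindex_bij_witness[of _ "\<lambda>e. a \<otimes>\<^bsub>A\<^esub> e" "\<lambda>c. inv\<^bsub>A\<^esub> a \<otimes>\<^bsub>A\<^esub> c"])
        (use a b in auto)
  qed
  also have "\<dots> = (\<Sum>b'\<in>carrier B. \<Sum>a\<in>?F b'. \<Sum>e\<in>?F (inv\<^bsub>B\<^esub> p a \<otimes>\<^bsub>B\<^esub> b). x a n * y e n)"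
    using A.fin B.fin by (intro sum.group[symmetric]) auto
  also have "\<dots> = (\<Sum>b'\<in>carrier B. (\<Sum>a\<in>?F b'. x a n) * (\<Sum>e\<in>?F (inv\<^bsub>B\<^esub> b' \<otimes>\<^bsub>B\<^esub> b). y e n))"
    by (simp add: sum_product)
  finally have key: "(\<Sum>c\<in>?F b. \<Sum>a\<in>carrier A. x a n * y (inv\<^bsub>A\<^esub> a \<otimes>\<^bsub>A\<^esub> c) n) = \<dots>" .
  have "[?L b n = (\<Sum>c\<in>?F b. \<Sum>a\<in>carrier A. x a n * y (inv\<^bsub>A\<^esub> a \<otimes>\<^bsub>A\<^esub> c) n)] (mod int l ^ n)"
    using x y b A.fin by (simp add: push_forward_at A.group_ring_mult_closed A.group_ring_mult_at cong_def mod_simps)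
  moreover have "[?R b n = (\<Sum>b'\<in>carrier B. (\<Sum>a\<in>?F b'. x a n) * (\<Sum>e\<in>?F (inv\<^bsub>B\<^esub> b' \<otimes>\<^bsub>B\<^esub> b). y e n))] (mod int l ^ n)"
    using x y b A.fin
    by (simp add: push_forward_at push_forward_closed B.group_ring_mult_at cong_def)
      (intro cong_sum[unfolded cong_def] cong_mult[unfolded cong_def], simp_all)
  ultimately show "[?L b n = ?R b n] (mod int l ^ n)" unfolding key by (meson cong_sym cong_trans)
qed (use x y in \<open>auto intro!: push_forward_closed A.group_ring_mult_closed B.group_ring_mult_closed\<close>)

lemma push_forward_hom: "push_forward l A B p \<in> ring_hom A.ZA B.ZA"
proof (rule ring_hom_memI)
  fix x y assume "x \<in> carrier A.ZA" "y \<in> carrier A.ZA"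
  then have xy: "x \<in> carrier A \<rightarrow>\<^sub>E carrier (Zl l)" "y \<in> carrier A \<rightarrow>\<^sub>E carrier (Zl l)"
    by (simp_all add: group_ring_simps(1))
  then show "push_forward l A B p x \<in> carrier B.ZA"
    by (simp add: group_ring_simps(1) push_forward_closed)
  show "push_forward l A B p (x \<otimes>\<^bsub>A.ZA\<^esub> y) = push_forward l A B p x \<otimes>\<^bsub>B.ZA\<^esub> push_forward l A B p y"
    using xy by (rule push_forward_mult)
  show "push_forward l A B p (x \<oplus>\<^bsub>A.ZA\<^esub> y) = push_forward l A B p x \<oplus>\<^bsub>B.ZA\<^esub> push_forward l A B p y"
  proof (rule group_ring_eqI)
    have cl: "x \<oplus>\<^bsub>A.ZA\<^esub> y \<in> carrier A \<rightarrow>\<^sub>E carrier (Zl l)" using xy by (auto simp: group_ring_simps)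
    show "push_forward l A B p (x \<oplus>\<^bsub>A.ZA\<^esub> y) \<in> carrier B \<rightarrow>\<^sub>E carrier (Zl l)"
      using cl by (rule push_forward_closed)
    show "push_forward l A B p x \<oplus>\<^bsub>B.ZA\<^esub> push_forward l A B p y \<in> carrier B \<rightarrow>\<^sub>E carrier (Zl l)"
      using push_forward_closed[OF xy(1), of B p] push_forward_closed[OF xy(2), of B p]
      by (auto simp: group_ring_simps)
    fix b n assume "b \<in> carrier B"
    then show "[push_forward l A B p (x \<oplus>\<^bsub>A.ZA\<^esub> y) b n =
        (push_forward l A B p x \<oplus>\<^bsub>B.ZA\<^esub> push_forward l A B p y) b n] (mod int l ^ n)"
      using xy cl A.fin
      by (simp add: push_forward_at cong_def) 
        (simp add: group_ring_simps Zl_simps(5) push_forward_at mod_simps sum.distrib)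
  qed
qed (simp add: group_ring_simps push_forward_const)

end

section \<open>Completed group rings\<close>

text \<open>The homomorphism \<open>G/U \<rightarrow> H/V\<close> induced by a homomorphism \<open>f\<close> that maps \<open>U\<close> into \<open>V\<close>.\<close>

definition factor_map :: "('h, 'n) monoid_scheme \<Rightarrow> 'h set \<Rightarrow> ('g \<Rightarrow> 'h) \<Rightarrow> 'g set \<Rightarrow> 'h set" where
  "factor_map H V f C = V <#>\<^bsub>H\<^esub> (f ` C)"

lemma carrier_Mod: "carrier (G Mod U) = rcosets\<^bsub>G\<^esub> U"
  by (simp add: FactGroup_def)

locale factor_hom = G?: group G + H?: group H
  for G :: "('g, 'm) monoid_scheme" and H :: "('h, 'n) monoid_scheme" +
  fixes f U V
  assumes f: "f \<in> hom G H" and U: "U \<lhd> G" and V: "V \<lhd> H" and fUV: "f ` U \<subseteq> V"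
begin

sublocale f: group_hom G H f using f by unfold_locales

lemma factor_map_coset:
  assumes g: "g \<in> carrier G"
  shows "factor_map H V f (U #>\<^bsub>G\<^esub> g) = V #>\<^bsub>H\<^esub> f g"
proof -
  interpret V: normal V H by (rule V)
  interpret U: normal U G by (rule U)
  show ?thesis
  proof (intro equalityI subsetI)
    fix h assume "h \<in> factor_map H V f (U #>\<^bsub>G\<^esub> g)"
    then obtain v u where vu: "v \<in> V" "u \<in> U" "h = v \<otimes>\<^bsub>H\<^esub> f (u \<otimes>\<^bsub>G\<^esub> g)"
      by (auto simp: factor_map_def set_mult_def r_coset_def)
    then have "h = (v \<otimes>\<^bsub>H\<^esub> f u) \<otimes>\<^bsub>H\<^esub> f g"
      using g V.subset U.subset by (simp add: H.m_assoc subset_iff)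
    moreover have "v \<otimes>\<^bsub>H\<^esub> f u \<in> V" using vu fUV by auto
    ultimately show "h \<in> V #>\<^bsub>H\<^esub> f g" by (auto simp: r_coset_def)
  next
    fix h assume "h \<in> V #>\<^bsub>H\<^esub> f g"
    then obtain v where v: "v \<in> V" "h = v \<otimes>\<^bsub>H\<^esub> f (\<one>\<^bsub>G\<^esub> \<otimes>\<^bsub>G\<^esub> g)" using g by (auto simp: r_coset_def)
    then show "h \<in> factor_map H V f (U #>\<^bsub>G\<^esub> g)"
      using U.one_closed unfolding factor_map_def set_mult_def r_coset_def by blast
  qed
qed

lemma factor_map_closed: "C \<in> carrier (G Mod U) \<Longrightarrow> factor_map H V f C \<in> carrier (H Mod V)"
  by (auto simp: carrier_Mod RCOSETS_def factor_map_coset)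

lemma factor_map_hom: "factor_map H V f \<in> hom (G Mod U) (H Mod V)"
proof (rule homI)
  interpret V: normal V H by (rule V)
  interpret U: normal U G by (rule U)
  fix C D assume "C \<in> carrier (G Mod U)" "D \<in> carrier (G Mod U)"
  then obtain c d where "c \<in> carrier G" "C = U #>\<^bsub>G\<^esub> c" "d \<in> carrier G" "D = U #>\<^bsub>G\<^esub> d"
    by (auto simp: carrier_Mod RCOSETS_def)
  then show "factor_map H V f (C \<otimes>\<^bsub>G Mod U\<^esub> D) = factor_map H V f C \<otimes>\<^bsub>H Mod V\<^esub> factor_map H V f D"
    by (simp add: FactGroup_def U.rcos_sum V.rcos_sum factor_map_coset)
qed (rule factor_map_closed)

lemma factor_map_eq_iff:
  assumes d: "d \<in> rcosets\<^bsub>G\<^esub> U" and c: "c \<in> rcosets\<^bsub>H\<^esub> V"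
  shows "f ` d \<subseteq> c \<longleftrightarrow> factor_map H V f d = c"
proof -
  interpret V: normal V H by (rule V)
  interpret U: normal U G by (rule U)
  obtain g where g: "g \<in> carrier G" "d = U #>\<^bsub>G\<^esub> g" using d by (auto simp: RCOSETS_def)
  have gd: "g \<in> d" using g U.one_closed by (force simp: r_coset_def)
  show ?thesis
  proof
    assume "f ` d \<subseteq> c"
    then have fg: "f g \<in> c" using gd by auto
    obtain h where h: "h \<in> carrier H" "c = V #>\<^bsub>H\<^esub> h" using c by (auto simp: RCOSETS_def)
    have "V #>\<^bsub>H\<^esub> h = V #>\<^bsub>H\<^esub> f g"
      using fg h V.is_subgroup by (intro H.repr_independence) auto
    then show "factor_map H V f d = c" using g h by (simp add: factor_map_coset)
  next
    assume "factor_map H V f d = c"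
    moreover have "f ` d \<subseteq> factor_map H V f d"
    proof
      fix h assume h: "h \<in> f ` d"
      then have "h \<in> carrier H" using g U.subset by (auto simp: r_coset_def)
      then have "\<one>\<^bsub>H\<^esub> \<otimes>\<^bsub>H\<^esub> h = h" by simp
      then show "h \<in> factor_map H V f d"
        unfolding factor_map_def set_mult_def by (intro UN_I[OF V.one_closed] UN_I[OF h]) simp
    qed
    ultimately show "f ` d \<subseteq> c" by simp
  qed
qed

end

lemma (in group) rcosets_carrier: "rcosets (carrier G) = {carrier G}"
proof -
  have "carrier G #> g = carrier G" if "g \<in> carrier G" for g
    using that by (intro coset_join2 subgroup_self)
  then show ?thesis by (auto simp: RCOSETS_def)
qed

locale pro_group = prime_number + group G for G :: "'g topgroup" (structure) +
  assumes whole: "carrier G \<in> open_normal G"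
begin

abbreviation "ZG \<equiv> Zl_group_ring l G"
abbreviation "ZQ U \<equiv> group_ring (Zl l) (G Mod U)"

lemma open_normalD:
  assumes "U \<in> open_normal G"
  shows "U \<lhd> G" "finite (rcosets U)"
  using assms by (auto simp: open_normal_def)

lemma finite_group_ring_Mod: "U \<in> open_normal G \<Longrightarrow> finite_group_ring l (G Mod U)"
  using open_normalD[of U] normal.factorgroup_is_group[of U G]
  by (auto simp: finite_group_ring_def finite_group_ring_axioms_def carrier_Mod prime_number_axioms)

lemma ring_ZQ: "U \<in> open_normal G \<Longrightarrow> ring (ZQ U)"
  by (rule finite_group_ring.group_ring_is_ring[OF finite_group_ring_Mod])

lemma projection_factor_hom:
  assumes "U \<in> open_normal G" "V \<in> open_normal G" "V \<subseteq> U"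
  shows "factor_hom G G (\<lambda>x. x) V U"
  using assms open_normalD[of U] open_normalD[of V]
  by (intro factor_hom.intro factor_hom_axioms.intro is_group) (auto simp: hom_def)

definition projection :: "'g set \<Rightarrow> 'g set \<Rightarrow> 'g Zl_elem \<Rightarrow> 'g set \<Rightarrow> nat \<Rightarrow> int" where
  "projection V U x = push_forward l (G Mod V) (G Mod U) (factor_map G U (\<lambda>x. x)) (x V)"

lemma projection_hom:
  assumes "U \<in> open_normal G" "V \<in> open_normal G" "V \<subseteq> U"
  shows "push_forward l (G Mod V) (G Mod U) (factor_map G U (\<lambda>x. x)) \<in> ring_hom (ZQ V) (ZQ U)"
proof -
  interpret p: factor_hom G G "\<lambda>x. x" V U using assms by (rule projection_factor_hom)
  interpret finite_group_ring_hom l "G Mod V" "G Mod U" "factor_map G U (\<lambda>x. x)"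
    using finite_group_ring_Mod[OF assms(1)] finite_group_ring_Mod[OF assms(2)]
    by (auto simp: finite_group_ring_hom_def finite_group_ring_hom_axioms_def p.factor_map_hom)
  show ?thesis by (rule push_forward_hom)
qed

text \<open>The cosets of \<open>V\<close> contained in a coset of \<open>U\<close> form a fibre of \<open>G/V \<rightarrow> G/U\<close>. So compatibility of the
  components means compatibility with push-forward, which is a ring homomorphism.\<close>

lemma Zl_group_ring_carrier:
  "x \<in> carrier ZG \<longleftrightarrow> x \<in> extensional (open_normal G) \<and>
    (\<forall>U\<in>open_normal G. x U \<in> carrier (ZQ U)) \<and>
    (\<forall>U\<in>open_normal G. \<forall>V\<in>open_normal G. V \<subseteq> U \<longrightarrow> projection V U x = x U)"
proof -
  have "(\<forall>c\<in>rcosets U. x U c = (\<Oplus>\<^bsub>Zl l\<^esub>d\<in>{d \<in> rcosets V. d \<subseteq> c}. x V d)) \<longleftrightarrow> projection V U x = x U"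
    if UV: "U \<in> open_normal G" "V \<in> open_normal G" "V \<subseteq> U" and x: "x U \<in> carrier (ZQ U)" for U V
  proof -
    interpret p: factor_hom G G "\<lambda>x. x" V U using UV by (rule projection_factor_hom)
    have "{d \<in> rcosets V. d \<subseteq> c} = {d \<in> rcosets V. factor_map G U (\<lambda>x. x) d = c}"
      if "c \<in> rcosets U" for c
      using p.factor_map_eq_iff[OF _ that] by auto
    then have "(\<forall>c\<in>rcosets U. x U c = (\<Oplus>\<^bsub>Zl l\<^esub>d\<in>{d \<in> rcosets V. d \<subseteq> c}. x V d)) \<longleftrightarrow>
        (\<forall>c\<in>rcosets U. projection V U x c = x U c)"
      by (auto simp: projection_def push_forward_def carrier_Mod)
    also have "\<dots> \<longleftrightarrow> projection V U x = x U"
      using x by (auto simp: group_ring_simps carrier_Mod projection_def push_forward_def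
        fun_eq_iff PiE_iff extensional_def)
    finally show ?thesis .
  qed
  then have "(\<forall>U\<in>open_normal G. \<forall>V\<in>open_normal G. V \<subseteq> U \<longrightarrow>
        (\<forall>c\<in>rcosets U. x U c = (\<Oplus>\<^bsub>Zl l\<^esub>d\<in>{d \<in> rcosets V. d \<subseteq> c}. x V d))) \<longleftrightarrow>
      (\<forall>U\<in>open_normal G. \<forall>V\<in>open_normal G. V \<subseteq> U \<longrightarrow> projection V U x = x U)"
    if "\<forall>U\<in>open_normal G. x U \<in> carrier (ZQ U)"
    using that by (intro ball_cong refl imp_cong) blast
  moreover have "x \<in> carrier ZG \<longleftrightarrow> (x \<in> extensional (open_normal G) \<and> (\<forall>U\<in>open_normal G. x U \<in> carrier (ZQ U))) \<and>
      (\<forall>U\<in>open_normal G. \<forall>V\<in>open_normal G. V \<subseteq> U \<longrightarrow>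
        (\<forall>c\<in>rcosets U. x U c = (\<Oplus>\<^bsub>Zl l\<^esub>d\<in>{d \<in> rcosets V. d \<subseteq> c}. x V d)))"
    by (simp add: Zl_group_ring_def PiE_iff conj_commute)
  ultimately show ?thesis by blast
qed

lemma Zl_group_ring_simps:
  "x \<otimes>\<^bsub>ZG\<^esub> y = (\<lambda>U\<in>open_normal G. x U \<otimes>\<^bsub>ZQ U\<^esub> y U)"
  "\<one>\<^bsub>ZG\<^esub> = (\<lambda>U\<in>open_normal G. \<one>\<^bsub>ZQ U\<^esub>)"
  "\<zero>\<^bsub>ZG\<^esub> = (\<lambda>U\<in>open_normal G. \<zero>\<^bsub>ZQ U\<^esub>)"
  "x \<oplus>\<^bsub>ZG\<^esub> y = (\<lambda>U\<in>open_normal G. x U \<oplus>\<^bsub>ZQ U\<^esub> y U)"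
  by (simp_all add: Zl_group_ring_def)

lemma Zl_group_ringD:
  assumes "x \<in> carrier ZG"
  shows "x \<in> extensional (open_normal G)"
    and "\<And>U. U \<in> open_normal G \<Longrightarrow> x U \<in> carrier (ZQ U)"
    and "\<And>U V. U \<in> open_normal G \<Longrightarrow> V \<in> open_normal G \<Longrightarrow> V \<subseteq> U \<Longrightarrow>
      push_forward l (G Mod V) (G Mod U) (factor_map G U (\<lambda>x. x)) (x V) = x U"
proof -
  note x = assms[unfolded Zl_group_ring_carrier]
  show "x \<in> extensional (open_normal G)" using x by (rule conjunct1)
  show "x U \<in> carrier (ZQ U)" if "U \<in> open_normal G" for U
    using x[THEN conjunct2, THEN conjunct1, THEN bspec, OF that] .
  show "push_forward l (G Mod V) (G Mod U) (factor_map G U (\<lambda>x. x)) (x V) = x U"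
    if "U \<in> open_normal G" "V \<in> open_normal G" "V \<subseteq> U" for U V
    using x[THEN conjunct2, THEN conjunct2, rule_format, OF that] by (simp only: projection_def)
qed

lemmas Zl_group_ring_at = Zl_group_ringD(2)

lemma Zl_group_ring_eqI:
  assumes "x \<in> carrier ZG" "y \<in> carrier ZG" "\<And>U. U \<in> open_normal G \<Longrightarrow> x U = y U"
  shows "x = y"
  using Zl_group_ringD(1)[OF assms(1)] Zl_group_ringD(1)[OF assms(2)] assms(3) by (rule extensionalityI)

text \<open>All ring operations of the inverse limit are computed componentwise, and the transition maps
  are ring homomorphisms.\<close>

lemma Zl_group_ring_op_closed:
  assumes "\<And>U. U \<in> open_normal G \<Longrightarrow> z U \<in> carrier (ZQ U)"
    "\<And>U V. U \<in> open_normal G \<Longrightarrow> V \<in> open_normal G \<Longrightarrow> V \<subseteq> U \<Longrightarrow>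
      push_forward l (G Mod V) (G Mod U) (factor_map G U (\<lambda>x. x)) (z V) = z U"
  shows "(\<lambda>U\<in>open_normal G. z U) \<in> carrier ZG"
  unfolding Zl_group_ring_carrier projection_def using assms by simp

lemma Zl_group_ring_is_ring: "ring ZG"
proof (rule ringI)
  note at = Zl_group_ring_at
  have comp: "push_forward l (G Mod V) (G Mod U) (factor_map G U (\<lambda>x. x)) (x V) = x U"
    if "x \<in> carrier ZG" "U \<in> open_normal G" "V \<in> open_normal G" "V \<subseteq> U" for x U V
    using that by (rule Zl_group_ringD(3))
  have add_closed: "x \<oplus>\<^bsub>ZG\<^esub> y \<in> carrier ZG" if "x \<in> carrier ZG" "y \<in> carrier ZG" for x y
    unfolding Zl_group_ring_simps using that
    by (intro Zl_group_ring_op_closed)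
      (auto simp: ring_hom_add[OF projection_hom] comp at ring.ring_simprules(1)[OF ring_ZQ])
  have mult_closed: "x \<otimes>\<^bsub>ZG\<^esub> y \<in> carrier ZG" if "x \<in> carrier ZG" "y \<in> carrier ZG" for x y
    unfolding Zl_group_ring_simps using that
    by (intro Zl_group_ring_op_closed)
      (auto simp: ring_hom_mult[OF projection_hom] comp at ring.ring_simprules(5)[OF ring_ZQ])
  have one_closed: "\<one>\<^bsub>ZG\<^esub> \<in> carrier ZG"
    unfolding Zl_group_ring_simps
    by (intro Zl_group_ring_op_closed)
      (auto simp: ring_hom_one[OF projection_hom] ring.ring_simprules(6)[OF ring_ZQ])
  have zero_closed: "\<zero>\<^bsub>ZG\<^esub> \<in> carrier ZG"
    unfolding Zl_group_ring_simps
    by (intro Zl_group_ring_op_closed)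
      (auto simp: ring_hom_zero[OF projection_hom ring_ZQ ring_ZQ] ring.ring_simprules(2)[OF ring_ZQ])
  have minus_closed: "(\<lambda>U\<in>open_normal G. \<ominus>\<^bsub>ZQ U\<^esub> x U) \<in> carrier ZG" if x: "x \<in> carrier ZG" for x
  proof (rule Zl_group_ring_op_closed)
    fix U V assume UV: "U \<in> open_normal G" "V \<in> open_normal G" "V \<subseteq> U"
    interpret p: ring_hom_ring "ZQ V" "ZQ U" "push_forward l (G Mod V) (G Mod U) (factor_map G U (\<lambda>x. x))"
      using UV by (intro ring_hom_ringI2 ring_ZQ projection_hom)
    show "push_forward l (G Mod V) (G Mod U) (factor_map G U (\<lambda>x. x)) (\<ominus>\<^bsub>ZQ V\<^esub> x V) = \<ominus>\<^bsub>ZQ U\<^esub> x U"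
      using UV x by (simp add: comp at)
  qed (use x in \<open>auto simp: at ring.ring_simprules(3)[OF ring_ZQ]\<close>)
  show "abelian_group ZG"
  proof (rule abelian_groupI)
    fix x assume x: "x \<in> carrier ZG"
    show "\<exists>y\<in>carrier ZG. y \<oplus>\<^bsub>ZG\<^esub> x = \<zero>\<^bsub>ZG\<^esub>"
      using x minus_closed[OF x]
      by (intro bexI[OF _ minus_closed[OF x]])
        (auto simp: Zl_group_ring_simps at ring.ring_simprules(9)[OF ring_ZQ] intro!: restrict_ext)
    show "\<zero>\<^bsub>ZG\<^esub> \<oplus>\<^bsub>ZG\<^esub> x = x"
      using x zero_closed by (intro Zl_group_ring_eqI add_closed)
        (auto simp: Zl_group_ring_simps at ring.ring_simprules(8)[OF ring_ZQ])
  next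
    fix x y assume "x \<in> carrier ZG" "y \<in> carrier ZG"
    then show "x \<oplus>\<^bsub>ZG\<^esub> y = y \<oplus>\<^bsub>ZG\<^esub> x"
      by (auto simp: Zl_group_ring_simps at ring.ring_simprules(10)[OF ring_ZQ] intro!: restrict_ext)
  next
    fix x y z assume "x \<in> carrier ZG" "y \<in> carrier ZG" "z \<in> carrier ZG"
    then show "x \<oplus>\<^bsub>ZG\<^esub> y \<oplus>\<^bsub>ZG\<^esub> z = x \<oplus>\<^bsub>ZG\<^esub> (y \<oplus>\<^bsub>ZG\<^esub> z)"
      by (auto simp: Zl_group_ring_simps at ring.ring_simprules(7)[OF ring_ZQ] intro!: restrict_ext)
  qed (rule add_closed zero_closed; assumption)+
  show "monoid ZG"
  proof (rule monoidI)
    fix x assume x: "x \<in> carrier ZG"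
    show "\<one>\<^bsub>ZG\<^esub> \<otimes>\<^bsub>ZG\<^esub> x = x" "x \<otimes>\<^bsub>ZG\<^esub> \<one>\<^bsub>ZG\<^esub> = x"
      using x one_closed by (auto intro!: Zl_group_ring_eqI mult_closed)
        (auto simp: Zl_group_ring_simps at ring.ring_simprules(12)[OF ring_ZQ] monoid.r_one[OF ring.is_monoid[OF ring_ZQ]])
  next
    fix x y z assume "x \<in> carrier ZG" "y \<in> carrier ZG" "z \<in> carrier ZG"
    then show "x \<otimes>\<^bsub>ZG\<^esub> y \<otimes>\<^bsub>ZG\<^esub> z = x \<otimes>\<^bsub>ZG\<^esub> (y \<otimes>\<^bsub>ZG\<^esub> z)"
      by (auto simp: Zl_group_ring_simps at ring.ring_simprules(11)[OF ring_ZQ] intro!: restrict_ext)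
  qed (rule mult_closed one_closed; assumption)+
  fix x y z assume "x \<in> carrier ZG" "y \<in> carrier ZG" "z \<in> carrier ZG"
  then show "(x \<oplus>\<^bsub>ZG\<^esub> y) \<otimes>\<^bsub>ZG\<^esub> z = x \<otimes>\<^bsub>ZG\<^esub> z \<oplus>\<^bsub>ZG\<^esub> y \<otimes>\<^bsub>ZG\<^esub> z"
    "z \<otimes>\<^bsub>ZG\<^esub> (x \<oplus>\<^bsub>ZG\<^esub> y) = z \<otimes>\<^bsub>ZG\<^esub> x \<oplus>\<^bsub>ZG\<^esub> z \<otimes>\<^bsub>ZG\<^esub> y"
    by (auto simp: Zl_group_ring_simps at ring.ring_simprules(13)[OF ring_ZQ]
        ring.ring_simprules(23)[OF ring_ZQ] intro!: restrict_ext)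
qed

sublocale ZG: ring ZG by (rule Zl_group_ring_is_ring)

lemma Zl_const_eq: "Zl_const l G a = (\<lambda>U\<in>open_normal G. group_ring_const l (G Mod U) a)"
  by (simp add: Zl_const_def group_ring_const_def carrier_Mod one_FactGroup)

lemma Zl_const_hom: "ring_hom_ring (Zl l) ZG (Zl_const l G)"
proof (rule ring_hom_ringI2)
  have hom: "group_ring_const l (G Mod U) \<in> ring_hom (Zl l) (ZQ U)" if "U \<in> open_normal G" for U
    by (rule finite_group_ring.group_ring_const_hom[OF finite_group_ring_Mod[OF that]])
  show "Zl_const l G \<in> ring_hom (Zl l) ZG"
  proof (rule ring_hom_memI)
    fix a assume a: "a \<in> carrier (Zl l)"
    show "Zl_const l G a \<in> carrier ZG"
      unfolding Zl_const_eq
    proof (rule Zl_group_ring_op_closed)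
      fix U V assume UV: "U \<in> open_normal G" "V \<in> open_normal G" "V \<subseteq> U"
      interpret p: factor_hom G G "\<lambda>x. x" V U using UV by (rule projection_factor_hom)
      interpret finite_group_ring_hom l "G Mod V" "G Mod U" "factor_map G U (\<lambda>x. x)"
        using finite_group_ring_Mod[OF UV(1)] finite_group_ring_Mod[OF UV(2)]
        by (auto simp: finite_group_ring_hom_def finite_group_ring_hom_axioms_def p.factor_map_hom)
      show "push_forward l (G Mod V) (G Mod U) (factor_map G U (\<lambda>x. x)) (group_ring_const l (G Mod V) a) =
          group_ring_const l (G Mod U) a"
        using a by (rule push_forward_const)
    qed (use a in \<open>auto intro: ring_hom_closed[OF hom]\<close>)
  next
    fix a b assume "a \<in> carrier (Zl l)" "b \<in> carrier (Zl l)"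
    then show "Zl_const l G (a \<otimes>\<^bsub>Zl l\<^esub> b) = Zl_const l G a \<otimes>\<^bsub>ZG\<^esub> Zl_const l G b"
      "Zl_const l G (a \<oplus>\<^bsub>Zl l\<^esub> b) = Zl_const l G a \<oplus>\<^bsub>ZG\<^esub> Zl_const l G b"
      by (auto simp: Zl_const_eq Zl_group_ring_simps ring_hom_mult[OF hom] ring_hom_add[OF hom]
          intro!: restrict_ext)
  qed (auto simp: Zl_const_eq Zl_group_ring_simps group_ring_simps(2) intro!: restrict_ext)
qed (rule Zl.ring_axioms Zl_group_ring_is_ring)+

subsection \<open>Augmentation\<close>

definition augmentation :: "'g Zl_elem \<Rightarrow> nat \<Rightarrow> int" where
  "augmentation x = x (carrier G) (carrier G)"

lemma carrier_Mod_whole: "carrier (G Mod carrier G) = {carrier G}"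
  by (simp add: carrier_Mod rcosets_carrier)

lemma augmentation_hom: "ring_hom_ring ZG (Zl l) augmentation"
proof (rule ring_hom_ringI2)
  interpret Q: finite_group_ring l "G Mod carrier G" using whole by (rule finite_group_ring_Mod)
  have mem: "carrier G \<in> carrier (G Mod carrier G)" by (simp add: carrier_Mod_whole)
  have one: "\<one>\<^bsub>G Mod carrier G\<^esub> = carrier G" by (rule one_FactGroup)
  have closed: "augmentation x \<in> carrier (Zl l)" if "x \<in> carrier ZG" for x
    using Zl_group_ring_at[OF that whole] mem by (auto simp: augmentation_def group_ring_simps)
  show "augmentation \<in> ring_hom ZG (Zl l)"
  proof (rule ring_hom_memI)
    fix x y assume xy: "x \<in> carrier ZG" "y \<in> carrier ZG"
    then have at: "x (carrier G) \<in> carrier (G Mod carrier G) \<rightarrow>\<^sub>E carrier (Zl l)"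
        "y (carrier G) \<in> carrier (G Mod carrier G) \<rightarrow>\<^sub>E carrier (Zl l)"
      using Zl_group_ring_at[OF _ whole] by (auto simp: group_ring_simps)
    have inv: "inv\<^bsub>G Mod carrier G\<^esub> carrier G \<otimes>\<^bsub>G Mod carrier G\<^esub> carrier G = carrier G"
      using Q.l_inv[OF mem] one by simp
    show "augmentation (x \<otimes>\<^bsub>ZG\<^esub> y) = augmentation x \<otimes>\<^bsub>Zl l\<^esub> augmentation y"
    proof
      fix n
      have "augmentation (x \<otimes>\<^bsub>ZG\<^esub> y) n = (x (carrier G) \<otimes>\<^bsub>Q.ZA\<^esub> y (carrier G)) (carrier G) n"
        using whole by (simp add: augmentation_def Zl_group_ring_simps)
      also have "\<dots> = (augmentation x n * augmentation y n) mod int l ^ n"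
        using Q.group_ring_mult_at[OF at mem, of n] by (simp add: carrier_Mod_whole inv[simplified] augmentation_def)
      finally show "augmentation (x \<otimes>\<^bsub>ZG\<^esub> y) n = (augmentation x \<otimes>\<^bsub>Zl l\<^esub> augmentation y) n"
        by (simp add: Zl_simps(2))
    qed
    show "augmentation (x \<oplus>\<^bsub>ZG\<^esub> y) = augmentation x \<oplus>\<^bsub>Zl l\<^esub> augmentation y"
      using whole mem by (simp add: augmentation_def Zl_group_ring_simps group_ring_simps)
    show "augmentation x \<in> carrier (Zl l)" using xy by (simp add: closed)
  next
    show "augmentation \<one>\<^bsub>ZG\<^esub> = \<one>\<^bsub>Zl l\<^esub>"
      using whole mem by (simp add: augmentation_def Zl_group_ring_simps group_ring_simps
          group_ring_const_def one)
  qed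
qed (rule Zl.ring_axioms Zl_group_ring_is_ring)+

sublocale aug: ring_hom_ring ZG "Zl l" augmentation by (rule augmentation_hom)

lemma aug_ideal_eq: "aug_ideal l G = {x \<in> carrier ZG. augmentation x = \<zero>\<^bsub>Zl l\<^esub>}"
  by (simp add: aug_ideal_def augmentation_def)

lemma aug_ideal_is_ideal: "ideal (aug_ideal l G) ZG"
  using aug.kernel_is_ideal unfolding aug_ideal_eq a_kernel_def' .

lemma aug_pow_is_ideal: "ideal (aug_pow l G n) ZG"
  by (induction n) (simp_all add: ZG.oneideal ZG.ideal_prod_is_ideal aug_ideal_is_ideal)

end

subsection \<open>Functoriality\<close>

locale pro_group_hom = G?: pro_group l G + H?: pro_group l H
  for l and G :: "'g topgroup" and H :: "'h topgroup" +
  fixes f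
  assumes f: "f \<in> hom G H"
    and preimage_open_normal: "\<And>V. V \<in> open_normal H \<Longrightarrow> {g \<in> carrier G. f g \<in> V} \<in> open_normal G"
begin

abbreviation "pre V \<equiv> {g \<in> carrier G. f g \<in> V}"

lemma factor_hom_pre: "V \<in> open_normal H \<Longrightarrow> factor_hom G H f (pre V) V"
  using G.open_normalD(1)[OF preimage_open_normal[of V]] H.open_normalD(1)[of V] f
  by (intro factor_hom.intro factor_hom_axioms.intro G.is_group H.is_group) auto

lemma finite_group_ring_hom_pre:
  "V \<in> open_normal H \<Longrightarrow> finite_group_ring_hom l (G Mod pre V) (H Mod V) (factor_map H V f)"
  by (intro finite_group_ring_hom.intro finite_group_ring_hom_axioms.intro
      G.finite_group_ring_Mod[OF preimage_open_normal] H.finite_group_ring_Mod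
      factor_hom.factor_map_hom[OF factor_hom_pre])

lemma Zl_map_eq:
  "Zl_map l G H f x = (\<lambda>V\<in>open_normal H. push_forward l (G Mod pre V) (H Mod V) (factor_map H V f) (x (pre V)))"
proof -
  have "{d \<in> rcosets\<^bsub>G\<^esub> (pre V). f ` d \<subseteq> c} = {d \<in> rcosets\<^bsub>G\<^esub> (pre V). factor_map H V f d = c}"
    if "V \<in> open_normal H" "c \<in> rcosets\<^bsub>H\<^esub> V" for V c
    using factor_hom.factor_map_eq_iff[OF factor_hom_pre[OF that(1)] _ that(2)] by auto
  then show ?thesis
    by (auto simp: Zl_map_def push_forward_def carrier_Mod Let_def intro!: restrict_ext)
qed

text \<open>Pushing forward to \<open>H/V\<close> and then to \<open>H/U\<close> is the same as pushing forward along the composite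
  \<open>G/f\<^sup>-\<^sup>1(V) \<rightarrow> G/f\<^sup>-\<^sup>1(U) \<rightarrow> H/U\<close>.\<close>

lemma Zl_map_closed:
  assumes x: "x \<in> carrier G.ZG"
  shows "Zl_map l G H f x \<in> carrier H.ZG"
  unfolding Zl_map_eq
proof (rule H.Zl_group_ring_op_closed)
  fix V assume V: "V \<in> open_normal H"
  then show "push_forward l (G Mod pre V) (H Mod V) (factor_map H V f) (x (pre V)) \<in> carrier (H.ZQ V)"
    using ring_hom_closed[OF finite_group_ring_hom.push_forward_hom[OF finite_group_ring_hom_pre[OF V]]]
      G.Zl_group_ring_at[OF x preimage_open_normal[OF V]] by auto
next
  fix U V assume UV: "U \<in> open_normal H" "V \<in> open_normal H" "V \<subseteq> U"
  note pU = preimage_open_normal[OF UV(1)] and pV = preimage_open_normal[OF UV(2)]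
  have sub: "pre V \<subseteq> pre U" using UV(3) by auto
  interpret hV: factor_hom G H f "pre V" V using UV(2) by (rule factor_hom_pre)
  interpret hU: factor_hom G H f "pre U" U using UV(1) by (rule factor_hom_pre)
  interpret pG: factor_hom G G "\<lambda>x. x" "pre V" "pre U" using pU pV sub by (rule G.projection_factor_hom)
  interpret pH: factor_hom H H "\<lambda>x. x" V U using UV by (rule H.projection_factor_hom)
  interpret A: finite_group_ring l "G Mod pre V" using pV by (rule G.finite_group_ring_Mod)
  interpret B: finite_group_ring l "H Mod V" using UV(2) by (rule H.finite_group_ring_Mod)
  interpret D: finite_group_ring l "G Mod pre U" using pU by (rule G.finite_group_ring_Mod)
  have xV: "x (pre V) \<in> carrier (G Mod pre V) \<rightarrow>\<^sub>E carrier (Zl l)"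
    using G.Zl_group_ring_at[OF x pV] by (simp add: group_ring_simps)
  have xU: "x (pre U) = push_forward l (G Mod pre V) (G Mod pre U) (factor_map G (pre U) (\<lambda>x. x)) (x (pre V))"
    using G.Zl_group_ringD(3)[OF x pU pV sub] by (rule sym)
  have coset: "\<exists>g\<in>carrier G. C = pre V #>\<^bsub>G\<^esub> g" if "C \<in> carrier (G Mod pre V)" for C
    using that by (auto simp: carrier_Mod RCOSETS_def)
  have "push_forward l (H Mod V) (H Mod U) (factor_map H U (\<lambda>x. x))
      (push_forward l (G Mod pre V) (H Mod V) (factor_map H V f) (x (pre V))) =
      push_forward l (G Mod pre V) (H Mod U) (\<lambda>C. factor_map H U (\<lambda>x. x) (factor_map H V f C)) (x (pre V))"
    using xV A.fin B.fin hV.factor_map_closed by (intro push_forward_comp) auto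
  also have "\<dots> = push_forward l (G Mod pre U) (H Mod U) (factor_map H U f) (x (pre U))"
    unfolding xU
  proof (rule push_forward_comp[symmetric])
    fix C assume "C \<in> carrier (G Mod pre V)"
    then obtain g where g: "g \<in> carrier G" "C = pre V #>\<^bsub>G\<^esub> g" using coset by auto
    then show "factor_map H U (\<lambda>x. x) (factor_map H V f C) =
        factor_map H U f (factor_map G (pre U) (\<lambda>x. x) C)"
      using hV.f.hom_closed[OF g(1)]
      by (simp add: hV.factor_map_coset hU.factor_map_coset pG.factor_map_coset pH.factor_map_coset)
  qed (use xV A.fin D.fin pG.factor_map_closed in auto)
  finally show "push_forward l (H Mod V) (H Mod U) (factor_map H U (\<lambda>x. x))
      (push_forward l (G Mod pre V) (H Mod V) (factor_map H V f) (x (pre V))) =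
      push_forward l (G Mod pre U) (H Mod U) (factor_map H U f) (x (pre U))" .
qed

lemma Zl_map_hom: "ring_hom_ring G.ZG H.ZG (Zl_map l G H f)"
proof (rule ring_hom_ringI2)
  note hom = finite_group_ring_hom.push_forward_hom[OF finite_group_ring_hom_pre]
  show "Zl_map l G H f \<in> ring_hom G.ZG H.ZG"
  proof (rule ring_hom_memI)
    fix x y assume xy: "x \<in> carrier G.ZG" "y \<in> carrier G.ZG"
    note at = G.Zl_group_ring_at[OF xy(1) preimage_open_normal] G.Zl_group_ring_at[OF xy(2) preimage_open_normal]
    show "Zl_map l G H f (x \<otimes>\<^bsub>G.ZG\<^esub> y) = Zl_map l G H f x \<otimes>\<^bsub>H.ZG\<^esub> Zl_map l G H f y"
      "Zl_map l G H f (x \<oplus>\<^bsub>G.ZG\<^esub> y) = Zl_map l G H f x \<oplus>\<^bsub>H.ZG\<^esub> Zl_map l G H f y"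
      by (auto simp: Zl_map_eq G.Zl_group_ring_simps H.Zl_group_ring_simps preimage_open_normal at
          ring_hom_mult[OF hom] ring_hom_add[OF hom] intro!: restrict_ext)
    show "Zl_map l G H f x \<in> carrier H.ZG" using xy(1) by (rule Zl_map_closed)
  next
    show "Zl_map l G H f \<one>\<^bsub>G.ZG\<^esub> = \<one>\<^bsub>H.ZG\<^esub>"
      by (auto simp: Zl_map_eq G.Zl_group_ring_simps H.Zl_group_ring_simps preimage_open_normal
          ring_hom_one[OF hom] intro!: restrict_ext)
  qed
qed (rule G.Zl_group_ring_is_ring H.Zl_group_ring_is_ring)+

sublocale Zl_map: ring_hom_ring G.ZG H.ZG "Zl_map l G H f" by (rule Zl_map_hom)

lemma Zl_map_const:
  assumes a: "a \<in> carrier (Zl l)"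
  shows "Zl_map l G H f (Zl_const l G a) = Zl_const l H a"
  unfolding Zl_map_eq G.Zl_const_eq H.Zl_const_eq
  using finite_group_ring_hom.push_forward_const[OF finite_group_ring_hom_pre _ ] a
  by (auto simp: preimage_open_normal intro!: restrict_ext)

lemma augmentation_Zl_map:
  assumes x: "x \<in> carrier G.ZG"
  shows "H.augmentation (Zl_map l G H f x) = G.augmentation x"
proof -
  have pre: "pre (carrier H) = carrier G" using f by (auto simp: hom_def)
  interpret h: factor_hom G H f "pre (carrier H)" "carrier H" using H.whole by (rule factor_hom_pre)
  have mem: "carrier G \<in> carrier (G Mod carrier G)" "carrier H \<in> carrier (H Mod carrier H)"
    by (simp_all add: G.carrier_Mod_whole H.carrier_Mod_whole)
  have "factor_map H (carrier H) f (carrier G) = carrier H"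
    using h.factor_map_closed[of "carrier G"] mem unfolding pre H.carrier_Mod_whole by auto
  then have "{a \<in> carrier (G Mod carrier G). factor_map H (carrier H) f a = carrier H} = {carrier G}"
    by (auto simp: G.carrier_Mod_whole)
  moreover have "x (carrier G) (carrier G) \<in> carrier (Zl l)"
    using ring_hom_closed[OF G.aug.homh x] by (simp add: G.augmentation_def)
  ultimately show ?thesis
    using H.whole mem by (simp add: H.augmentation_def G.augmentation_def Zl_map_eq pre push_forward_def)
qed

lemma Zl_map_aug_pow: "x \<in> aug_pow l G n \<Longrightarrow> Zl_map l G H f x \<in> aug_pow l H n"
proof (induction n arbitrary: x)
  case 0
  then show ?case using ring_hom_closed[OF Zl_map.homh] by simp
next
  case (Suc n)
  have In: "a \<in> carrier G.ZG" if "a \<in> aug_pow l G k" for a k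
    using that by (rule ideal.Icarr[OF G.aug_pow_is_ideal])
  have aug: "a \<in> carrier G.ZG" "Zl_map l G H f a \<in> aug_ideal l H" if "a \<in> aug_ideal l G" for a
    using that ring_hom_closed[OF Zl_map.homh, of a]
    by (simp_all add: G.aug_ideal_eq H.aug_ideal_eq augmentation_Zl_map)
  from Suc.prems have "x \<in> ideal_prod G.ZG (aug_pow l G n) (aug_ideal l G)" by simp
  then have "x \<in> carrier G.ZG \<and> Zl_map l G H f x \<in> ideal_prod H.ZG (aug_pow l H n) (aug_ideal l H)"
  proof (induction x rule: ideal_prod.induct)
    case (prod i j)
    have "Zl_map l G H f (i \<otimes>\<^bsub>G.ZG\<^esub> j) = Zl_map l G H f i \<otimes>\<^bsub>H.ZG\<^esub> Zl_map l G H f j"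
      using In[OF prod(1)] aug(1)[OF prod(2)] by (rule ring_hom_mult[OF Zl_map.homh])
    then show ?case
      using ideal_prod.prod[OF Suc.IH[OF prod(1)] aug(2)[OF prod(2)]]
        In[OF prod(1)] aug(1)[OF prod(2)] by (simp only: G.ZG.m_closed simp_thms)
  next
    case (sum a b)
    then have "Zl_map l G H f (a \<oplus>\<^bsub>G.ZG\<^esub> b) = Zl_map l G H f a \<oplus>\<^bsub>H.ZG\<^esub> Zl_map l G H f b"
      by (intro ring_hom_add[OF Zl_map.homh]) blast+
    then show ?case
      using sum by (simp only: G.ZG.a_closed ideal_prod.sum simp_thms)
  qed
  then show ?case by simp
qed

end

section \<open>Quotients by powers of the augmentation ideal and their rationalizations\<close>

lemma quot_carrierE:
  assumes "C \<in> carrier (R Quot I)"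
  obtains x where "x \<in> carrier R" "C = I +>\<^bsub>R\<^esub> x"
  using assms by (auto simp: FactRing_def A_RCOSETS_def')

locale quot_hom = ring_hom_ring R S h + I: ideal I R + J: ideal J S
  for R :: "('a, 'm) ring_scheme" and S :: "('b, 'n) ring_scheme" and h I J +
  assumes hIJ: "h ` I \<subseteq> J"
begin

lemma quot_map_coset:
  assumes x: "x \<in> carrier R"
  shows "J <+>\<^bsub>S\<^esub> (h ` (I +>\<^bsub>R\<^esub> x)) = J +>\<^bsub>S\<^esub> h x"
proof -
  interpret factor_hom "add_monoid R" "add_monoid S" h I J
    using I.a_normal J.a_normal hIJ
    by (intro factor_hom.intro factor_hom_axioms.intro R.add.is_group S.add.is_group) (auto simp: hom_def)
  show ?thesis
    using factor_map_coset[of x] x by (simp add: factor_map_def set_add_def a_r_coset_def)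
qed

lemma quot_map_hom: "ring_hom_ring (R Quot I) (S Quot J) (\<lambda>C. J <+>\<^bsub>S\<^esub> (h ` C))"
proof (rule ring_hom_ringI2)
  note RI = I.rcos_ring_hom and SJ = J.rcos_ring_hom
  show "(\<lambda>C. J <+>\<^bsub>S\<^esub> (h ` C)) \<in> ring_hom (R Quot I) (S Quot J)"
  proof (rule ring_hom_memI)
    fix C D assume CD: "C \<in> carrier (R Quot I)" "D \<in> carrier (R Quot I)"
    obtain x where x: "x \<in> carrier R" "C = I +>\<^bsub>R\<^esub> x" using CD(1) by (rule quot_carrierE)
    obtain y where y: "y \<in> carrier R" "D = I +>\<^bsub>R\<^esub> y" using CD(2) by (rule quot_carrierE)
    have hxy: "h x \<in> carrier S" "h y \<in> carrier S" using x y by auto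
    show "J <+>\<^bsub>S\<^esub> (h ` C) \<in> carrier (S Quot J)"
      using x ring_hom_closed[OF SJ hxy(1)] by (simp add: quot_map_coset)
    show "J <+>\<^bsub>S\<^esub> (h ` (C \<otimes>\<^bsub>R Quot I\<^esub> D)) = (J <+>\<^bsub>S\<^esub> (h ` C)) \<otimes>\<^bsub>S Quot J\<^esub> (J <+>\<^bsub>S\<^esub> (h ` D))"
      unfolding x(2) y(2)
      by (simp only: ring_hom_mult[OF RI x(1) y(1), symmetric] quot_map_coset x(1) y(1) R.m_closed
          hom_mult ring_hom_mult[OF SJ hxy])
    show "J <+>\<^bsub>S\<^esub> (h ` (C \<oplus>\<^bsub>R Quot I\<^esub> D)) = (J <+>\<^bsub>S\<^esub> (h ` C)) \<oplus>\<^bsub>S Quot J\<^esub> (J <+>\<^bsub>S\<^esub> (h ` D))"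
      unfolding x(2) y(2)
      by (simp only: ring_hom_add[OF RI x(1) y(1), symmetric] quot_map_coset x(1) y(1) R.a_closed
          hom_add ring_hom_add[OF SJ hxy])
  next
    show "J <+>\<^bsub>S\<^esub> (h ` \<one>\<^bsub>R Quot I\<^esub>) = \<one>\<^bsub>S Quot J\<^esub>"
      by (simp only: ring_hom_one[OF RI, symmetric] quot_map_coset R.one_closed hom_one ring_hom_one[OF SJ])
  qed
qed (rule I.quotient_is_ring J.quotient_is_ring)+

end

context pro_group
begin

abbreviation "Iq n \<equiv> aug_pow l G n"
abbreviation "Vn n \<equiv> Ql_quot l G n"

text \<open>The fraction \<open>x / l\<^sup>j\<close> in \<open>\<int>\<^sub>l[[G]]/I\<^sup>n \<otimes> \<rat>\<^sub>l\<close>.\<close>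

definition quot_frac :: "nat \<Rightarrow> 'g Zl_elem \<Rightarrow> nat \<Rightarrow> ('g Zl_elem set \<times> nat) set" where
  "quot_frac n x j = ell_frac l (Zl_quot l G n) (Iq n +>\<^bsub>ZG\<^esub> x) j"

lemma ring_Zl_quot: "ring (Zl_quot l G n)"
  unfolding Zl_quot_def by (rule ideal.quotient_is_ring[OF aug_pow_is_ideal])

lemma coset_hom: "ring_hom_ring ZG (Zl_quot l G n) ((+>\<^bsub>ZG\<^esub>) (Iq n))"
  unfolding Zl_quot_def by (rule ideal.rcos_ring_hom_ring[OF aug_pow_is_ideal])

sublocale Zq: ring "Zl_quot l G n" for n by (rule ring_Zl_quot)
sublocale Vn: ring "Vn n" for n by (rule Zq.rationalize_is_ring)
sublocale co: ring_hom_ring ZG "Zl_quot l G n" "(+>\<^bsub>ZG\<^esub>) (Iq n)" for n by (rule coset_hom)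

lemma coset_closed: "x \<in> carrier ZG \<Longrightarrow> Iq n +>\<^bsub>ZG\<^esub> x \<in> carrier (Zl_quot l G n)"
  by (rule ring_hom_closed[OF co.homh])

lemma Zl_quot_carrierE:
  assumes "C \<in> carrier (Zl_quot l G n)"
  obtains x where "x \<in> carrier ZG" "C = Iq n +>\<^bsub>ZG\<^esub> x"
  using assms unfolding Zl_quot_def by (rule quot_carrierE)

lemma Vn_carrierE:
  assumes "v \<in> carrier (Vn n)"
  obtains x j where "x \<in> carrier ZG" "v = quot_frac n x j"
  using assms unfolding quot_frac_def by (metis Zq.rationalize_carrierE Zl_quot_carrierE)

lemma quot_frac_closed: "x \<in> carrier ZG \<Longrightarrow> quot_frac n x j \<in> carrier (Vn n)"
  unfolding quot_frac_def by (intro Zq.ell_frac_closed coset_closed)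

lemma quot_frac_add:
  assumes "x \<in> carrier ZG" "y \<in> carrier ZG"
  shows "quot_frac n x j \<oplus>\<^bsub>Vn n\<^esub> quot_frac n y j = quot_frac n (x \<oplus>\<^bsub>ZG\<^esub> y) j"
  using assms unfolding quot_frac_def
  by (simp only: Zq.rationalize_add coset_closed ring_hom_add[OF co.homh])

lemma quot_frac_mult:
  assumes "x \<in> carrier ZG" "y \<in> carrier ZG"
  shows "quot_frac n x j \<otimes>\<^bsub>Vn n\<^esub> quot_frac n y k = quot_frac n (x \<otimes>\<^bsub>ZG\<^esub> y) (j + k)"
  using assms unfolding quot_frac_def
  by (simp only: Zq.rationalize_mult coset_closed ring_hom_mult[OF co.homh])

lemma quot_frac_expand:
  assumes "x \<in> carrier ZG"
  shows "quot_frac n x j = quot_frac n ([(l ^ k)] \<cdot>\<^bsub>ZG\<^esub> x) (j + k)"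
  using assms unfolding quot_frac_def
  by (simp only: co.hom_add_pow_nat) (rule Zq.ell_frac_expand[OF coset_closed])

lemma quot_frac_zero: "\<zero>\<^bsub>Vn n\<^esub> = quot_frac n \<zero>\<^bsub>ZG\<^esub> j"
  unfolding quot_frac_def
  by (simp only: ring_hom_zero[OF co.homh ZG.ring_axioms Zq.ring_axioms] Zq.rationalize_zero[of l n j])

lemma quot_frac_minus:
  assumes "x \<in> carrier ZG"
  shows "\<ominus>\<^bsub>Vn n\<^esub> quot_frac n x j = quot_frac n (\<ominus>\<^bsub>ZG\<^esub> x) j"
  unfolding quot_frac_def
  by (simp only: Zq.ell_frac_minus[OF coset_closed[OF assms]] co.hom_a_inv[OF assms])

lemma coset_eq_zero_iff:
  assumes "x \<in> carrier ZG"
  shows "Iq n +>\<^bsub>ZG\<^esub> x = \<zero>\<^bsub>Zl_quot l G n\<^esub> \<longleftrightarrow> x \<in> Iq n"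
proof -
  have sub: "abelian_subgroup (Iq n) ZG"
    using ideal.axioms(1)[OF aug_pow_is_ideal] ZG.abelian_group_axioms
    by (intro abelian_subgroupI3) (auto simp: additive_subgroup.a_subgroup)
  have z: "\<zero>\<^bsub>Zl_quot l G n\<^esub> = Iq n" unfolding Zl_quot_def FactRing_def by simp
  show ?thesis
  proof
    assume "Iq n +>\<^bsub>ZG\<^esub> x = \<zero>\<^bsub>Zl_quot l G n\<^esub>"
    then show "x \<in> Iq n" using abelian_subgroup.a_rcos_self[OF sub assms] unfolding z by simp
  next
    assume "x \<in> Iq n"
    then show "Iq n +>\<^bsub>ZG\<^esub> x = \<zero>\<^bsub>Zl_quot l G n\<^esub>"
      unfolding z by (rule abelian_subgroup.a_rcos_const[OF sub])
  qed
qed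

text \<open>The quotient \<open>\<int>\<^sub>l[[G]]/I\<^sup>n\<close> may have \<open>l\<close>-torsion, which dies in the rationalization.\<close>

lemma quot_frac_eq_zero_iff:
  assumes x: "x \<in> carrier ZG"
  shows "quot_frac n x j = \<zero>\<^bsub>Vn n\<^esub> \<longleftrightarrow> (\<exists>k. [(l ^ k :: nat)] \<cdot>\<^bsub>ZG\<^esub> x \<in> Iq n)"
proof -
  have "quot_frac n x j = \<zero>\<^bsub>Vn n\<^esub> \<longleftrightarrow> (\<exists>i. [(l ^ (i + 0))] \<cdot>\<^bsub>Zl_quot l G n\<^esub> (Iq n +>\<^bsub>ZG\<^esub> x) =
      [(l ^ (i + j))] \<cdot>\<^bsub>Zl_quot l G n\<^esub> \<zero>\<^bsub>Zl_quot l G n\<^esub>)"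
    unfolding quot_frac_def Zq.rationalize_zero[of l n 0]
    by (rule Zq.ell_frac_eq_iff[OF coset_closed[OF x] Zq.zero_closed])
  also have "\<dots> \<longleftrightarrow> (\<exists>i. Iq n +>\<^bsub>ZG\<^esub> ([(l ^ i)] \<cdot>\<^bsub>ZG\<^esub> x) = \<zero>\<^bsub>Zl_quot l G n\<^esub>)"
    using x by (simp add: co.hom_add_pow_nat)
  also have "\<dots> \<longleftrightarrow> (\<exists>i. [(l ^ i :: nat)] \<cdot>\<^bsub>ZG\<^esub> x \<in> Iq n)"
    using x by (simp only: coset_eq_zero_iff ZG.add.nat_pow_closed)
  finally show ?thesis .
qed

lemma quot_frac_zeroI: "x \<in> Iq n \<Longrightarrow> quot_frac n x j = \<zero>\<^bsub>Vn n\<^esub>"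
  using coset_eq_zero_iff[OF ideal.Icarr[OF aug_pow_is_ideal], of x n n]
  by (simp only: quot_frac_def Zq.rationalize_zero[of l n j] simp_thms)

subsection \<open>The rational completed group ring\<close>

lemma aug_pow_Suc_subset: "Iq (Suc n) \<subseteq> Iq n"
  using ZG.ideal_prod_inter[OF aug_pow_is_ideal aug_ideal_is_ideal] by simp

definition transition :: "nat \<Rightarrow> ('g Zl_elem set \<times> nat) set \<Rightarrow> ('g Zl_elem set \<times> nat) set" where
  "transition n = rationalize_map l (Zl_quot l G n) (\<lambda>C. Iq n <+>\<^bsub>ZG\<^esub> C)"

lemma transition_quot_hom: "quot_hom ZG ZG (\<lambda>x. x) (Iq (Suc n)) (Iq n)"
proof -
  have "ring_hom_ring ZG ZG (\<lambda>x. x)"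
    by (intro ring_hom_ringI2 ZG.ring_axioms) (auto simp: ring_hom_def)
  then show ?thesis
    using aug_pow_is_ideal[of n] aug_pow_is_ideal[of "Suc n"] aug_pow_Suc_subset[of n]
    by (intro quot_hom.intro quot_hom_axioms.intro) auto
qed

lemma quot_transition_hom: "ring_hom_ring (Zl_quot l G (Suc n)) (Zl_quot l G n) (\<lambda>C. Iq n <+>\<^bsub>ZG\<^esub> C)"
  using quot_hom.quot_map_hom[OF transition_quot_hom, of n] by (simp add: Zl_quot_def)

sublocale tr: ring_hom_ring "Vn (Suc n)" "Vn n" "transition n" for n
  unfolding transition_def by (rule ring_hom_ring.rationalize_map_hom[OF quot_transition_hom])

lemma transition_quot_frac:
  assumes x: "x \<in> carrier ZG"
  shows "transition n (quot_frac (Suc n) x j) = quot_frac n x j"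
proof -
  have "transition n (quot_frac (Suc n) x j) = ell_frac l (Zl_quot l G n) (Iq n <+>\<^bsub>ZG\<^esub> (Iq (Suc n) +>\<^bsub>ZG\<^esub> x)) j"
    unfolding transition_def quot_frac_def
    by (rule ring_hom_ring.rationalize_map_ell_frac[OF quot_transition_hom coset_closed[OF x]])
  also have "Iq n <+>\<^bsub>ZG\<^esub> (Iq (Suc n) +>\<^bsub>ZG\<^esub> x) = Iq n +>\<^bsub>ZG\<^esub> x"
    using quot_hom.quot_map_coset[OF transition_quot_hom x, of n] by simp
  finally show ?thesis by (simp add: quot_frac_def)
qed

abbreviation "QG \<equiv> Ql_group_ring l G"

lemma Ql_group_ring_simps:
  "g \<in> carrier QG \<longleftrightarrow> (\<forall>n. g n \<in> carrier (Vn n) \<and> transition n (g (Suc n)) = g n)"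
  "(g \<otimes>\<^bsub>QG\<^esub> h) n = g n \<otimes>\<^bsub>Vn n\<^esub> h n"
  "\<one>\<^bsub>QG\<^esub> n = \<one>\<^bsub>Vn n\<^esub>"
  "\<zero>\<^bsub>QG\<^esub> n = \<zero>\<^bsub>Vn n\<^esub>"
  "(g \<oplus>\<^bsub>QG\<^esub> h) n = g n \<oplus>\<^bsub>Vn n\<^esub> h n"
  by (simp_all add: Ql_group_ring_def transition_def)

lemma Ql_group_ringD:
  assumes "g \<in> carrier QG"
  shows "g n \<in> carrier (Vn n)" "transition n (g (Suc n)) = g n"
  using assms by (simp_all only: Ql_group_ring_simps(1))

lemma Ql_group_ringI:
  assumes "\<And>n. g n \<in> carrier (Vn n)" "\<And>n. transition n (g (Suc n)) = g n"
  shows "g \<in> carrier QG"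
  unfolding Ql_group_ring_simps(1) using assms by blast

lemma Ql_group_ring_is_ring: "ring QG"
proof (rule ringI)
  note D = Ql_group_ringD
  have add_closed: "g \<oplus>\<^bsub>QG\<^esub> h \<in> carrier QG" if "g \<in> carrier QG" "h \<in> carrier QG" for g h
    using D[OF that(1)] D[OF that(2)] by (intro Ql_group_ringI) (simp_all only: Ql_group_ring_simps Vn.a_closed ring_hom_add[OF tr.homh])
  have mult_closed: "g \<otimes>\<^bsub>QG\<^esub> h \<in> carrier QG" if "g \<in> carrier QG" "h \<in> carrier QG" for g h
    using D[OF that(1)] D[OF that(2)] by (intro Ql_group_ringI) (simp_all only: Ql_group_ring_simps Vn.m_closed ring_hom_mult[OF tr.homh])
  have one_closed: "\<one>\<^bsub>QG\<^esub> \<in> carrier QG"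
    by (intro Ql_group_ringI) (simp_all only: Ql_group_ring_simps Vn.one_closed ring_hom_one[OF tr.homh])
  have zero_closed: "\<zero>\<^bsub>QG\<^esub> \<in> carrier QG"
    by (intro Ql_group_ringI) (simp_all only: Ql_group_ring_simps Vn.zero_closed
        ring_hom_zero[OF tr.homh Vn.ring_axioms Vn.ring_axioms])
  have minus_closed: "(\<lambda>n. \<ominus>\<^bsub>Vn n\<^esub> g n) \<in> carrier QG" if g: "g \<in> carrier QG" for g
    using D[OF g] by (intro Ql_group_ringI) (simp_all add: tr.hom_a_inv)
  show "abelian_group QG"
  proof (rule abelian_groupI)
    fix g assume g: "g \<in> carrier QG"
    show "\<exists>h\<in>carrier QG. h \<oplus>\<^bsub>QG\<^esub> g = \<zero>\<^bsub>QG\<^esub>"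
      by (rule bexI[OF _ minus_closed[OF g]]) (rule ext, simp only: Ql_group_ring_simps Vn.l_neg D(1)[OF g])
    show "\<zero>\<^bsub>QG\<^esub> \<oplus>\<^bsub>QG\<^esub> g = g"
      by (rule ext) (simp only: Ql_group_ring_simps Vn.l_zero D(1)[OF g])
  next
    fix g h assume "g \<in> carrier QG" "h \<in> carrier QG"
    then show "g \<oplus>\<^bsub>QG\<^esub> h = h \<oplus>\<^bsub>QG\<^esub> g"
      by (intro ext) (simp add: Ql_group_ring_simps(5) D(1) Vn.a_comm)
  next
    fix g h k assume "g \<in> carrier QG" "h \<in> carrier QG" "k \<in> carrier QG"
    then show "g \<oplus>\<^bsub>QG\<^esub> h \<oplus>\<^bsub>QG\<^esub> k = g \<oplus>\<^bsub>QG\<^esub> (h \<oplus>\<^bsub>QG\<^esub> k)"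
      by (intro ext) (simp only: Ql_group_ring_simps(5) D(1) Vn.a_assoc)
  qed (rule add_closed zero_closed; assumption)+
  show "monoid QG"
  proof (rule monoidI)
    fix g assume g: "g \<in> carrier QG"
    show "\<one>\<^bsub>QG\<^esub> \<otimes>\<^bsub>QG\<^esub> g = g" "g \<otimes>\<^bsub>QG\<^esub> \<one>\<^bsub>QG\<^esub> = g"
      by (rule ext, simp only: Ql_group_ring_simps Vn.l_one Vn.r_one D(1)[OF g])+
  next
    fix g h k assume "g \<in> carrier QG" "h \<in> carrier QG" "k \<in> carrier QG"
    then show "g \<otimes>\<^bsub>QG\<^esub> h \<otimes>\<^bsub>QG\<^esub> k = g \<otimes>\<^bsub>QG\<^esub> (h \<otimes>\<^bsub>QG\<^esub> k)"
      by (intro ext) (simp only: Ql_group_ring_simps(2) D(1) Vn.m_assoc)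
  qed (rule mult_closed one_closed; assumption)+
  fix g h k assume "g \<in> carrier QG" "h \<in> carrier QG" "k \<in> carrier QG"
  then show "(g \<oplus>\<^bsub>QG\<^esub> h) \<otimes>\<^bsub>QG\<^esub> k = g \<otimes>\<^bsub>QG\<^esub> k \<oplus>\<^bsub>QG\<^esub> h \<otimes>\<^bsub>QG\<^esub> k"
    "k \<otimes>\<^bsub>QG\<^esub> (g \<oplus>\<^bsub>QG\<^esub> h) = k \<otimes>\<^bsub>QG\<^esub> g \<oplus>\<^bsub>QG\<^esub> k \<otimes>\<^bsub>QG\<^esub> h"
    by (intro ext, simp only: Ql_group_ring_simps(2,5) D(1) Vn.l_distr Vn.r_distr)+
qed

sublocale QG: ring QG by (rule Ql_group_ring_is_ring)

lemma Ql_group_ring_minus_at: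
  assumes "g \<in> carrier QG"
  shows "(\<ominus>\<^bsub>QG\<^esub> g) n = \<ominus>\<^bsub>Vn n\<^esub> g n"
proof -
  have "(\<ominus>\<^bsub>QG\<^esub> g) n \<oplus>\<^bsub>Vn n\<^esub> g n = \<zero>\<^bsub>Vn n\<^esub>"
    using fun_cong[OF QG.l_neg[OF assms], of n] by (simp only: Ql_group_ring_simps)
  then show ?thesis
    using Ql_group_ringD(1)[OF assms] Ql_group_ringD(1)[OF QG.a_inv_closed[OF assms]]
    by (metis Vn.minus_equality)
qed

lemma Ql_group_ring_diff_at:
  assumes "h \<in> carrier QG"
  shows "(g \<ominus>\<^bsub>QG\<^esub> h) n = g n \<ominus>\<^bsub>Vn n\<^esub> h n"
  using assms by (simp only: a_minus_def Ql_group_ring_simps(5) Ql_group_ring_minus_at)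

lemma Ql_group_ring_finsum_at:
  assumes "finite A" "f \<in> A \<rightarrow> carrier QG"
  shows "(\<Oplus>\<^bsub>QG\<^esub>a\<in>A. f a) n = (\<Oplus>\<^bsub>Vn n\<^esub>a\<in>A. f a n)"
  using assms
proof (induction A)
  case (insert a A)
  then have "f a \<in> carrier QG" "f \<in> A \<rightarrow> carrier QG" by auto
  moreover have "(\<lambda>a. f a n) \<in> A \<rightarrow> carrier (Vn n)" "f a n \<in> carrier (Vn n)"
    using insert.prems Ql_group_ringD(1) by auto
  ultimately show ?case using insert by (simp add: Ql_group_ring_simps(5))
qed (simp add: Ql_group_ring_simps(4))

subsection \<open>Scalars\<close>

lemma quot_const_hom: "ring_hom_ring (Zl l) (Zl_quot l G n) (\<lambda>a. Iq n +>\<^bsub>ZG\<^esub> Zl_const l G a)"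
proof (rule ring_hom_ringI2)
  note hom = ring_hom_ring.homh[OF Zl_const_hom]
  show "(\<lambda>a. Iq n +>\<^bsub>ZG\<^esub> Zl_const l G a) \<in> ring_hom (Zl l) (Zl_quot l G n)"
    by (rule ring_hom_memI)
      (simp_all only: coset_closed ring_hom_closed[OF hom] ring_hom_mult[OF hom] ring_hom_add[OF hom]
        ring_hom_one[OF hom] ring_hom_mult[OF co.homh] ring_hom_add[OF co.homh] ring_hom_one[OF co.homh])
qed (rule Zl.ring_axioms Zq.ring_axioms)+

sublocale qc: ring_hom_ring "Ql l" "Vn n" "Ql_quot_const l G n" for n
  unfolding Ql_quot_const_def by (rule ring_hom_ring.rationalize_map_hom[OF quot_const_hom])

lemma Zl_const_closed: "a \<in> carrier (Zl l) \<Longrightarrow> Zl_const l G a \<in> carrier ZG"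
  by (rule ring_hom_closed[OF ring_hom_ring.homh[OF Zl_const_hom]])

lemma Ql_quot_const_ell_frac:
  assumes "a \<in> carrier (Zl l)"
  shows "Ql_quot_const l G n (ell_frac l (Zl l) a j) = quot_frac n (Zl_const l G a) j"
  unfolding Ql_quot_const_def quot_frac_def
  using assms by (rule ring_hom_ring.rationalize_map_ell_frac[OF quot_const_hom])

lemma Ql_quot_const_transition:
  assumes "s \<in> carrier (Ql l)"
  shows "transition n (Ql_quot_const l G (Suc n) s) = Ql_quot_const l G n s"
proof -
  obtain a j where a: "a \<in> carrier (Zl l)" "s = ell_frac l (Zl l) a j"
    using assms by (rule Zl.rationalize_carrierE)
  then show ?thesis by (simp only: Ql_quot_const_ell_frac transition_quot_frac Zl_const_closed)
qed

lemma Ql_const_closed: "s \<in> carrier (Ql l) \<Longrightarrow> Ql_const l G s \<in> carrier QG"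
  by (intro Ql_group_ringI)
    (simp_all only: Ql_const_def Ql_quot_const_transition ring_hom_closed[OF qc.homh])

lemma Ql_scale_at: "Ql_scale l G s g n = Ql_quot_const l G n s \<otimes>\<^bsub>Vn n\<^esub> g n"
  by (simp only: Ql_scale_def Ql_group_ring_simps Ql_const_def)

lemma Ql_scale_closed: "s \<in> carrier (Ql l) \<Longrightarrow> g \<in> carrier QG \<Longrightarrow> Ql_scale l G s g \<in> carrier QG"
  by (simp only: Ql_scale_def QG.m_closed Ql_const_closed)

end

subsection \<open>Functoriality\<close>

context pro_group_hom
begin

definition quot_map :: "nat \<Rightarrow> ('g Zl_elem set \<times> nat) set \<Rightarrow> ('h Zl_elem set \<times> nat) set" where
  "quot_map n = rationalize_map l (Zl_quot l H n) (\<lambda>C. aug_pow l H n <+>\<^bsub>H.ZG\<^esub> (Zl_map l G H f ` C))"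

lemma Ql_map_at: "Ql_map l G H f g n = quot_map n (g n)"
  by (simp add: Ql_map_def quot_map_def)

lemma Zl_map_quot_hom: "quot_hom G.ZG H.ZG (Zl_map l G H f) (aug_pow l G n) (aug_pow l H n)"
  using G.aug_pow_is_ideal H.aug_pow_is_ideal Zl_map_aug_pow
  by (intro quot_hom.intro quot_hom_axioms.intro Zl_map_hom) auto

lemma Zl_quot_map_hom: "ring_hom_ring (Zl_quot l G n) (Zl_quot l H n)
    (\<lambda>C. aug_pow l H n <+>\<^bsub>H.ZG\<^esub> (Zl_map l G H f ` C))"
  unfolding Zl_quot_def by (rule quot_hom.quot_map_hom[OF Zl_map_quot_hom])

sublocale qm: ring_hom_ring "G.Vn n" "H.Vn n" "quot_map n" for n
  unfolding quot_map_def by (rule ring_hom_ring.rationalize_map_hom[OF Zl_quot_map_hom])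

lemma quot_map_quot_frac:
  assumes x: "x \<in> carrier G.ZG"
  shows "quot_map n (G.quot_frac n x j) = H.quot_frac n (Zl_map l G H f x) j"
proof -
  have "quot_map n (G.quot_frac n x j) = ell_frac l (Zl_quot l H n)
      (aug_pow l H n <+>\<^bsub>H.ZG\<^esub> (Zl_map l G H f ` (aug_pow l G n +>\<^bsub>G.ZG\<^esub> x))) j"
    unfolding quot_map_def G.quot_frac_def
    by (rule ring_hom_ring.rationalize_map_ell_frac[OF Zl_quot_map_hom G.coset_closed[OF x]])
  then show ?thesis by (simp only: quot_hom.quot_map_coset[OF Zl_map_quot_hom x] H.quot_frac_def)
qed

lemma quot_map_const:
  assumes "s \<in> carrier (Ql l)"
  shows "quot_map n (Ql_quot_const l G n s) = Ql_quot_const l H n s"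
proof -
  obtain a j where a: "a \<in> carrier (Zl l)" "s = ell_frac l (Zl l) a j"
    using assms by (rule G.Zl.rationalize_carrierE)
  then show ?thesis
    by (simp only: G.Ql_quot_const_ell_frac H.Ql_quot_const_ell_frac quot_map_quot_frac
        G.Zl_const_closed Zl_map_const)
qed

end

section \<open>The weight filtration modulo powers of the augmentation ideal\<close>

context pro_group
begin

text \<open>Powers of ideals are formed by multiplication on the right; multiplication on the left is needed
  for the weight filtration.\<close>

lemma aug_mult_aug_pow:
  assumes x: "x \<in> aug_ideal l G" and "y \<in> Iq k"
  shows "x \<otimes>\<^bsub>ZG\<^esub> y \<in> Iq (Suc k)"
  using assms(2)
proof (induction k arbitrary: y)
  case 0
  have xc: "x \<in> carrier ZG" using x by (rule ideal.Icarr[OF aug_ideal_is_ideal])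
  have "\<one>\<^bsub>ZG\<^esub> \<otimes>\<^bsub>ZG\<^esub> (x \<otimes>\<^bsub>ZG\<^esub> y) \<in> ideal_prod ZG (Iq 0) (aug_ideal l G)"
    using ideal.I_r_closed[OF aug_ideal_is_ideal x, of y] 0 by (intro ideal_prod.prod) simp_all
  then show ?case using xc 0 by simp
next
  case (Suc k)
  have xc: "x \<in> carrier ZG" using x by (rule ideal.Icarr[OF aug_ideal_is_ideal])
  have "y \<in> ideal_prod ZG (Iq k) (aug_ideal l G)" using Suc.prems by simp
  then have "y \<in> carrier ZG \<and> x \<otimes>\<^bsub>ZG\<^esub> y \<in> ideal_prod ZG (Iq (Suc k)) (aug_ideal l G)"
  proof (induction y rule: ideal_prod.induct)
    case (prod i j)
    have c: "i \<in> carrier ZG" "j \<in> carrier ZG"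
      using prod ideal.Icarr[OF aug_pow_is_ideal] ideal.Icarr[OF aug_ideal_is_ideal] by blast+
    have "(x \<otimes>\<^bsub>ZG\<^esub> i) \<otimes>\<^bsub>ZG\<^esub> j \<in> ideal_prod ZG (Iq (Suc k)) (aug_ideal l G)"
      using Suc.IH[OF prod(1)] prod(2) by (rule ideal_prod.prod)
    then show ?case using xc c by (simp only: ZG.m_assoc ZG.m_closed simp_thms)
  next
    case (sum s t)
    then show ?case using xc by (simp only: ZG.r_distr ZG.a_closed ideal_prod.sum simp_thms)
  qed
  then show ?case by simp
qed

lemma aug_pow_one: "Iq 1 = aug_ideal l G"
proof
  show "Iq 1 \<subseteq> aug_ideal l G"
    using ZG.ideal_prod_inter[OF aug_pow_is_ideal[of 0] aug_ideal_is_ideal] by simp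
  show "aug_ideal l G \<subseteq> Iq 1"
  proof
    fix x assume x: "x \<in> aug_ideal l G"
    have "x \<otimes>\<^bsub>ZG\<^esub> \<one>\<^bsub>ZG\<^esub> \<in> Iq (Suc 0)" using x by (rule aug_mult_aug_pow) simp
    then show "x \<in> Iq 1" using ideal.Icarr[OF aug_ideal_is_ideal x] by simp
  qed
qed

lemma aug_pow_antimono: "k \<le> m \<Longrightarrow> Iq m \<subseteq> Iq k"
  by (induction m rule: dec_induct) (use aug_pow_Suc_subset in blast)+

lemma aug_pow_ell_smult: "x \<in> Iq k \<Longrightarrow> [(n::nat)] \<cdot>\<^bsub>ZG\<^esub> x \<in> Iq k"
proof (induction n)
  case 0
  then show ?case using additive_subgroup.zero_closed[OF ideal.axioms(1)[OF aug_pow_is_ideal]] by simp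
next
  case (Suc n)
  then show ?case using additive_subgroup.a_closed[OF ideal.axioms(1)[OF aug_pow_is_ideal]] by simp
qed

text \<open>The image of \<open>I\<^sup>k \<otimes> \<rat>\<^sub>l\<close> in \<open>\<int>\<^sub>l[[G]]/I\<^sup>N \<otimes> \<rat>\<^sub>l\<close>.\<close>

definition aug_filtration :: "nat \<Rightarrow> nat \<Rightarrow> ('g Zl_elem set \<times> nat) set set" where
  "aug_filtration N k = {quot_frac N x j | x j. x \<in> Iq k}"

lemma aug_filtration_add:
  assumes "u \<in> aug_filtration N k" "v \<in> aug_filtration N k"
  shows "u \<oplus>\<^bsub>Vn N\<^esub> v \<in> aug_filtration N k"
proof -
  obtain x i y j where x: "u = quot_frac N x i" "x \<in> Iq k" and y: "v = quot_frac N y j" "y \<in> Iq k"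
    using assms by (auto simp: aug_filtration_def)
  have c: "x \<in> carrier ZG" "y \<in> carrier ZG" using x y ideal.Icarr[OF aug_pow_is_ideal] by blast+
  have u: "u = quot_frac N ([(l ^ j)] \<cdot>\<^bsub>ZG\<^esub> x) (i + j)"
    unfolding x(1) by (rule quot_frac_expand[OF c(1)])
  have v: "v = quot_frac N ([(l ^ i)] \<cdot>\<^bsub>ZG\<^esub> y) (i + j)"
    unfolding y(1) add.commute[of i j] by (rule quot_frac_expand[OF c(2)])
  have sum: "u \<oplus>\<^bsub>Vn N\<^esub> v = quot_frac N ([(l ^ j)] \<cdot>\<^bsub>ZG\<^esub> x \<oplus>\<^bsub>ZG\<^esub> [(l ^ i)] \<cdot>\<^bsub>ZG\<^esub> y) (i + j)"
    unfolding u v using c by (intro quot_frac_add) simp_all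
  have "[(l ^ j)] \<cdot>\<^bsub>ZG\<^esub> x \<oplus>\<^bsub>ZG\<^esub> [(l ^ i)] \<cdot>\<^bsub>ZG\<^esub> y \<in> Iq k"
    using x(2) y(2) by (intro additive_subgroup.a_closed[OF ideal.axioms(1)[OF aug_pow_is_ideal]] aug_pow_ell_smult)
  then show ?thesis unfolding sum aug_filtration_def by blast
qed

lemma aug_filtration_mult:
  assumes "u \<in> aug_filtration N 1" "v \<in> aug_filtration N k"
  shows "u \<otimes>\<^bsub>Vn N\<^esub> v \<in> aug_filtration N (Suc k)"
proof -
  obtain x i y j where x: "u = quot_frac N x i" "x \<in> Iq 1" and y: "v = quot_frac N y j" "y \<in> Iq k"
    using assms by (auto simp: aug_filtration_def)
  have c: "x \<in> carrier ZG" "y \<in> carrier ZG" using x y ideal.Icarr[OF aug_pow_is_ideal] by blast+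
  have "u \<otimes>\<^bsub>Vn N\<^esub> v = quot_frac N (x \<otimes>\<^bsub>ZG\<^esub> y) (i + j)"
    unfolding x(1) y(1) using c by (rule quot_frac_mult)
  moreover have "x \<otimes>\<^bsub>ZG\<^esub> y \<in> Iq (Suc k)"
    using x(2) y(2) unfolding aug_pow_one by (rule aug_mult_aug_pow)
  ultimately show ?thesis unfolding aug_filtration_def by blast
qed

lemma aug_filtration_antimono: "k \<le> m \<Longrightarrow> aug_filtration N m \<subseteq> aug_filtration N k"
  unfolding aug_filtration_def using aug_pow_antimono by blast

lemma aug_filtration_zero: "v \<in> aug_filtration N N \<Longrightarrow> v = \<zero>\<^bsub>Vn N\<^esub>"
  by (auto simp: aug_filtration_def quot_frac_zeroI)

lemma Ql_group_ring_lower: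
  assumes g: "g \<in> carrier QG" and x: "x \<in> carrier ZG" and gN: "g N = quot_frac N x j" and "m \<le> N"
  shows "g m = quot_frac m x j"
  using \<open>m \<le> N\<close>
proof (induction rule: inc_induct)
  case (step n)
  then show ?case using Ql_group_ringD(2)[OF g, of n] transition_quot_frac[OF x] by metis
qed (rule gN)

text \<open>Vanishing of the component \<open>x / l\<^sup>j\<close> at 1 only says that some \<open>l\<^sup>k x\<close> lies in \<open>I\<close>, but \<open>x / l\<^sup>j\<close> may also be
  written with the numerator \<open>l\<^sup>k x\<close>.\<close>

lemma Ql_aug_ideal_filtration:
  assumes g: "g \<in> Ql_aug_ideal l G" and N: "N \<ge> 1"
  shows "g N \<in> aug_filtration N 1"
proof -
  have gc: "g \<in> carrier QG" and g1: "g 1 = \<zero>\<^bsub>Vn 1\<^esub>" using g by (auto simp: Ql_aug_ideal_def)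
  obtain x j where x: "x \<in> carrier ZG" "g N = quot_frac N x j"
    using Ql_group_ringD(1)[OF gc, of N] by (rule Vn_carrierE)
  have "quot_frac 1 x j = \<zero>\<^bsub>Vn 1\<^esub>" using Ql_group_ring_lower[OF gc x N] g1 by simp
  then obtain k where k: "[(l ^ k)] \<cdot>\<^bsub>ZG\<^esub> x \<in> Iq 1" using quot_frac_eq_zero_iff[OF x(1)] by blast
  have "g N = quot_frac N ([(l ^ k)] \<cdot>\<^bsub>ZG\<^esub> x) (j + k)" unfolding x(2) by (rule quot_frac_expand[OF x(1)])
  then show ?thesis using k unfolding aug_filtration_def by blast
qed

lemma ideal_prod_filtration:
  assumes "w \<in> ideal_prod QG A B"
    and A: "\<And>a. a \<in> A \<Longrightarrow> a \<in> carrier QG \<and> a N \<in> aug_filtration N 1"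
    and B: "\<And>b. b \<in> B \<Longrightarrow> b \<in> carrier QG \<and> b N \<in> aug_filtration N k"
  shows "w \<in> carrier QG \<and> w N \<in> aug_filtration N (Suc k)"
  using assms(1)
proof (induction w rule: ideal_prod.induct)
  case (prod i j)
  then show ?case
    using A[OF prod(1)] B[OF prod(2)] by (simp only: QG.m_closed Ql_group_ring_simps(2)[of _ _ N] aug_filtration_mult simp_thms)
next
  case (sum s t)
  then show ?case by (simp only: QG.a_closed Ql_group_ring_simps(5)[of _ _ N] aug_filtration_add simp_thms)
qed

lemma set_add_filtration:
  assumes "w \<in> A <+>\<^bsub>QG\<^esub> B"
    and A: "\<And>a. a \<in> A \<Longrightarrow> a \<in> carrier QG \<and> a N \<in> aug_filtration N k"
    and B: "\<And>b. b \<in> B \<Longrightarrow> b \<in> carrier QG \<and> b N \<in> aug_filtration N k"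
  shows "w \<in> carrier QG \<and> w N \<in> aug_filtration N k"
proof -
  obtain a b where "a \<in> A" "b \<in> B" "w = a \<oplus>\<^bsub>QG\<^esub> b" using assms(1) by (auto simp: set_add_def')
  then show ?thesis using A B by (simp only: QG.a_closed Ql_group_ring_simps(5)[of _ _ N] aug_filtration_add simp_thms)
qed

text \<open>Each factor from \<open>I\<close> or \<open>J \<subseteq> I\<close> raises the power of \<open>I\<close> by one and the weight by at most two, so
  weight \<open>i\<close> forces at least \<open>\<lceil>i/2\<rceil>\<close> factors.\<close>

lemma weight_filtration_aug_filtration:
  assumes J: "J \<subseteq> Ql_aug_ideal l G" and N: "N \<ge> 1"
    and "w \<in> weight_filtration QG (Ql_aug_ideal l G) J i"
  shows "w \<in> carrier QG \<and> w N \<in> aug_filtration N ((i + 1) div 2)"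
  using assms(3)
proof (induction i arbitrary: w rule: induct_nat_012)
  case 0
  have all: "a \<in> carrier QG \<and> a N \<in> aug_filtration N 0" if "a \<in> carrier QG" for a
    using that Ql_group_ringD(1)[OF that, of N] unfolding aug_filtration_def
    by (auto elim!: Vn_carrierE)
  then show ?case using 0 by simp
next
  case 1
  have all: "a \<in> carrier QG \<and> a N \<in> aug_filtration N 0" if "a \<in> carrier QG" for a
    using that Ql_group_ringD(1)[OF that, of N] unfolding aug_filtration_def
    by (auto elim!: Vn_carrierE)
  have I: "a \<in> carrier QG \<and> a N \<in> aug_filtration N 1" if "a \<in> Ql_aug_ideal l G" for a
    using that Ql_aug_ideal_filtration[OF that N] by (auto simp: Ql_aug_ideal_def)
  have "w \<in> ideal_prod QG (Ql_aug_ideal l G) (carrier QG) <+>\<^bsub>QG\<^esub> ideal_prod QG J (carrier QG)"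
    using 1 by simp
  then have "w \<in> carrier QG \<and> w N \<in> aug_filtration N (Suc 0)"
    by (rule set_add_filtration; elim ideal_prod_filtration) (use I J all in blast)+
  then show ?case by simp
next
  case (ge2 i)
  have I: "a \<in> carrier QG \<and> a N \<in> aug_filtration N 1" if "a \<in> Ql_aug_ideal l G" for a
    using that Ql_aug_ideal_filtration[OF that N] by (auto simp: Ql_aug_ideal_def)
  have "(i + 1) div 2 \<le> (Suc i + 1) div 2" by simp
  then have 1: "a \<in> carrier QG \<and> a N \<in> aug_filtration N ((i + 1) div 2)"
    if "a \<in> weight_filtration QG (Ql_aug_ideal l G) J (Suc i)" for a
    using ge2.IH(2)[OF that] aug_filtration_antimono by blast
  have "w \<in> ideal_prod QG (Ql_aug_ideal l G) (weight_filtration QG (Ql_aug_ideal l G) J (Suc i)) <+>\<^bsub>QG\<^esub>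
      ideal_prod QG J (weight_filtration QG (Ql_aug_ideal l G) J i)"
    using ge2.prems by simp
  then have "w \<in> carrier QG \<and> w N \<in> aug_filtration N (Suc ((i + 1) div 2))"
    by (rule set_add_filtration; elim ideal_prod_filtration) (use I J 1 ge2.IH(1) in blast)+
  then show ?case by simp
qed

lemma weight_filtration_closed:
  assumes "J \<subseteq> Ql_aug_ideal l G" "w \<in> weight_filtration QG (Ql_aug_ideal l G) J i"
  shows "w \<in> carrier QG"
  using weight_filtration_aug_filtration[OF assms(1) order_refl assms(2)] by blast

lemma weight_filtration_vanishes:
  assumes J: "J \<subseteq> Ql_aug_ideal l G" and w: "w \<in> weight_filtration QG (Ql_aug_ideal l G) J (2 * n)"
  shows "w n = \<zero>\<^bsub>Vn n\<^esub>"
proof (cases "n \<ge> 1")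
  case True
  have "w n \<in> aug_filtration n ((2 * n + 1) div 2)"
    using weight_filtration_aug_filtration[OF J True w] by blast
  then show ?thesis by (intro aug_filtration_zero) simp
next
  case False
  have "w n \<in> carrier (Vn n)" using weight_filtration_closed[OF J w] by (rule Ql_group_ringD(1))
  then obtain x j where "x \<in> carrier ZG" "w n = quot_frac n x j" by (rule Vn_carrierE)
  moreover have "n = 0" using False by simp
  ultimately show ?thesis using quot_frac_zeroI[of x 0 j] by simp
qed

end

context pro_group_hom
begin

text \<open>The reason is that the augmentation of \<open>\<int>\<^sub>l[[G]]\<close> factors through \<open>\<int>\<^sub>l[[H]]\<close>.\<close>

lemma Ql_kernel_subset: "Ql_kernel l G H f \<subseteq> Ql_aug_ideal l G"
proof
  fix g assume g: "g \<in> Ql_kernel l G H f"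
  then have gc: "g \<in> carrier G.QG" and ker: "Ql_map l G H f g = \<zero>\<^bsub>H.QG\<^esub>" by (auto simp: Ql_kernel_def)
  obtain x j where x: "x \<in> carrier G.ZG" "g 1 = G.quot_frac 1 x j"
    using G.Ql_group_ringD(1)[OF gc, of 1] by (rule G.Vn_carrierE)
  have fx: "Zl_map l G H f x \<in> carrier H.ZG" using x(1) by (rule Zl_map_closed)
  have "quot_map 1 (g 1) = \<zero>\<^bsub>H.Vn 1\<^esub>"
    using fun_cong[OF ker, of 1] by (simp only: Ql_map_at H.Ql_group_ring_simps)
  then have "H.quot_frac 1 (Zl_map l G H f x) j = \<zero>\<^bsub>H.Vn 1\<^esub>" by (simp only: x(2) quot_map_quot_frac x(1))
  then obtain k where "[(l ^ k)] \<cdot>\<^bsub>H.ZG\<^esub> Zl_map l G H f x \<in> aug_ideal l H"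
    using H.quot_frac_eq_zero_iff[OF fx] H.aug_pow_one by blast
  then have "Zl_map l G H f ([(l ^ k)] \<cdot>\<^bsub>G.ZG\<^esub> x) \<in> aug_ideal l H"
    by (simp only: Zl_map.hom_add_pow_nat x(1))
  then have "[(l ^ k)] \<cdot>\<^bsub>G.ZG\<^esub> x \<in> aug_ideal l G"
    using G.ZG.add.nat_pow_closed[OF x(1), of "l ^ k"]
    by (simp only: G.aug_ideal_eq H.aug_ideal_eq augmentation_Zl_map mem_Collect_eq simp_thms)
  then have "g 1 = \<zero>\<^bsub>G.Vn 1\<^esub>"
    unfolding x(2) using G.quot_frac_eq_zero_iff[OF x(1)] G.aug_pow_one by blast
  then show "g \<in> Ql_aug_ideal l G" using gc by (simp add: Ql_aug_ideal_def)
qed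

end

lemma (in abelian_group) eq_of_minus_eq_zero:
  assumes "x \<in> carrier G" "y \<in> carrier G" "x \<ominus> y = \<zero>"
  shows "x = y"
proof -
  have "x = (x \<ominus> y) \<oplus> y" using assms(1,2) by (simp add: a_minus_def a_assoc l_neg)
  then show ?thesis using assms by simp
qed

section \<open>Eigenvector decompositions with bounded denominators\<close>

text \<open>\<open>\<Lambda> e\<close> stands for the elements with denominator \<open>l\<^sup>e\<close>, and division by \<open>a\<^sup>j - a\<^sup>i\<close> costs a factor
  \<open>l\<^bsup>\<nu>(j - i)\<^esup>\<close> in the denominator; the costs \<open>\<nu>\<close> are bounded by \<open>c\<close> on average.\<close>

locale eigen_module = module R M for R (structure) and M (structure) +
  fixes T a \<Lambda> \<nu> c
  assumes T_closed: "\<And>x. x \<in> carrier M \<Longrightarrow> T x \<in> carrier M"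
    and T_add: "\<And>x y. x \<in> carrier M \<Longrightarrow> y \<in> carrier M \<Longrightarrow> T (x \<oplus>\<^bsub>M\<^esub> y) = T x \<oplus>\<^bsub>M\<^esub> T y"
    and T_smult: "\<And>r x. r \<in> carrier R \<Longrightarrow> x \<in> carrier M \<Longrightarrow> T (r \<odot>\<^bsub>M\<^esub> x) = r \<odot>\<^bsub>M\<^esub> T x"
    and a: "a \<in> carrier R"
    and units: "\<And>i j. i < j \<Longrightarrow> a [^] (j::nat) \<ominus> a [^] (i::nat) \<in> Units R"
    and lattice_closed: "\<And>e. \<Lambda> (e::nat) \<subseteq> carrier M"
    and lattice_zero: "\<And>e. \<zero>\<^bsub>M\<^esub> \<in> \<Lambda> e"
    and lattice_mono: "\<And>e e'. e \<le> e' \<Longrightarrow> \<Lambda> e \<subseteq> \<Lambda> e'"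
    and lattice_add: "\<And>e x y. x \<in> \<Lambda> e \<Longrightarrow> y \<in> \<Lambda> e \<Longrightarrow> x \<oplus>\<^bsub>M\<^esub> y \<in> \<Lambda> e"
    and lattice_minus: "\<And>e x. x \<in> \<Lambda> e \<Longrightarrow> \<ominus>\<^bsub>M\<^esub> x \<in> \<Lambda> e"
    and lattice_T: "\<And>e x. x \<in> \<Lambda> e \<Longrightarrow> T x \<in> \<Lambda> e"
    and lattice_a: "\<And>e x i. x \<in> \<Lambda> e \<Longrightarrow> a [^] (i::nat) \<odot>\<^bsub>M\<^esub> x \<in> \<Lambda> e"
    and lattice_divide: "\<And>e x i j. i < j \<Longrightarrow> x \<in> \<Lambda> e \<Longrightarrow>
      inv (a [^] (j::nat) \<ominus> a [^] (i::nat)) \<odot>\<^bsub>M\<^esub> x \<in> \<Lambda> (e + \<nu> (j - i))"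
    and cost: "\<And>m. (\<Sum>k=1..m. \<nu> k) \<le> c * m"
begin

definition shifted :: "nat \<Rightarrow> 'c \<Rightarrow> 'c" where
  "shifted k x = T x \<ominus>\<^bsub>M\<^esub> a [^] k \<odot>\<^bsub>M\<^esub> x"

lemma apow: "a [^] (i::nat) \<in> carrier R" using a by simp

lemma shifted_closed: "x \<in> carrier M \<Longrightarrow> shifted k x \<in> carrier M"
  by (simp add: shifted_def T_closed apow)

lemma shifted_add:
  assumes "x \<in> carrier M" "y \<in> carrier M"
  shows "shifted k (x \<oplus>\<^bsub>M\<^esub> y) = shifted k x \<oplus>\<^bsub>M\<^esub> shifted k y"
  using assms unfolding shifted_def a_minus_def
  by (simp add: T_add T_closed apow smult_r_distr M.minus_add M.a_ac)

lemma shifted_zero: "shifted k \<zero>\<^bsub>M\<^esub> = \<zero>\<^bsub>M\<^esub>"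
proof -
  have "shifted k \<zero>\<^bsub>M\<^esub> \<oplus>\<^bsub>M\<^esub> shifted k \<zero>\<^bsub>M\<^esub> = shifted k \<zero>\<^bsub>M\<^esub>"
    using shifted_add[of "\<zero>\<^bsub>M\<^esub>" "\<zero>\<^bsub>M\<^esub>" k] by simp
  then show ?thesis using shifted_closed[of "\<zero>\<^bsub>M\<^esub>" k] by (metis M.add.r_cancel_one M.zero_closed)
qed

lemma shifted_finsum:
  assumes "finite A" "f \<in> A \<rightarrow> carrier M"
  shows "shifted k (\<Oplus>\<^bsub>M\<^esub>i\<in>A. f i) = (\<Oplus>\<^bsub>M\<^esub>i\<in>A. shifted k (f i))"
  using assms
proof (induction A)
  case (insert i A)
  then have f: "f \<in> A \<rightarrow> carrier M" "f i \<in> carrier M" by auto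
  moreover have "(\<lambda>i. shifted k (f i)) \<in> A \<rightarrow> carrier M" "shifted k (f i) \<in> carrier M"
    using f shifted_closed by auto
  ultimately show ?case using insert by (simp add: shifted_add)
qed (simp add: shifted_zero)

lemma shifted_eigenvector:
  assumes "x \<in> carrier M" "T x = a [^] (i::nat) \<odot>\<^bsub>M\<^esub> x"
  shows "shifted k x = (a [^] i \<ominus> a [^] k) \<odot>\<^bsub>M\<^esub> x"
  using assms by (simp add: shifted_def a_minus_def smult_l_distr apow smult_l_minus)

lemma lattice_finsum:
  assumes "finite A" "\<And>i. i \<in> A \<Longrightarrow> f i \<in> \<Lambda> e"
  shows "(\<Oplus>\<^bsub>M\<^esub>i\<in>A. f i) \<in> \<Lambda> e"
  using assms
proof (induction A)
  case (insert i A)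
  then have "f \<in> A \<rightarrow> carrier M" "f i \<in> carrier M" using lattice_closed[of e] by auto
  then show ?case using insert by (simp add: lattice_add)
qed (simp add: lattice_zero)

lemma divide_mult_cancel:
  assumes "(i::nat) < j" "x \<in> carrier M"
  shows "(a [^] j \<ominus> a [^] i) \<odot>\<^bsub>M\<^esub> (inv (a [^] j \<ominus> a [^] i) \<odot>\<^bsub>M\<^esub> x) = x"
proof -
  have U: "a [^] j \<ominus> a [^] i \<in> Units R" using assms(1) by (rule units)
  show ?thesis
    unfolding smult_assoc1[OF R.Units_closed[OF U] R.Units_inv_closed[OF U] assms(2), symmetric]
    using U assms(2) by simp
qed

text \<open>Let \<open>v = v\<^sub>k + \<dots> + v\<^bsub>m-1\<^esub>\<close> be the desired decomposition. Then \<open>(T - a\<^sup>k) v\<close> has the components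
  \<open>(a\<^sup>i - a\<^sup>k) v\<^sub>i\<close> for \<open>i > k\<close>, which are known by induction; \<open>v\<^sub>k\<close> is what is left of \<open>v\<close>. The bound on
  the denominator of \<open>v\<^sub>i\<close> has two parts: \<open>c (m - i)\<close> when it arises as such a remainder, and
  \<open>\<nu> 1 + \<dots> + \<nu> (i - k)\<close> for the divisions by \<open>a\<^sup>i - a\<^bsup>i-1\<^esup>, \<dots>, a\<^sup>i - a\<^sup>k\<close> that follow. Their sum never
  exceeds \<open>c (m - k)\<close>, which is what makes the first part linear.\<close>

lemma eigen_decomposition:
  assumes W: "\<And>i. W i \<subseteq> carrier M" "\<And>i v. i < m \<Longrightarrow> v \<in> W i \<Longrightarrow> shifted i v \<in> W (Suc i)"
    "W m \<subseteq> {\<zero>\<^bsub>M\<^esub>}" and "k \<le> m" "v \<in> W k" "v \<in> \<Lambda> e"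
  shows "\<exists>w. (\<forall>i\<in>{k..<m}. w i \<in> \<Lambda> (e + c * (m - i) + (\<Sum>k=1..i - k. \<nu> k)) \<and> T (w i) = a [^] i \<odot>\<^bsub>M\<^esub> w i) \<and>
    v = (\<Oplus>\<^bsub>M\<^esub>i\<in>{k..<m}. w i)"
  using assms(4-6)
proof (induction k arbitrary: v rule: inc_induct)
  case base
  then show ?case using W(3) by auto
next
  case (step k)
  note v = step.prems
  have vc: "v \<in> carrier M" using W(1) v by auto
  have "shifted k v \<in> \<Lambda> e"
    unfolding shifted_def a_minus_def using v by (intro lattice_add lattice_minus lattice_T lattice_a)
  then obtain w where w: "\<And>i. i \<in> {Suc k..<m} \<Longrightarrow> w i \<in> \<Lambda> (e + c * (m - i) + (\<Sum>k=1..i - Suc k. \<nu> k))"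
    "\<And>i. i \<in> {Suc k..<m} \<Longrightarrow> T (w i) = a [^] i \<odot>\<^bsub>M\<^esub> w i"
    "shifted k v = (\<Oplus>\<^bsub>M\<^esub>i\<in>{Suc k..<m}. w i)"
    using step.IH[OF W(2)[OF step.hyps(2) v(1)]] by blast
  have wc: "w i \<in> carrier M" if "i \<in> {Suc k..<m}" for i using w(1)[OF that] lattice_closed by blast
  define u where "u i = inv (a [^] i \<ominus> a [^] k) \<odot>\<^bsub>M\<^esub> w i" for i
  have uc: "u i \<in> carrier M" if "i \<in> {Suc k..<m}" for i
    using wc[OF that] units[of k i] that by (simp add: u_def)
  have uL: "u i \<in> \<Lambda> (e + c * (m - i) + (\<Sum>k=1..i - k. \<nu> k))" if i: "i \<in> {Suc k..<m}" for i
  proof -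
    have "u i \<in> \<Lambda> (e + c * (m - i) + (\<Sum>k=1..i - Suc k. \<nu> k) + \<nu> (i - k))"
      unfolding u_def using i by (intro lattice_divide w(1)) auto
    moreover have "(\<Sum>k=1..i - k. \<nu> k) = (\<Sum>k=1..i - Suc k. \<nu> k) + \<nu> (i - k)"
    proof -
      have "i - k = Suc (i - Suc k)" using i by auto
      then show ?thesis by simp
    qed
    ultimately show ?thesis by (simp add: add.assoc)
  qed
  have uT: "T (u i) = a [^] i \<odot>\<^bsub>M\<^esub> u i" if i: "i \<in> {Suc k..<m}" for i
  proof -
    have I: "inv (a [^] i \<ominus> a [^] k) \<in> carrier R" using units[of k i] i by auto
    show ?thesis
      unfolding u_def using I wc[OF i] apow
      by (simp add: T_smult w(2)[OF i] smult_assoc1[symmetric] m_comm)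
  qed
  define s where "s = (\<Oplus>\<^bsub>M\<^esub>i\<in>{Suc k..<m}. u i)"
  have sc: "s \<in> carrier M" unfolding s_def using uc by (intro M.finsum_closed) auto
  have "shifted k s = (\<Oplus>\<^bsub>M\<^esub>i\<in>{Suc k..<m}. shifted k (u i))"
    unfolding s_def using uc by (intro shifted_finsum) auto
  also have "\<dots> = (\<Oplus>\<^bsub>M\<^esub>i\<in>{Suc k..<m}. w i)"
  proof (rule M.finsum_cong')
    fix i assume i: "i \<in> {Suc k..<m}"
    show "shifted k (u i) = w i"
      unfolding shifted_eigenvector[OF uc[OF i] uT[OF i]]
      unfolding u_def using i wc[OF i] by (intro divide_mult_cancel) auto
  qed (use wc in auto)
  finally have sv: "shifted k s = shifted k v" using w(3) by simp
  define t where "t = v \<ominus>\<^bsub>M\<^esub> s"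
  have tc: "t \<in> carrier M" using vc sc by (simp add: t_def)
  have vts: "v = t \<oplus>\<^bsub>M\<^esub> s" unfolding t_def a_minus_def using vc sc by (simp add: M.a_assoc M.l_neg)
  have "shifted k t \<oplus>\<^bsub>M\<^esub> shifted k s = shifted k s"
    using shifted_add[OF tc sc, of k] sv unfolding vts[symmetric] by simp
  then have t0: "shifted k t = \<zero>\<^bsub>M\<^esub>"
    by (simp only: M.add.r_cancel_one[OF shifted_closed[OF sc] shifted_closed[OF tc]])
  have tT: "T t = a [^] k \<odot>\<^bsub>M\<^esub> t"
    using t0 unfolding shifted_def by (rule M.eq_of_minus_eq_zero[OF T_closed[OF tc] smult_closed[OF apow tc]])
  have tL: "t \<in> \<Lambda> (e + c * (m - k))"
  proof -
    have "u i \<in> \<Lambda> (e + c * (m - k))" if i: "i \<in> {Suc k..<m}" for i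
    proof -
      have "c * (m - i) + (\<Sum>k=1..i - k. \<nu> k) \<le> c * (m - i) + c * (i - k)" using cost by simp
      also have "\<dots> = c * (m - k)" using i by (simp add: add_mult_distrib2[symmetric])
      finally show ?thesis using uL[OF i] lattice_mono by (metis add.assoc add_le_cancel_left subsetD)
    qed
    then have "s \<in> \<Lambda> (e + c * (m - k))" unfolding s_def by (intro lattice_finsum) auto
    moreover have "v \<in> \<Lambda> (e + c * (m - k))" using v lattice_mono[of e "e + c * (m - k)"] by auto
    ultimately show ?thesis unfolding t_def a_minus_def by (intro lattice_add lattice_minus)
  qed
  define w' where "w' i = (if i = k then t else u i)" for i
  have set: "{k..<m} = insert k {Suc k..<m}" using step.hyps by auto
  have "(\<Oplus>\<^bsub>M\<^esub>i\<in>{k..<m}. w' i) = w' k \<oplus>\<^bsub>M\<^esub> (\<Oplus>\<^bsub>M\<^esub>i\<in>{Suc k..<m}. w' i)"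
    unfolding set using uc tc by (intro M.finsum_insert) (auto simp: w'_def)
  also have "(\<Oplus>\<^bsub>M\<^esub>i\<in>{Suc k..<m}. w' i) = s"
    unfolding s_def using uc by (intro M.finsum_cong') (auto simp: w'_def)
  finally have "v = (\<Oplus>\<^bsub>M\<^esub>i\<in>{k..<m}. w' i)" using vts by (simp add: w'_def)
  moreover have "w' i \<in> \<Lambda> (e + c * (m - i) + (\<Sum>k=1..i - k. \<nu> k)) \<and> T (w' i) = a [^] i \<odot>\<^bsub>M\<^esub> w' i"
    if "i \<in> {k..<m}" for i
    using that tL tT uL uT unfolding set w'_def by auto
  ultimately show ?case by blast
qed

text \<open>Applying \<open>T - a\<^sup>m\<close> to a relation between \<open>m + 1\<close> eigenvectors removes the last one and multiplies the
  others by units.\<close>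

lemma eigen_independent:
  fixes m :: nat
  assumes "\<And>i. i < m \<Longrightarrow> w i \<in> carrier M" "\<And>i. i < m \<Longrightarrow> T (w i) = a [^] i \<odot>\<^bsub>M\<^esub> w i"
    "(\<Oplus>\<^bsub>M\<^esub>i\<in>{..<m}. w i) = \<zero>\<^bsub>M\<^esub>" "i < m"
  shows "w i = \<zero>\<^bsub>M\<^esub>"
  using assms
proof (induction m arbitrary: w i)
  case (Suc m)
  note wc = Suc.prems(1) and wT = Suc.prems(2)
  have coeff: "a [^] i \<ominus> a [^] m \<in> carrier R" for i :: nat using apow by simp
  define u where "u i = (a [^] i \<ominus> a [^] m) \<odot>\<^bsub>M\<^esub> w i" for i
  have uc: "u i \<in> carrier M" if "i < Suc m" for i using that wc coeff by (simp add: u_def)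
  have "\<zero>\<^bsub>M\<^esub> = shifted m (\<Oplus>\<^bsub>M\<^esub>i\<in>{..<Suc m}. w i)" by (simp only: Suc.prems(3) shifted_zero)
  also have "\<dots> = (\<Oplus>\<^bsub>M\<^esub>i\<in>{..<Suc m}. shifted m (w i))" using wc by (intro shifted_finsum) auto
  also have "\<dots> = (\<Oplus>\<^bsub>M\<^esub>i\<in>{..<Suc m}. u i)"
    using uc wc wT by (intro M.finsum_cong') (auto simp: u_def intro!: shifted_eigenvector)
  also have "\<dots> = u m \<oplus>\<^bsub>M\<^esub> (\<Oplus>\<^bsub>M\<^esub>i\<in>{..<m}. u i)"
    unfolding lessThan_Suc using uc by (intro M.finsum_insert) auto
  also have "u m = \<zero>\<^bsub>M\<^esub>" using wc[of m] apow[of m] by (simp add: u_def R.r_neg a_minus_def)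
  finally have sum: "(\<Oplus>\<^bsub>M\<^esub>i\<in>{..<m}. u i) = \<zero>\<^bsub>M\<^esub>" using uc by (simp add: M.finsum_closed Pi_iff)
  have "T (u i) = a [^] i \<odot>\<^bsub>M\<^esub> u i" if "i < m" for i
    using that coeff[of i] apow wc[of i] wT[of i] unfolding u_def
    by (simp add: T_smult smult_assoc1[symmetric] m_comm)
  then have u0: "u i = \<zero>\<^bsub>M\<^esub>" if "i < m" for i using Suc.IH[OF _ _ sum that] uc by simp
  have w0: "w i = \<zero>\<^bsub>M\<^esub>" if i: "i < m" for i
  proof -
    have U: "a [^] m \<ominus> a [^] i \<in> Units R" using i by (rule units)
    have "(a [^] m \<ominus> a [^] i) = \<ominus> (a [^] i \<ominus> a [^] m)"
      using apow[of i] apow[of m] by (simp add: a_minus_def R.minus_add R.a_comm)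
    then have "(a [^] m \<ominus> a [^] i) \<odot>\<^bsub>M\<^esub> w i = \<zero>\<^bsub>M\<^esub>"
      using u0[OF i] wc[of i] coeff[of i] i by (simp add: smult_l_minus u_def)
    then have "inv (a [^] m \<ominus> a [^] i) \<odot>\<^bsub>M\<^esub> ((a [^] m \<ominus> a [^] i) \<odot>\<^bsub>M\<^esub> w i) = \<zero>\<^bsub>M\<^esub>"
      using U by simp
    moreover have "inv (a [^] m \<ominus> a [^] i) \<odot>\<^bsub>M\<^esub> ((a [^] m \<ominus> a [^] i) \<odot>\<^bsub>M\<^esub> w i) = w i"
      unfolding smult_assoc1[OF R.Units_inv_closed[OF U] R.Units_closed[OF U] wc[OF less_SucI[OF i]], symmetric]
      using U wc[OF less_SucI[OF i]] by simp
    ultimately show ?thesis by simp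
  qed
  have "(\<Oplus>\<^bsub>M\<^esub>i\<in>{..<m}. w i) = \<zero>\<^bsub>M\<^esub>" by (rule M.add.finprod_one_eqI) (use w0 in simp)
  moreover have "(\<Oplus>\<^bsub>M\<^esub>i\<in>{..<Suc m}. w i) = w m \<oplus>\<^bsub>M\<^esub> (\<Oplus>\<^bsub>M\<^esub>i\<in>{..<m}. w i)"
    unfolding lessThan_Suc using wc by (intro M.finsum_insert) auto
  ultimately have "w m = \<zero>\<^bsub>M\<^esub>" using Suc.prems(3) wc[of m] by simp
  then show ?case using w0 Suc.prems(4) by (cases "i = m") auto
qed simp

end

section \<open>Valuations\<close>

context pro_group
begin

text \<open>The elements of \<open>\<int>\<^sub>l[[G]]/I\<^sup>n \<otimes> \<rat>\<^sub>l\<close> with denominator \<open>l\<^sup>e\<close>.\<close>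

definition lattice :: "nat \<Rightarrow> nat \<Rightarrow> ('g Zl_elem set \<times> nat) set set" where
  "lattice n e = {quot_frac n x e | x. x \<in> carrier ZG}"

lemma latticeI: "x \<in> carrier ZG \<Longrightarrow> quot_frac n x e \<in> lattice n e"
  by (auto simp: lattice_def)

lemma latticeE:
  assumes "v \<in> lattice n e"
  obtains x where "x \<in> carrier ZG" "v = quot_frac n x e"
  using assms by (auto simp: lattice_def)

lemma lattice_subset: "lattice n e \<subseteq> carrier (Vn n)"
  by (auto simp: lattice_def quot_frac_closed)

lemma zero_in_lattice: "\<zero>\<^bsub>Vn n\<^esub> \<in> lattice n e"
  unfolding quot_frac_zero[of n e] by (intro latticeI) simp

lemma lattice_increasing: "e \<le> e' \<Longrightarrow> lattice n e \<subseteq> lattice n e'"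
proof
  fix v assume "e \<le> e'" "v \<in> lattice n e"
  then obtain x where x: "x \<in> carrier ZG" "v = quot_frac n x e" by (elim latticeE)
  have "v = quot_frac n ([(l ^ (e' - e))] \<cdot>\<^bsub>ZG\<^esub> x) (e + (e' - e))"
    unfolding x(2) using x(1) by (rule quot_frac_expand)
  moreover have "e + (e' - e) = e'" using \<open>e \<le> e'\<close> by simp
  ultimately show "v \<in> lattice n e'" using x(1) by (auto simp: lattice_def)
qed

lemma lattice_add_closed:
  assumes "u \<in> lattice n e" "v \<in> lattice n e"
  shows "u \<oplus>\<^bsub>Vn n\<^esub> v \<in> lattice n e"
proof -
  obtain x where x: "x \<in> carrier ZG" "u = quot_frac n x e" using assms(1) by (rule latticeE)
  obtain y where y: "y \<in> carrier ZG" "v = quot_frac n y e" using assms(2) by (rule latticeE)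
  have "u \<oplus>\<^bsub>Vn n\<^esub> v = quot_frac n (x \<oplus>\<^bsub>ZG\<^esub> y) e"
    unfolding x(2) y(2) using x(1) y(1) by (rule quot_frac_add)
  then show ?thesis using x(1) y(1) by (auto simp: lattice_def)
qed

lemma lattice_minus_closed:
  assumes "u \<in> lattice n e"
  shows "\<ominus>\<^bsub>Vn n\<^esub> u \<in> lattice n e"
proof -
  obtain x where x: "x \<in> carrier ZG" "u = quot_frac n x e" using assms(1) by (rule latticeE)
  have "\<ominus>\<^bsub>Vn n\<^esub> u = quot_frac n (\<ominus>\<^bsub>ZG\<^esub> x) e"
    unfolding x(2) using x(1) by (rule quot_frac_minus)
  then show ?thesis using x(1) by (auto simp: lattice_def)
qed

lemma lattice_const:
  assumes s: "s \<in> carrier (Zl l)" and v: "v \<in> lattice n e"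
  shows "Ql_quot_const l G n (ell_frac l (Zl l) s j) \<otimes>\<^bsub>Vn n\<^esub> v \<in> lattice n (j + e)"
proof -
  obtain x where x: "x \<in> carrier ZG" "v = quot_frac n x e" using v by (rule latticeE)
  have "Ql_quot_const l G n (ell_frac l (Zl l) s j) \<otimes>\<^bsub>Vn n\<^esub> v = quot_frac n (Zl_const l G s \<otimes>\<^bsub>ZG\<^esub> x) (j + e)"
    unfolding x(2) Ql_quot_const_ell_frac[OF s] using Zl_const_closed[OF s] x(1) by (rule quot_frac_mult)
  then show ?thesis using x(1) Zl_const_closed[OF s] by (auto simp: lattice_def)
qed

text \<open>If \<open>a / l\<^sup>j\<close> represents \<open>l\<^sup>e / l\<^sup>p\<close> and \<open>l\<^sup>i\<close> divides \<open>a\<close>, comparison of \<open>l\<^bsup>j+e\<^esup>\<close> with \<open>l\<^sup>p a\<close> modulo \<open>l\<^bsup>p+i\<^esup>\<close>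
  gives \<open>p + i \<le> j + e\<close>.\<close>

lemma Ql_val_ell_frac_le:
  "Ql_val l (ell_frac l (Zl l) ([(l ^ e)] \<cdot>\<^bsub>Zl l\<^esub> \<one>\<^bsub>Zl l\<^esub>) p) \<le> ereal (real e - real p)"
  unfolding Ql_val_def
proof (rule Sup_least, clarsimp)
  fix i j a assume a: "(a, j) \<in> ell_frac l (Zl l) ([(l ^ e)] \<cdot>\<^bsub>Zl l\<^esub> \<one>\<^bsub>Zl l\<^esub>) p" and ai: "a i = 0"
  obtain k where ac: "a \<in> carrier (Zl l)"
    and k: "[(l ^ (k + j))] \<cdot>\<^bsub>Zl l\<^esub> ([(l ^ e)] \<cdot>\<^bsub>Zl l\<^esub> \<one>\<^bsub>Zl l\<^esub>) = [(l ^ (k + p))] \<cdot>\<^bsub>Zl l\<^esub> a"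
    using a by (auto simp: ell_frac_def)
  let ?N = "k + p + i"
  have dvd: "int l ^ i dvd a ?N"
    using Zl_mod_le[OF ac, of i ?N] ai by (simp add: dvd_eq_mod_eq_0)
  have "(int (l ^ (k + j)) * (int (l ^ e) * 1)) mod int l ^ ?N = (int (l ^ (k + p)) * a ?N) mod int l ^ ?N"
    using fun_cong[OF k, of ?N] by (simp only: Zl_add_pow Zl_simps(3) mod_mult_right_eq)
  then have "(int l ^ (k + j + e)) mod int l ^ ?N = (int l ^ (k + p) * a ?N) mod int l ^ ?N"
    by (simp only: of_nat_mult of_nat_power power_add mult.assoc mult_1_right)
  also have "\<dots> = 0" using dvd by (simp add: power_add)
  finally have "int l ^ ?N dvd int l ^ (k + j + e)" by (simp add: dvd_eq_mod_eq_0)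
  then have "l ^ ?N dvd l ^ (k + j + e)" by (simp only: of_nat_power[symmetric] int_dvd_int_iff)
  then have "?N \<le> k + j + e" using l_gt(2) by (rule power_dvd_imp_le)
  then show "real i - real j \<le> real e - real p" by linarith
qed

text \<open>Multiplication by the scalar \<open>l\<^sup>e / l\<^sup>p\<close> makes the element integral.\<close>

lemma quot_val_ge:
  assumes x: "x \<in> carrier ZG"
  shows "quot_val l G n (quot_frac n ([(l ^ p)] \<cdot>\<^bsub>ZG\<^esub> x) e) \<ge> ereal (real p - real e)"
proof -
  let ?s = "ell_frac l (Zl l) ([(l ^ e)] \<cdot>\<^bsub>Zl l\<^esub> \<one>\<^bsub>Zl l\<^esub>) p"
  let ?S = "{Ql_val l s | s. s \<in> carrier (Ql l) \<and>
     Ql_quot_const l G n s \<otimes>\<^bsub>Vn n\<^esub> quot_frac n ([(l ^ p)] \<cdot>\<^bsub>ZG\<^esub> x) e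
       \<in> {ell_frac l (Zl_quot l G n) C 0 | C. C \<in> carrier (Zl_quot l G n)}}"
  have sc: "[(l ^ e)] \<cdot>\<^bsub>Zl l\<^esub> \<one>\<^bsub>Zl l\<^esub> \<in> carrier (Zl l)" by simp
  have const: "Zl_const l G ([(l ^ e)] \<cdot>\<^bsub>Zl l\<^esub> \<one>\<^bsub>Zl l\<^esub>) = [(l ^ e)] \<cdot>\<^bsub>ZG\<^esub> \<one>\<^bsub>ZG\<^esub>"
    using ring_hom_ring.hom_add_pow_nat[OF Zl_const_hom, of "\<one>\<^bsub>Zl l\<^esub>" "l ^ e"]
      ring_hom_one[OF ring_hom_ring.homh[OF Zl_const_hom]] by simp
  have "Ql_quot_const l G n ?s \<otimes>\<^bsub>Vn n\<^esub> quot_frac n ([(l ^ p)] \<cdot>\<^bsub>ZG\<^esub> x) e =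
      quot_frac n ([(l ^ e)] \<cdot>\<^bsub>ZG\<^esub> \<one>\<^bsub>ZG\<^esub> \<otimes>\<^bsub>ZG\<^esub> [(l ^ p)] \<cdot>\<^bsub>ZG\<^esub> x) (p + e)"
    unfolding Ql_quot_const_ell_frac[OF sc] const using x by (intro quot_frac_mult) simp_all
  also have "\<dots> = quot_frac n ([(l ^ (p + e))] \<cdot>\<^bsub>ZG\<^esub> x) (0 + (p + e))"
    using x by (simp add: ZG.ell_smult_mult_ell_smult add.commute)
  also have "\<dots> = quot_frac n x 0" using x by (rule quot_frac_expand[symmetric])
  finally have eq: "Ql_quot_const l G n ?s \<otimes>\<^bsub>Vn n\<^esub> quot_frac n ([(l ^ p)] \<cdot>\<^bsub>ZG\<^esub> x) e = quot_frac n x 0" .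
  have "quot_frac n x 0 \<in> {ell_frac l (Zl_quot l G n) C 0 | C. C \<in> carrier (Zl_quot l G n)}"
    unfolding quot_frac_def using coset_closed[OF x] by blast
  then have "Ql_val l ?s \<in> ?S" using Zl.ell_frac_closed[OF sc, of l p] eq by auto
  then have "Inf ?S \<le> Ql_val l ?s" by (rule Inf_lower)
  also have "\<dots> \<le> ereal (real e - real p)" by (rule Ql_val_ell_frac_le)
  finally have "- ereal (real e - real p) \<le> - Inf ?S" by (simp only: ereal_minus_le_minus)
  then show ?thesis by (simp add: quot_val_def)
qed

lemma quot_val_lattice:
  assumes "v \<in> lattice n e"
  shows "quot_val l G n v \<ge> ereal (- real e)"
proof -
  obtain x where x: "x \<in> carrier ZG" "v = quot_frac n x e" using assms by (rule latticeE)
  have "[(l ^ 0 :: nat)] \<cdot>\<^bsub>ZG\<^esub> x = x" using x(1) by simp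
  then show ?thesis using quot_val_ge[OF x(1), of 0 e n] by (simp add: x(2))
qed

lemma quot_val_zero: "quot_val l G n \<zero>\<^bsub>Vn n\<^esub> = \<infinity>"
proof (rule ereal_top)
  fix B :: real
  obtain p :: nat where p: "B \<le> real p" using real_arch_simple by blast
  have "\<zero>\<^bsub>Vn n\<^esub> = quot_frac n ([(l ^ p)] \<cdot>\<^bsub>ZG\<^esub> \<zero>\<^bsub>ZG\<^esub>) 0"
    using quot_frac_zero[of n 0] by simp
  then have "ereal (real p) \<le> quot_val l G n \<zero>\<^bsub>Vn n\<^esub>"
    using quot_val_ge[of "\<zero>\<^bsub>ZG\<^esub>" p 0 n] by simp
  then show "ereal B \<le> quot_val l G n \<zero>\<^bsub>Vn n\<^esub>" using p by (meson ereal_less_eq(3) order_trans)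
qed

text \<open>Some scalar \<open>s = a / l\<^sup>j\<close> of valuation less than \<open>t\<close> makes \<open>s v\<close> integral. Writing \<open>a\<close> as a unit times
  \<open>l\<^sup>k\<close> shows that \<open>l\<^bsup>k-j\<^esup>\<close> already does so, and \<open>k - j < t\<close>. As \<open>t\<close> is positive, the truncated
  subtraction is harmless when \<open>k < j\<close>.\<close>

lemma lattice_of_quot_val:
  assumes v: "v \<in> carrier (Vn n)" and gt: "quot_val l G n v > ereal (- t)" and t: "t > 0"
  obtains m where "real m < t" "v \<in> lattice n m"
proof -
  let ?S = "{Ql_val l s | s. s \<in> carrier (Ql l) \<and> Ql_quot_const l G n s \<otimes>\<^bsub>Vn n\<^esub> v
       \<in> {ell_frac l (Zl_quot l G n) C 0 | C. C \<in> carrier (Zl_quot l G n)}}"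
  have "- ereal t < - Inf ?S" using gt by (simp add: quot_val_def)
  then have "Inf ?S < ereal t" by (simp only: ereal_minus_less_minus)
  then obtain s C where s: "s \<in> carrier (Ql l)" "Ql_val l s < ereal t" and C: "C \<in> carrier (Zl_quot l G n)"
    "Ql_quot_const l G n s \<otimes>\<^bsub>Vn n\<^esub> v = ell_frac l (Zl_quot l G n) C 0"
    unfolding Inf_less_iff by blast
  obtain z where z: "z \<in> carrier ZG" "C = Iq n +>\<^bsub>ZG\<^esub> z" using C(1) by (rule Zl_quot_carrierE)
  obtain a j where a: "a \<in> carrier (Zl l)" "s = ell_frac l (Zl l) a j"
    using s(1) by (rule Zl.rationalize_carrierE)
  have bound: "real i - real j < t" if "a i = 0" for i
  proof -
    have "ereal (real i - real j) \<le> Ql_val l s"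
      unfolding Ql_val_def using that Zl.ell_frac_refl[OF a(1), of j l] a(2) by (intro Sup_upper) blast
    then show ?thesis using s(2) by (metis ereal_less_eq(3) less_ereal.simps(1) order_le_less_trans)
  qed
  have "a \<noteq> \<zero>\<^bsub>Zl l\<^esub>"
  proof
    assume "a = \<zero>\<^bsub>Zl l\<^esub>"
    then have "real i - real j < t" for i by (intro bound) (simp add: Zl_simps(4))
    moreover obtain i :: nat where "t + real j \<le> real i" using real_arch_simple by blast
    ultimately show False by (metis add_le_cancel_right diff_add_cancel not_le)
  qed
  then obtain k u where u: "u \<in> Units (Zl l)" "a = [(l ^ k)] \<cdot>\<^bsub>Zl l\<^esub> u" "a k = 0"
    by (rule Zl_nonzeroE[OF a(1)])
  obtain y p where y: "y \<in> carrier ZG" "v = quot_frac n y p" using v by (rule Vn_carrierE)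
  define u' where "u' = Zl_const l G (inv\<^bsub>Zl l\<^esub> u)"
  have uc: "u \<in> carrier (Zl l)" "inv\<^bsub>Zl l\<^esub> u \<in> carrier (Zl l)" "inv\<^bsub>Zl l\<^esub> u \<otimes>\<^bsub>Zl l\<^esub> u = \<one>\<^bsub>Zl l\<^esub>"
    using u(1) by auto
  have u'c: "u' \<in> carrier ZG" unfolding u'_def using uc(2) by (rule Zl_const_closed)
  have ca: "Zl_const l G a \<in> carrier ZG" using a(1) by (rule Zl_const_closed)
  have uu: "u' \<otimes>\<^bsub>ZG\<^esub> Zl_const l G u = \<one>\<^bsub>ZG\<^esub>"
    unfolding u'_def using uc ring_hom_mult[OF ring_hom_ring.homh[OF Zl_const_hom] uc(2,1)]
      ring_hom_one[OF ring_hom_ring.homh[OF Zl_const_hom]] by simp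
  have au: "Zl_const l G a = [(l ^ k)] \<cdot>\<^bsub>ZG\<^esub> Zl_const l G u"
    unfolding u(2) using uc(1) by (rule ring_hom_ring.hom_add_pow_nat[OF Zl_const_hom])
  define z' where "z' = u' \<otimes>\<^bsub>ZG\<^esub> z"
  have z'c: "z' \<in> carrier ZG" using u'c z(1) by (simp add: z'_def)
  have "u' \<otimes>\<^bsub>ZG\<^esub> (Zl_const l G a \<otimes>\<^bsub>ZG\<^esub> y) = [(l ^ k)] \<cdot>\<^bsub>ZG\<^esub> (u' \<otimes>\<^bsub>ZG\<^esub> Zl_const l G u \<otimes>\<^bsub>ZG\<^esub> y)"
    unfolding au using u'c y(1) Zl_const_closed[OF uc(1)]
    by (simp add: ZG.add_pow_ldistr ZG.add_pow_rdistr ZG.m_assoc)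
  then have uay: "u' \<otimes>\<^bsub>ZG\<^esub> (Zl_const l G a \<otimes>\<^bsub>ZG\<^esub> y) = [(l ^ k)] \<cdot>\<^bsub>ZG\<^esub> y" using y(1) by (simp add: uu)
  have "quot_frac n (Zl_const l G a \<otimes>\<^bsub>ZG\<^esub> y) (j + p) = quot_frac n z 0"
    using C(2) unfolding a(2) y(2) z(2) Ql_quot_const_ell_frac[OF a(1)] quot_frac_mult[OF ca y(1)]
    by (simp only: quot_frac_def)
  then have "quot_frac n u' 0 \<otimes>\<^bsub>Vn n\<^esub> quot_frac n (Zl_const l G a \<otimes>\<^bsub>ZG\<^esub> y) (j + p) =
      quot_frac n u' 0 \<otimes>\<^bsub>Vn n\<^esub> quot_frac n z 0" by simp
  then have key: "quot_frac n ([(l ^ k)] \<cdot>\<^bsub>ZG\<^esub> y) (j + p) = quot_frac n z' 0"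
    using u'c ca y(1) z(1) by (simp only: quot_frac_mult ZG.m_closed uay z'_def add_0)
  have ky: "[(l ^ k)] \<cdot>\<^bsub>ZG\<^esub> y \<in> carrier ZG" using y(1) by simp
  have "v \<in> lattice n (k - j)"
  proof (cases "j \<le> k")
    case True
    have "v = quot_frac n ([(l ^ k)] \<cdot>\<^bsub>ZG\<^esub> y) (p + k)" unfolding y(2) using y(1) by (rule quot_frac_expand)
    also have "\<dots> = quot_frac n (\<one>\<^bsub>ZG\<^esub> \<otimes>\<^bsub>ZG\<^esub> [(l ^ k)] \<cdot>\<^bsub>ZG\<^esub> y) ((k - j) + (j + p))"
      using True ky by (simp add: add.commute)
    also have "\<dots> = quot_frac n \<one>\<^bsub>ZG\<^esub> (k - j) \<otimes>\<^bsub>Vn n\<^esub> quot_frac n z' 0"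
      unfolding key[symmetric] using ky by (intro quot_frac_mult[symmetric]) simp_all
    also have "\<dots> = quot_frac n (\<one>\<^bsub>ZG\<^esub> \<otimes>\<^bsub>ZG\<^esub> z') (k - j + 0)" using z'c by (intro quot_frac_mult) simp_all
    finally show ?thesis using z'c by (auto simp: lattice_def)
  next
    case False
    let ?d = "[(l ^ (j - k))] \<cdot>\<^bsub>ZG\<^esub> \<one>\<^bsub>ZG\<^esub>"
    have "v = quot_frac n ([(l ^ j)] \<cdot>\<^bsub>ZG\<^esub> y) (p + j)" unfolding y(2) using y(1) by (rule quot_frac_expand)
    also have "[(l ^ j)] \<cdot>\<^bsub>ZG\<^esub> y = ?d \<otimes>\<^bsub>ZG\<^esub> [(l ^ k)] \<cdot>\<^bsub>ZG\<^esub> y"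
      using False y(1) by (simp add: ZG.ell_smult_mult_ell_smult)
    also have "quot_frac n (?d \<otimes>\<^bsub>ZG\<^esub> [(l ^ k)] \<cdot>\<^bsub>ZG\<^esub> y) (p + j) =
        quot_frac n (?d \<otimes>\<^bsub>ZG\<^esub> [(l ^ k)] \<cdot>\<^bsub>ZG\<^esub> y) (0 + (j + p))" by (simp add: add.commute)
    also have "\<dots> = quot_frac n ?d 0 \<otimes>\<^bsub>Vn n\<^esub> quot_frac n z' 0"
      unfolding key[symmetric] using ky by (intro quot_frac_mult[symmetric]) simp_all
    also have "\<dots> = quot_frac n (?d \<otimes>\<^bsub>ZG\<^esub> z') (0 + 0)" using z'c by (intro quot_frac_mult) simp_all
    finally show ?thesis using z'c False by (auto simp: lattice_def)
  qed
  moreover have "real (k - j) < t" using bound[OF u(3)] t by (cases "j \<le> k") (auto simp: of_nat_diff)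
  ultimately show ?thesis using that by blast
qed

lemma convergent_norm_le:
  assumes "\<And>n. quot_val l G n (g n) + ereal (r * real n) \<ge> ereal B"
  shows "convergent_norm l G r g \<le> ereal (real l powr - B)"
  unfolding convergent_norm_def
proof (rule SUP_least)
  fix n
  show "ell_powr_neg l (quot_val l G n (g n) + ereal (r * real n)) \<le> ereal (real l powr - B)"
    using assms[of n] l_gt
    by (cases "quot_val l G n (g n) + ereal (r * real n)") (auto simp: ell_powr_neg_def)
qed

lemma convergent_ringI:
  assumes g: "g \<in> carrier QG" and lat: "\<And>n. g n \<in> lattice n (m + c * n)" and r: "real c < r"
  shows "g \<in> convergent_ring l G r"
proof -
  have "(\<lambda>n. quot_val l G n (g n) + ereal (r * real n)) \<longlonglongrightarrow> \<infinity>"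
    unfolding tendsto_PInfty
  proof (intro allI)
    fix B :: real
    obtain N :: nat where N: "(B + real m) / (r - real c) < real N" using reals_Archimedean2 by blast
    have "quot_val l G n (g n) + ereal (r * real n) > ereal B" if "n \<ge> N" for n
    proof -
      have "(B + real m) / (r - real c) < real n" using N that by linarith
      then have "B + real m < real n * (r - real c)" using r by (simp add: pos_divide_less_eq)
      then have "B < - real (m + c * n) + r * real n" by (simp add: algebra_simps)
      then have "ereal B < ereal (- real (m + c * n)) + ereal (r * real n)" by simp
      also have "\<dots> \<le> quot_val l G n (g n) + ereal (r * real n)"
        by (intro add_right_mono quot_val_lattice lat)
      finally show ?thesis .
    qed
    then show "eventually (\<lambda>n. ereal B < quot_val l G n (g n) + ereal (r * real n)) sequentially"
      by (auto simp: eventually_sequentially)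
  qed
  then show ?thesis using g by (simp add: convergent_ring_def)
qed

text \<open>Eigenvectors are nonzero by definition, so summands that vanish have to be left out.\<close>

lemma Ql_span_sum:
  fixes k :: nat
  assumes E: "E \<subseteq> carrier QG" and e: "\<And>i. i < k \<Longrightarrow> e i \<in> E \<or> e i = \<zero>\<^bsub>QG\<^esub>"
  shows "(\<Oplus>\<^bsub>QG\<^esub>i\<in>{..<k}. e i) \<in> Ql_span l G E"
  using e
proof (induction k)
  case 0
  show ?case unfolding Ql_span_def by (auto intro!: exI[of _ "0::nat"])
next
  case (Suc k)
  have ec: "e i \<in> carrier QG" if "i < Suc k" for i using Suc.prems[OF that] E by auto
  have sum: "(\<Oplus>\<^bsub>QG\<^esub>i\<in>{..<Suc k}. e i) = e k \<oplus>\<^bsub>QG\<^esub> (\<Oplus>\<^bsub>QG\<^esub>i\<in>{..<k}. e i)"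
    unfolding lessThan_Suc using ec by (intro QG.finsum_insert) auto
  have fc: "(\<Oplus>\<^bsub>QG\<^esub>i\<in>{..<k}. e i) \<in> carrier QG" using ec by (intro QG.finsum_closed) auto
  have IH: "(\<Oplus>\<^bsub>QG\<^esub>i\<in>{..<k}. e i) \<in> Ql_span l G E"
    by (rule Suc.IH) (use Suc.prems less_SucI in blast)
  obtain m s e' where m: "(\<Oplus>\<^bsub>QG\<^esub>i\<in>{..<k}. e i) = (\<Oplus>\<^bsub>QG\<^esub>i\<in>{..<m}. Ql_scale l G (s i) (e' i))"
    "s \<in> {..<m::nat} \<rightarrow> carrier (Ql l)" "e' \<in> {..<m} \<rightarrow> E"
    using IH unfolding Ql_span_def mem_Collect_eq by blast
  show ?case
  proof (cases "e k = \<zero>\<^bsub>QG\<^esub>")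
    case True
    then have "(\<Oplus>\<^bsub>QG\<^esub>i\<in>{..<Suc k}. e i) = (\<Oplus>\<^bsub>QG\<^esub>i\<in>{..<m}. Ql_scale l G (s i) (e' i))"
      unfolding sum m(1)[symmetric] using fc by simp
    then show ?thesis using m(2,3) unfolding Ql_span_def by blast
  next
    case False
    then have ek: "e k \<in> E" using Suc.prems[of k] by simp
    interpret Q: ring "Ql l" by (rule Zl.rationalize_is_ring)
    define s2 where "s2 i = (if i = m then \<one>\<^bsub>Ql l\<^esub> else s i)" for i
    define e2 where "e2 i = (if i = m then e k else e' i)" for i
    have s2: "s2 \<in> {..<Suc m} \<rightarrow> carrier (Ql l)" using m(2) by (auto simp: s2_def less_Suc_eq)
    have e2: "e2 \<in> {..<Suc m} \<rightarrow> E" using m(3) ek by (auto simp: e2_def less_Suc_eq)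
    have one: "Ql_scale l G \<one>\<^bsub>Ql l\<^esub> (e k) = e k"
      by (rule ext) (simp only: Ql_scale_at ring_hom_one[OF qc.homh] Vn.l_one Ql_group_ringD(1)[OF ec[OF lessI]])
    have cl: "Ql_scale l G (s2 i) (e2 i) \<in> carrier QG" if "i < Suc m" for i
      using s2 e2 that E by (intro Ql_scale_closed) auto
    have "(\<Oplus>\<^bsub>QG\<^esub>i\<in>{..<Suc m}. Ql_scale l G (s2 i) (e2 i)) =
        Ql_scale l G (s2 m) (e2 m) \<oplus>\<^bsub>QG\<^esub> (\<Oplus>\<^bsub>QG\<^esub>i\<in>{..<m}. Ql_scale l G (s2 i) (e2 i))"
      unfolding lessThan_Suc using cl by (intro QG.finsum_insert) auto
    also have "(\<Oplus>\<^bsub>QG\<^esub>i\<in>{..<m}. Ql_scale l G (s2 i) (e2 i)) = (\<Oplus>\<^bsub>QG\<^esub>i\<in>{..<m}. Ql_scale l G (s i) (e' i))"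
      using m(2,3) E by (intro QG.finsum_cong') (auto simp: s2_def e2_def intro!: Ql_scale_closed)
    also have "Ql_scale l G (s2 m) (e2 m) = e k" by (simp only: s2_def e2_def one if_True simp_thms)
    finally have "(\<Oplus>\<^bsub>QG\<^esub>i\<in>{..<Suc k}. e i) = (\<Oplus>\<^bsub>QG\<^esub>i\<in>{..<Suc m}. Ql_scale l G (s2 i) (e2 i))"
      by (simp only: sum m(1))
    then show ?thesis using s2 e2 unfolding Ql_span_def by blast
  qed
qed

end

section \<open>Density of the eigenvectors\<close>

locale pro_group_endo = pro_group_hom l G G f for l and G :: "'g topgroup" and f +
  fixes \<alpha> J
  assumes alpha: "\<alpha> \<in> Units (Zl l)" and not_root: "\<forall>n>0. \<alpha> [^]\<^bsub>Zl l\<^esub> (n::nat) \<noteq> \<one>\<^bsub>Zl l\<^esub>"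
    and J: "J \<subseteq> Ql_aug_ideal l G"
    and powers: "acts_on_gr_by_powers l G (weight_filtration (Ql_group_ring l G) (Ql_aug_ideal l G) J)
      (Ql_map l G G f) \<alpha>"
begin

abbreviation "weight i \<equiv> weight_filtration QG (Ql_aug_ideal l G) J i"

lemma alpha_closed: "\<alpha> \<in> carrier (Zl l)" using alpha by auto

interpretation Q: cring "Ql l" by (rule Zl.rationalize_is_cring)

definition qa :: "((nat \<Rightarrow> int) \<times> nat) set" where
  "qa = ell_frac l (Zl l) \<alpha> 0"

lemma qa_closed: "qa \<in> carrier (Ql l)"
  unfolding qa_def using alpha_closed by (rule Zl.ell_frac_closed)

lemma qa_pow: "qa [^]\<^bsub>Ql l\<^esub> (i::nat) = ell_frac l (Zl l) (\<alpha> [^]\<^bsub>Zl l\<^esub> i) 0"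
proof (induction i)
  case (Suc i)
  have "qa [^]\<^bsub>Ql l\<^esub> Suc i = ell_frac l (Zl l) (\<alpha> [^]\<^bsub>Zl l\<^esub> i) 0 \<otimes>\<^bsub>Ql l\<^esub> ell_frac l (Zl l) \<alpha> 0"
    using Suc by (simp add: qa_def)
  then show ?case using alpha_closed by (simp add: Zl.rationalize_mult)
qed (simp add: Zl.rationalize_one)

lemma qa_pow_closed: "qa [^]\<^bsub>Ql l\<^esub> (i::nat) \<in> carrier (Ql l)"
  unfolding qa_pow using alpha_closed by (intro Zl.ell_frac_closed) simp

text \<open>The difference \<open>\<alpha>\<^sup>j - \<alpha>\<^sup>i\<close> is \<open>\<alpha>\<^sup>i (\<alpha>\<^bsup>j-i\<^esup> - 1)\<close> with a unit \<open>\<alpha>\<^sup>i\<close>, so its inverse has a denominator that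
  depends on \<open>j - i\<close> only.\<close>

lemma bounded_denominators:
  obtains \<nu> :: "nat \<Rightarrow> nat" and c :: nat
  where "\<And>m. (\<Sum>k=1..m. \<nu> k) \<le> c * m"
    and "\<And>i j. i < j \<Longrightarrow> \<exists>s\<in>carrier (Zl l).
      (qa [^]\<^bsub>Ql l\<^esub> (j::nat) \<ominus>\<^bsub>Ql l\<^esub> qa [^]\<^bsub>Ql l\<^esub> (i::nat)) \<otimes>\<^bsub>Ql l\<^esub> ell_frac l (Zl l) s (\<nu> (j - i)) = \<one>\<^bsub>Ql l\<^esub>"
proof -
  obtain k where k: "\<And>m. m > 0 \<Longrightarrow> \<exists>t\<in>carrier (Zl l). (\<alpha> [^]\<^bsub>Zl l\<^esub> m \<ominus>\<^bsub>Zl l\<^esub> \<one>\<^bsub>Zl l\<^esub>) \<otimes>\<^bsub>Zl l\<^esub> t =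
      [(l ^ (k + multiplicity l m))] \<cdot>\<^bsub>Zl l\<^esub> \<one>\<^bsub>Zl l\<^esub>"
    using power_minus_one_dvd_ell_power[OF alpha not_root] by blast
  define \<nu> where "\<nu> m = k + multiplicity l m" for m
  show ?thesis
  proof (rule that[of \<nu> "k + 1"])
    fix m
    have "(\<Sum>k=1..m. \<nu> k) = k * m + (\<Sum>k=1..m. multiplicity l k)"
      by (simp add: \<nu>_def sum.distrib)
    then show "(\<Sum>k=1..m. \<nu> k) \<le> (k + 1) * m" using sum_multiplicity_le[OF prime_l, of m] by simp
  next
    fix i j :: nat assume ij: "i < j"
    obtain t where t: "t \<in> carrier (Zl l)" "(\<alpha> [^]\<^bsub>Zl l\<^esub> (j - i) \<ominus>\<^bsub>Zl l\<^esub> \<one>\<^bsub>Zl l\<^esub>) \<otimes>\<^bsub>Zl l\<^esub> t =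
        [(l ^ \<nu> (j - i))] \<cdot>\<^bsub>Zl l\<^esub> \<one>\<^bsub>Zl l\<^esub>"
      using k[of "j - i"] ij by (auto simp: \<nu>_def)
    define b where "b = \<alpha> [^]\<^bsub>Zl l\<^esub> i"
    have bU: "b \<in> Units (Zl l)" unfolding b_def using alpha by (rule Zl.Units_pow_closed)
    then have b: "b \<in> carrier (Zl l)" "inv\<^bsub>Zl l\<^esub> b \<in> carrier (Zl l)" "b \<otimes>\<^bsub>Zl l\<^esub> inv\<^bsub>Zl l\<^esub> b = \<one>\<^bsub>Zl l\<^esub>" by auto
    define d where "d = \<alpha> [^]\<^bsub>Zl l\<^esub> (j - i)"
    have d: "d \<in> carrier (Zl l)" unfolding d_def using alpha_closed by simp
    have aj: "\<alpha> [^]\<^bsub>Zl l\<^esub> j = b \<otimes>\<^bsub>Zl l\<^esub> d"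
      unfolding b_def d_def using ij alpha_closed by (simp add: Zl.nat_pow_mult)
    define s where "s = inv\<^bsub>Zl l\<^esub> b \<otimes>\<^bsub>Zl l\<^esub> t"
    have s: "s \<in> carrier (Zl l)" using b t by (simp add: s_def)
    have "(b \<otimes>\<^bsub>Zl l\<^esub> d \<ominus>\<^bsub>Zl l\<^esub> b) \<otimes>\<^bsub>Zl l\<^esub> s = (b \<otimes>\<^bsub>Zl l\<^esub> inv\<^bsub>Zl l\<^esub> b) \<otimes>\<^bsub>Zl l\<^esub> ((d \<ominus>\<^bsub>Zl l\<^esub> \<one>\<^bsub>Zl l\<^esub>) \<otimes>\<^bsub>Zl l\<^esub> t)"
      unfolding s_def using b(1,2) d t(1) by algebra
    then have prod: "(b \<otimes>\<^bsub>Zl l\<^esub> d \<ominus>\<^bsub>Zl l\<^esub> b) \<otimes>\<^bsub>Zl l\<^esub> s = [(l ^ \<nu> (j - i))] \<cdot>\<^bsub>Zl l\<^esub> \<one>\<^bsub>Zl l\<^esub>"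
      using t(2) by (simp add: b(3) d_def)
    have "qa [^]\<^bsub>Ql l\<^esub> j \<ominus>\<^bsub>Ql l\<^esub> qa [^]\<^bsub>Ql l\<^esub> i = ell_frac l (Zl l) (b \<otimes>\<^bsub>Zl l\<^esub> d \<ominus>\<^bsub>Zl l\<^esub> b) 0"
      unfolding qa_pow aj b_def[symmetric] using b d by (simp add: Zl.ell_frac_diff)
    then have "(qa [^]\<^bsub>Ql l\<^esub> j \<ominus>\<^bsub>Ql l\<^esub> qa [^]\<^bsub>Ql l\<^esub> i) \<otimes>\<^bsub>Ql l\<^esub> ell_frac l (Zl l) s (\<nu> (j - i)) =
        ell_frac l (Zl l) ([(l ^ \<nu> (j - i))] \<cdot>\<^bsub>Zl l\<^esub> \<one>\<^bsub>Zl l\<^esub>) (0 + \<nu> (j - i))"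
      using b d s by (simp add: Zl.rationalize_mult prod)
    also have "\<dots> = \<one>\<^bsub>Ql l\<^esub>"
      unfolding Zl.rationalize_one by (rule Zl.ell_frac_expand[symmetric]) simp
    finally show "\<exists>s\<in>carrier (Zl l). (qa [^]\<^bsub>Ql l\<^esub> j \<ominus>\<^bsub>Ql l\<^esub> qa [^]\<^bsub>Ql l\<^esub> i) \<otimes>\<^bsub>Ql l\<^esub> ell_frac l (Zl l) s (\<nu> (j - i)) = \<one>\<^bsub>Ql l\<^esub>"
      using s by blast
  qed
qed

text \<open>The ring \<open>\<int>\<^sub>l[[G]]/I\<^sup>n \<otimes> \<rat>\<^sub>l\<close> as a module over \<open>\<rat>\<^sub>l\<close>.\<close>

definition Vmod where
  "Vmod n = \<lparr>carrier = carrier (Vn n), monoid.mult = monoid.mult (Vn n), monoid.one = monoid.one (Vn n),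
    ring.zero = ring.zero (Vn n), ring.add = ring.add (Vn n),
    module.smult = (\<lambda>s v. Ql_quot_const l G n s \<otimes>\<^bsub>Vn n\<^esub> v)\<rparr>"

lemma Vmod_simps:
  "carrier (Vmod n) = carrier (Vn n)" "\<zero>\<^bsub>Vmod n\<^esub> = \<zero>\<^bsub>Vn n\<^esub>" "u \<oplus>\<^bsub>Vmod n\<^esub> v = u \<oplus>\<^bsub>Vn n\<^esub> v"
  "s \<odot>\<^bsub>Vmod n\<^esub> v = Ql_quot_const l G n s \<otimes>\<^bsub>Vn n\<^esub> v"
  "\<ominus>\<^bsub>Vmod n\<^esub> u = \<ominus>\<^bsub>Vn n\<^esub> u" "u \<ominus>\<^bsub>Vmod n\<^esub> v = u \<ominus>\<^bsub>Vn n\<^esub> v"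
  "finsum (Vmod n) h A = finsum (Vn n) h A"
  by (simp_all add: Vmod_def a_inv_def a_minus_def finsum_def m_inv_def finprod_def)

lemma Vmod_module: "module (Ql l) (Vmod n)"
proof (rule moduleI)
  show "abelian_group (Vmod n)"
  proof (rule abelian_groupI)
    fix v assume "v \<in> carrier (Vmod n)"
    then show "\<exists>u\<in>carrier (Vmod n). u \<oplus>\<^bsub>Vmod n\<^esub> v = \<zero>\<^bsub>Vmod n\<^esub>"
      by (intro bexI[of _ "\<ominus>\<^bsub>Vn n\<^esub> v"]) (simp_all add: Vmod_simps Vn.l_neg)
  qed (simp_all add: Vmod_simps Vn.add.m_ac)
qed (simp_all only: Vmod_simps Vn.m_closed ring_hom_closed[OF qc.homh] ring_hom_add[OF qc.homh]
    ring_hom_mult[OF qc.homh] ring_hom_one[OF qc.homh] Vn.l_distr Vn.r_distr Vn.m_assoc Vn.l_one Q.cring_axioms)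

lemma quot_map_transition:
  assumes "v \<in> carrier (Vn (Suc n))"
  shows "quot_map n (transition n v) = transition n (quot_map (Suc n) v)"
proof -
  obtain x j where x: "x \<in> carrier ZG" "v = quot_frac (Suc n) x j" using assms by (rule Vn_carrierE)
  then show ?thesis by (simp only: transition_quot_frac quot_map_quot_frac Zl_map_closed)
qed

lemma quot_map_lattice: "v \<in> lattice n e \<Longrightarrow> quot_map n v \<in> lattice n e"
  by (elim latticeE) (simp only: quot_map_quot_frac latticeI Zl_map_closed)

lemma weight_at:
  assumes "w \<in> weight i"
  shows "\<exists>w'\<in>weight (Suc i). quot_map n (w n) \<ominus>\<^bsub>Vn n\<^esub> Ql_quot_const l G n (qa [^]\<^bsub>Ql l\<^esub> i) \<otimes>\<^bsub>Vn n\<^esub> w n = w' n"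
proof (rule bexI)
  have w: "w \<in> carrier QG" using J assms by (rule weight_filtration_closed)
  let ?w' = "Ql_map l G G f w \<ominus>\<^bsub>QG\<^esub> Ql_scale l G (ell_frac l (Zl l) (\<alpha> [^]\<^bsub>Zl l\<^esub> i) 0) w"
  show "?w' \<in> weight (Suc i)" using powers assms unfolding acts_on_gr_by_powers_def by blast
  have "Ql_scale l G (ell_frac l (Zl l) (\<alpha> [^]\<^bsub>Zl l\<^esub> i) 0) w \<in> carrier QG"
    using alpha_closed w by (intro Ql_scale_closed Zl.ell_frac_closed) auto
  then show "quot_map n (w n) \<ominus>\<^bsub>Vn n\<^esub> Ql_quot_const l G n (qa [^]\<^bsub>Ql l\<^esub> i) \<otimes>\<^bsub>Vn n\<^esub> w n = ?w' n"
    by (simp only: Ql_group_ring_diff_at Ql_scale_at Ql_map_at qa_pow)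
qed

lemma eigen_module_level:
  assumes cost: "\<And>m. (\<Sum>k=1..m. \<nu> k) \<le> c * m"
    and inv: "\<And>i j. i < j \<Longrightarrow> \<exists>s\<in>carrier (Zl l).
      (qa [^]\<^bsub>Ql l\<^esub> (j::nat) \<ominus>\<^bsub>Ql l\<^esub> qa [^]\<^bsub>Ql l\<^esub> (i::nat)) \<otimes>\<^bsub>Ql l\<^esub> ell_frac l (Zl l) s (\<nu> (j - i)) = \<one>\<^bsub>Ql l\<^esub>"
  shows "eigen_module (Ql l) (Vmod n) (quot_map n) qa (lattice n) \<nu> c"
proof -
  have inv': "qa [^]\<^bsub>Ql l\<^esub> j \<ominus>\<^bsub>Ql l\<^esub> qa [^]\<^bsub>Ql l\<^esub> i \<in> Units (Ql l) \<and>
      (\<exists>s\<in>carrier (Zl l). inv\<^bsub>Ql l\<^esub> (qa [^]\<^bsub>Ql l\<^esub> j \<ominus>\<^bsub>Ql l\<^esub> qa [^]\<^bsub>Ql l\<^esub> i) = ell_frac l (Zl l) s (\<nu> (j - i)))"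
    if ij: "i < j" for i j :: nat
  proof -
    obtain s where s: "s \<in> carrier (Zl l)"
      "(qa [^]\<^bsub>Ql l\<^esub> j \<ominus>\<^bsub>Ql l\<^esub> qa [^]\<^bsub>Ql l\<^esub> i) \<otimes>\<^bsub>Ql l\<^esub> ell_frac l (Zl l) s (\<nu> (j - i)) = \<one>\<^bsub>Ql l\<^esub>"
      using inv[OF ij] by blast
    have c: "qa [^]\<^bsub>Ql l\<^esub> j \<ominus>\<^bsub>Ql l\<^esub> qa [^]\<^bsub>Ql l\<^esub> i \<in> carrier (Ql l)" using qa_closed by simp
    have e: "ell_frac l (Zl l) s (\<nu> (j - i)) \<in> carrier (Ql l)" using s(1) by (rule Zl.ell_frac_closed)
    have "qa [^]\<^bsub>Ql l\<^esub> j \<ominus>\<^bsub>Ql l\<^esub> qa [^]\<^bsub>Ql l\<^esub> i \<in> Units (Ql l)"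
      using c e s(2) Q.m_comm[OF c e] unfolding Units_def by auto
    then show ?thesis using Q.comm_inv_char[OF c e s(2)] s(1) by blast
  qed
  show ?thesis
  proof (intro eigen_module.intro eigen_module_axioms.intro Vmod_module)
    fix e :: nat and x and i j :: nat assume ij: "i < j" and x: "x \<in> lattice n e"
    obtain s where s: "s \<in> carrier (Zl l)"
      "inv\<^bsub>Ql l\<^esub> (qa [^]\<^bsub>Ql l\<^esub> j \<ominus>\<^bsub>Ql l\<^esub> qa [^]\<^bsub>Ql l\<^esub> i) = ell_frac l (Zl l) s (\<nu> (j - i))"
      using inv'[OF ij] by blast
    show "inv\<^bsub>Ql l\<^esub> (qa [^]\<^bsub>Ql l\<^esub> j \<ominus>\<^bsub>Ql l\<^esub> qa [^]\<^bsub>Ql l\<^esub> i) \<odot>\<^bsub>Vmod n\<^esub> x \<in> lattice n (e + \<nu> (j - i))"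
      unfolding s(2) Vmod_simps using lattice_const[OF s(1) x, of "\<nu> (j - i)"] by (simp only: add.commute)
  next
    fix e :: nat and x and i :: nat assume x: "x \<in> lattice n e"
    show "qa [^]\<^bsub>Ql l\<^esub> i \<odot>\<^bsub>Vmod n\<^esub> x \<in> lattice n e"
      unfolding qa_pow Vmod_simps
      using lattice_const[OF Zl.nat_pow_closed[OF alpha_closed] x, of i 0] by simp
  next
    fix r x assume "r \<in> carrier (Ql l)" "x \<in> carrier (Vmod n)"
    then show "quot_map n (r \<odot>\<^bsub>Vmod n\<^esub> x) = r \<odot>\<^bsub>Vmod n\<^esub> quot_map n x"
      by (simp only: Vmod_simps ring_hom_mult[OF qm.homh] ring_hom_closed[OF qc.homh] quot_map_const)
  next
    fix i j :: nat assume "i < j"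
    then show "qa [^]\<^bsub>Ql l\<^esub> j \<ominus>\<^bsub>Ql l\<^esub> qa [^]\<^bsub>Ql l\<^esub> i \<in> Units (Ql l)" using inv' by blast
  qed (simp_all only: Vmod_simps ring_hom_closed[OF qm.homh] ring_hom_add[OF qm.homh] qa_closed cost
      lattice_subset zero_in_lattice lattice_increasing lattice_add_closed lattice_minus_closed quot_map_lattice)
qed

text \<open>An element of constant denominator has, modulo every power of the augmentation ideal, an
  eigenvector decomposition; by uniqueness these are compatible and define eigenvectors in
  \<open>\<rat>\<^sub>l[[G]]\<close>.\<close>

lemma eigen_components:
  obtains c :: nat where "\<And>x e. x \<in> carrier ZG \<Longrightarrow> \<exists>E. \<forall>i. E i \<in> carrier QG \<and>
    (\<forall>n. E i n \<in> lattice n (e + c * n)) \<and> Ql_map l G G f (E i) = Ql_scale l G (qa [^]\<^bsub>Ql l\<^esub> i) (E i) \<and>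
    (\<forall>n N. n \<le> N \<longrightarrow> (\<Oplus>\<^bsub>QG\<^esub>i\<in>{..<2 * N}. E i) n = quot_frac n x e)"
proof -
  obtain \<nu> c where cost: "\<And>m. (\<Sum>k=1..m. \<nu> k) \<le> c * m" and inv: "\<And>i j. i < j \<Longrightarrow> \<exists>s\<in>carrier (Zl l).
      (qa [^]\<^bsub>Ql l\<^esub> (j::nat) \<ominus>\<^bsub>Ql l\<^esub> qa [^]\<^bsub>Ql l\<^esub> (i::nat)) \<otimes>\<^bsub>Ql l\<^esub> ell_frac l (Zl l) s (\<nu> (j - i)) = \<one>\<^bsub>Ql l\<^esub>"
    using bounded_denominators by blast
  note eigen = eigen_module_level[OF cost inv]
  show ?thesis
  proof (rule that)
    fix x e assume x: "x \<in> carrier ZG"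
    define h where "h n = quot_frac n x e" for n
    have h: "h \<in> carrier QG"
      unfolding h_def using x by (intro Ql_group_ringI quot_frac_closed transition_quot_frac)
    have hD: "h n \<in> carrier (Vn n)" "transition n (h (Suc n)) = h n" for n
      using Ql_group_ringD[OF h] .
    have "\<exists>w. (\<forall>i. w i \<in> lattice n (e + 2 * c * n) \<and>
          quot_map n (w i) = Ql_quot_const l G n (qa [^]\<^bsub>Ql l\<^esub> i) \<otimes>\<^bsub>Vn n\<^esub> w i \<and>
          (i \<ge> 2 * n \<longrightarrow> w i = \<zero>\<^bsub>Vn n\<^esub>)) \<and> h n = (\<Oplus>\<^bsub>Vn n\<^esub>i\<in>{..<2 * n}. w i)" for n
    proof -
      interpret E: eigen_module "Ql l" "Vmod n" "quot_map n" qa "lattice n" \<nu> c by (rule eigen)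
      \<comment> \<open>the images of the weight filtration reach 0 after \<open>2 n\<close> steps\<close>
      have "\<exists>w. (\<forall>i\<in>{0..<2 * n}. w i \<in> lattice n (e + c * (2 * n - i) + (\<Sum>k=1..i - 0. \<nu> k)) \<and>
          quot_map n (w i) = qa [^]\<^bsub>Ql l\<^esub> i \<odot>\<^bsub>Vmod n\<^esub> w i) \<and> h n = (\<Oplus>\<^bsub>Vmod n\<^esub>i\<in>{0..<2 * n}. w i)"
      proof (rule E.eigen_decomposition[where W = "\<lambda>i. (\<lambda>w. w n) ` weight i"])
        show "(\<lambda>w. w n) ` weight i \<subseteq> carrier (Vmod n)" for i
          using Ql_group_ringD(1)[OF weight_filtration_closed[OF J]] by (auto simp: Vmod_simps)
        show "E.shifted i v \<in> (\<lambda>w. w n) ` weight (Suc i)" if "v \<in> (\<lambda>w. w n) ` weight i" for i v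
          using that weight_at[of _ i n] by (auto simp: E.shifted_def Vmod_simps)
        show "(\<lambda>w. w n) ` weight (2 * n) \<subseteq> {\<zero>\<^bsub>Vmod n\<^esub>}"
          using weight_filtration_vanishes[OF J, of _ n] by (auto simp: Vmod_simps)
        show "h n \<in> (\<lambda>w. w n) ` weight 0" using h by simp
        show "h n \<in> lattice n e" unfolding h_def using x by (rule latticeI)
      qed simp
      then obtain w where w: "\<And>i. i < 2 * n \<Longrightarrow> w i \<in> lattice n (e + c * (2 * n - i) + (\<Sum>k=1..i. \<nu> k))"
        "\<And>i. i < 2 * n \<Longrightarrow> quot_map n (w i) = Ql_quot_const l G n (qa [^]\<^bsub>Ql l\<^esub> i) \<otimes>\<^bsub>Vn n\<^esub> w i"
        "h n = (\<Oplus>\<^bsub>Vn n\<^esub>i\<in>{..<2 * n}. w i)"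
        by (auto simp: Vmod_simps atLeast0LessThan)
      define w' where "w' i = (if i < 2 * n then w i else \<zero>\<^bsub>Vn n\<^esub>)" for i
      have lat: "w i \<in> lattice n (e + 2 * c * n)" if i: "i < 2 * n" for i
      proof -
        have "c * (2 * n - i) + (\<Sum>k=1..i. \<nu> k) \<le> c * (2 * n - i) + c * i" using cost by simp
        also have "\<dots> = 2 * c * n" using i by (simp add: add_mult_distrib2[symmetric])
        finally have "e + c * (2 * n - i) + (\<Sum>k=1..i. \<nu> k) \<le> e + 2 * c * n" by simp
        then show ?thesis using w(1)[OF i] lattice_increasing by blast
      qed
      have "h n = (\<Oplus>\<^bsub>Vn n\<^esub>i\<in>{..<2 * n}. w' i)"
        unfolding w(3) using subsetD[OF lattice_subset lat] by (intro Vn.finsum_cong') (auto simp: w'_def)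
      moreover have "w' i \<in> lattice n (e + 2 * c * n)" "i \<ge> 2 * n \<longrightarrow> w' i = \<zero>\<^bsub>Vn n\<^esub>"
        "quot_map n (w' i) = Ql_quot_const l G n (qa [^]\<^bsub>Ql l\<^esub> i) \<otimes>\<^bsub>Vn n\<^esub> w' i" for i
        using lat w(2) ring_hom_zero[OF qm.homh Vn.ring_axioms Vn.ring_axioms]
          ring_hom_closed[OF qc.homh qa_pow_closed]
        by (auto simp: w'_def zero_in_lattice)
      ultimately show ?thesis by blast
    qed
    then obtain w where w: "\<And>n i. w n i \<in> lattice n (e + 2 * c * n)"
      "\<And>n i. quot_map n (w n i) = Ql_quot_const l G n (qa [^]\<^bsub>Ql l\<^esub> i) \<otimes>\<^bsub>Vn n\<^esub> w n i"
      "\<And>n i. i \<ge> 2 * n \<Longrightarrow> w n i = \<zero>\<^bsub>Vn n\<^esub>" "\<And>n. h n = (\<Oplus>\<^bsub>Vn n\<^esub>i\<in>{..<2 * n}. w n i)"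
      by metis
    have wc: "w n i \<in> carrier (Vn n)" for n i using w(1) lattice_subset by blast
    have sum: "(\<Oplus>\<^bsub>Vn n\<^esub>i\<in>{..<2 * N}. w n i) = h n" if "n \<le> N" for n N
      unfolding w(4) using that wc w(3)
      by (intro Vn.add.finprod_mono_neutral_cong_right) auto
    have qc: "Ql_quot_const l G n (qa [^]\<^bsub>Ql l\<^esub> i) \<in> carrier (Vn n)" for n and i :: nat
      by (rule ring_hom_closed[OF qc.homh qa_pow_closed])
    have trans: "transition n (w (Suc n) i) = w n i" for n i
    proof (cases "i < 2 * Suc n")
      case True
      interpret E: eigen_module "Ql l" "Vmod n" "quot_map n" qa "lattice n" \<nu> c by (rule eigen)
      \<comment> \<open>the components at \<open>n + 1\<close> and those at \<open>n\<close>, padded with zeros, decompose the same element\<close>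
      let ?t = "\<lambda>i. transition n (w (Suc n) i)"
      have tc: "?t i \<in> carrier (Vn n)" for i using wc by (rule ring_hom_closed[OF tr.homh])
      define d where "d i = ?t i \<ominus>\<^bsub>Vn n\<^esub> w n i" for i
      have dc: "d i \<in> carrier (Vn n)" for i using tc wc by (simp add: d_def)
      have td: "?t i = d i \<oplus>\<^bsub>Vn n\<^esub> w n i" for i
        unfolding d_def a_minus_def using tc[of i] wc[of n i] by (simp add: Vn.a_assoc Vn.l_neg)
      have tT: "quot_map n (?t i) = Ql_quot_const l G n (qa [^]\<^bsub>Ql l\<^esub> i) \<otimes>\<^bsub>Vn n\<^esub> ?t i" for i
        unfolding quot_map_transition[OF wc] w(2) ring_hom_mult[OF tr.homh qc wc]
          Ql_quot_const_transition[OF qa_pow_closed] ..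
      have dT: "quot_map n (d i) = Ql_quot_const l G n (qa [^]\<^bsub>Ql l\<^esub> i) \<otimes>\<^bsub>Vn n\<^esub> d i" for i
      proof -
        let ?a = "Ql_quot_const l G n (qa [^]\<^bsub>Ql l\<^esub> i)"
        have "?a \<otimes>\<^bsub>Vn n\<^esub> d i \<oplus>\<^bsub>Vn n\<^esub> ?a \<otimes>\<^bsub>Vn n\<^esub> w n i = ?a \<otimes>\<^bsub>Vn n\<^esub> ?t i"
          unfolding td by (rule Vn.r_distr[symmetric, OF dc wc qc])
        also have "\<dots> = quot_map n (d i) \<oplus>\<^bsub>Vn n\<^esub> ?a \<otimes>\<^bsub>Vn n\<^esub> w n i"
          unfolding tT[symmetric] unfolding td ring_hom_add[OF qm.homh dc wc] w(2) ..
        finally have "quot_map n (d i) \<oplus>\<^bsub>Vn n\<^esub> ?a \<otimes>\<^bsub>Vn n\<^esub> w n i = ?a \<otimes>\<^bsub>Vn n\<^esub> d i \<oplus>\<^bsub>Vn n\<^esub> ?a \<otimes>\<^bsub>Vn n\<^esub> w n i" ..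
        then show ?thesis
          by (rule Vn.add.r_cancel[OF _ ring_hom_closed[OF qm.homh dc] Vn.m_closed[OF qc dc] Vn.m_closed[OF qc wc]])
      qed
      have "(\<Oplus>\<^bsub>Vn n\<^esub>i\<in>{..<2 * Suc n}. d i) \<oplus>\<^bsub>Vn n\<^esub> h n =
          (\<Oplus>\<^bsub>Vn n\<^esub>i\<in>{..<2 * Suc n}. d i) \<oplus>\<^bsub>Vn n\<^esub> (\<Oplus>\<^bsub>Vn n\<^esub>i\<in>{..<2 * Suc n}. w n i)"
        using sum[of n "Suc n"] by simp
      also have "\<dots> = (\<Oplus>\<^bsub>Vn n\<^esub>i\<in>{..<2 * Suc n}. ?t i)"
        unfolding td using dc wc by (intro Vn.finsum_addf[symmetric]) auto
      also have "\<dots> = transition n (\<Oplus>\<^bsub>Vn (Suc n)\<^esub>i\<in>{..<2 * Suc n}. w (Suc n) i)"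
        using wc by (subst tr.hom_finsum) (auto simp: comp_def)
      also have "\<dots> = h n" unfolding w(4)[symmetric] by (rule hD(2))
      finally have "(\<Oplus>\<^bsub>Vn n\<^esub>i\<in>{..<2 * Suc n}. d i) = \<zero>\<^bsub>Vn n\<^esub>"
        using dc hD(1)[of n] by (simp add: Vn.add.r_cancel_one Vn.finsum_closed)
      then have "d i = \<zero>\<^bsub>Vn n\<^esub>"
        using E.eigen_independent[of "2 * Suc n" d i] dc dT True by (simp add: Vmod_simps)
      then show ?thesis using td[of i] wc[of n i] by simp
    next
      case False
      then show ?thesis
        using w(3)[of "Suc n" i] w(3)[of n i] ring_hom_zero[OF tr.homh Vn.ring_axioms Vn.ring_axioms] by simp
    qed
    define E where "E i = (\<lambda>n. w n i)" for i
    have Ec: "E i \<in> carrier QG" for i unfolding E_def by (intro Ql_group_ringI wc trans)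
    have "(\<Oplus>\<^bsub>QG\<^esub>i\<in>{..<2 * N}. E i) n = quot_frac n x e" if "n \<le> N" for n N
    proof -
      have "(\<Oplus>\<^bsub>QG\<^esub>i\<in>{..<2 * N}. E i) n = (\<Oplus>\<^bsub>Vn n\<^esub>i\<in>{..<2 * N}. E i n)"
        using Ec by (intro Ql_group_ring_finsum_at) auto
      then show ?thesis using sum[OF that] by (simp add: E_def h_def)
    qed
    moreover have "Ql_map l G G f (E i) = Ql_scale l G (qa [^]\<^bsub>Ql l\<^esub> i) (E i)" for i
      by (rule ext) (simp only: Ql_map_at Ql_scale_at E_def w(2))
    moreover have "E i n \<in> lattice n (e + 2 * c * n)" for i n unfolding E_def by (rule w(1))
    ultimately show "\<exists>E. \<forall>i. E i \<in> carrier QG \<and> (\<forall>n. E i n \<in> lattice n (e + 2 * c * n)) \<and>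
        Ql_map l G G f (E i) = Ql_scale l G (qa [^]\<^bsub>Ql l\<^esub> i) (E i) \<and>
        (\<forall>n N. n \<le> N \<longrightarrow> (\<Oplus>\<^bsub>QG\<^esub>i\<in>{..<2 * N}. E i) n = quot_frac n x e)"
      using Ec by blast
  qed
qed

text \<open>Elements \<open>x / l\<^sup>m\<close> of bounded denominator are dense in the convergent ring, since a convergent \<open>g\<close> agrees with
  one of them up to level \<open>N\<close> and beyond that level both are small. In turn \<open>x / l\<^sup>m\<close> agrees up to level
  \<open>N'\<close> with the sum of its first \<open>2 N'\<close> eigencomponents; their denominators grow with slope \<open>c\<close>, so that
  the difference is small for \<open>r > c\<close>.\<close>

theorem endo_topologically_diagonalizable: "\<exists>r>0. topologically_diagonalizable l G r (Ql_map l G G f)"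
proof -
  obtain c :: nat where comp: "\<And>x e. x \<in> carrier ZG \<Longrightarrow> \<exists>E. \<forall>i. E i \<in> carrier QG \<and>
      (\<forall>n. E i n \<in> lattice n (e + c * n)) \<and> Ql_map l G G f (E i) = Ql_scale l G (qa [^]\<^bsub>Ql l\<^esub> i) (E i) \<and>
      (\<forall>n N. n \<le> N \<longrightarrow> (\<Oplus>\<^bsub>QG\<^esub>i\<in>{..<2 * N}. E i) n = quot_frac n x e)"
    using eigen_components by blast
  define r :: real where "r = real c + 1"
  have r: "r > 0" "real c < r" by (simp_all add: r_def)
  have "\<exists>h\<in>Ql_span l G (eigenvectors l G r (Ql_map l G G f)). convergent_norm l G r (g \<ominus>\<^bsub>QG\<^esub> h) < ereal \<epsilon>"
    if g: "g \<in> convergent_ring l G r" and eps: "\<epsilon> > 0" for g \<epsilon>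
  proof -
    have gc: "g \<in> carrier QG" and lim: "(\<lambda>n. quot_val l G n (g n) + ereal (r * real n)) \<longlonglongrightarrow> \<infinity>"
      using g by (auto simp: convergent_ring_def)
    \<comment> \<open>norms are less than \<open>\<epsilon>\<close> if valuations are at least \<open>B\<close>; the 1 makes the inequality strict\<close>
    define B where "B = 1 - log (real l) \<epsilon>"
    have "real l powr - B < real l powr (log (real l) \<epsilon>)"
      using l_gt by (intro powr_less_mono) (auto simp: B_def)
    then have B: "real l powr - B < \<epsilon>" using l_gt eps by simp
    obtain N0 where N0: "\<And>n. n \<ge> N0 \<Longrightarrow> quot_val l G n (g n) + ereal (r * real n) > ereal B"
      using lim unfolding tendsto_PInfty eventually_sequentially by blast
    obtain N1 :: nat where N1: "B < real N1 * r" using r(1) reals_Archimedean3 by blast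
    define N where "N = max N0 N1"
    have rB: "r * real n - B > 0" if "n \<ge> N" for n
    proof -
      have "real N1 * r \<le> real n * r" using that r(1) by (intro mult_right_mono) (auto simp: N_def)
      then show ?thesis using N1 by (simp add: mult.commute)
    qed
    have g_lat: "\<exists>m. real m \<le> r * real n - B \<and> g n \<in> lattice n m" if n: "n \<ge> N" for n
    proof -
      have "quot_val l G n (g n) + ereal (r * real n) > ereal B" using N0 n by (simp add: N_def)
      then have "quot_val l G n (g n) > ereal (- (r * real n - B))"
        by (cases "quot_val l G n (g n)") auto
      then obtain m where "real m < r * real n - B" "g n \<in> lattice n m"
        using lattice_of_quot_val[OF Ql_group_ringD(1)[OF gc] _ rB[OF n]] by blast
      then show ?thesis by (intro exI[of _ m]) auto
    qed
    obtain m where m: "real m \<le> r * real N - B" "g N \<in> lattice N m" using g_lat by blast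
    obtain x where x: "x \<in> carrier ZG" "g N = quot_frac N x m" using m(2) by (rule latticeE)
    have g_low: "g n = quot_frac n x m" if "n \<le> N" for n
      using gc x that by (rule Ql_group_ring_lower)
    obtain E where E: "\<And>i. E i \<in> carrier QG" "\<And>i n. E i n \<in> lattice n (m + c * n)"
      "\<And>i. Ql_map l G G f (E i) = Ql_scale l G (qa [^]\<^bsub>Ql l\<^esub> i) (E i)"
      "\<And>n N. n \<le> N \<Longrightarrow> (\<Oplus>\<^bsub>QG\<^esub>i\<in>{..<2 * N}. E i) n = quot_frac n x m"
      using comp[OF x(1), of m] by blast
    obtain N2 :: nat where N2: "real m + B \<le> real N2" using real_arch_simple by blast
    \<comment> \<open>for \<open>n \<ge> N2\<close> the bound \<open>m + c n\<close> on the denominators is at most \<open>r n - B = c n + n - B\<close>\<close>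
    define N' where "N' = max N N2"
    define h where "h = (\<Oplus>\<^bsub>QG\<^esub>i\<in>{..<2 * N'}. E i)"
    have hc: "h \<in> carrier QG" unfolding h_def using E(1) by (intro QG.finsum_closed) auto
    have h_lat: "\<exists>k. real k \<le> r * real n - B \<and> h n \<in> lattice n k" if n: "n \<ge> N" for n
    proof (cases "n \<le> N'")
      case True
      have "r * real N \<le> r * real n" using n r(1) by (intro mult_left_mono) auto
      then have "real m \<le> r * real n - B" using m(1) by linarith
      moreover have "h n \<in> lattice n m" using E(4)[OF True] x(1) by (simp add: h_def latticeI)
      ultimately show ?thesis by blast
    next
      case False
      have "h n = (\<Oplus>\<^bsub>Vn n\<^esub>i\<in>{..<2 * N'}. E i n)"
        unfolding h_def using E(1) by (intro Ql_group_ring_finsum_at) auto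
      also have "\<dots> \<in> lattice n (m + c * n)"
      proof -
        have "(\<Oplus>\<^bsub>Vn n\<^esub>i\<in>{..<k}. E i n) \<in> lattice n (m + c * n)" for k :: nat
        proof (induction k)
          case (Suc k)
          have "(\<Oplus>\<^bsub>Vn n\<^esub>i\<in>{..<Suc k}. E i n) = E k n \<oplus>\<^bsub>Vn n\<^esub> (\<Oplus>\<^bsub>Vn n\<^esub>i\<in>{..<k}. E i n)"
            unfolding lessThan_Suc using Ql_group_ringD(1)[OF E(1)] by (intro Vn.finsum_insert) auto
          then show ?case using lattice_add_closed[OF E(2) Suc] by simp
        qed (simp add: zero_in_lattice)
        then show ?thesis .
      qed
      finally have "h n \<in> lattice n (m + c * n)" .
      moreover have "real (m + c * n) \<le> r * real n - B"
        using N2 False by (simp add: N'_def r_def algebra_simps)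
      ultimately show ?thesis by blast
    qed
    have "quot_val l G n ((g \<ominus>\<^bsub>QG\<^esub> h) n) + ereal (r * real n) \<ge> ereal B" for n
    proof (cases "n \<ge> N")
      case True
      obtain k1 where k1: "real k1 \<le> r * real n - B" "g n \<in> lattice n k1" using g_lat[OF True] by blast
      obtain k2 where k2: "real k2 \<le> r * real n - B" "h n \<in> lattice n k2" using h_lat[OF True] by blast
      define k where "k = max k1 k2"
      have "g n \<in> lattice n k" "h n \<in> lattice n k"
        using k1(2) k2(2) lattice_increasing[of k1 k n] lattice_increasing[of k2 k n] by (auto simp: k_def)
      then have "(g \<ominus>\<^bsub>QG\<^esub> h) n \<in> lattice n k"
        unfolding Ql_group_ring_diff_at[OF hc] unfolding a_minus_def by (intro lattice_add_closed lattice_minus_closed)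
      then have "ereal (- real k) + ereal (r * real n) \<le> quot_val l G n ((g \<ominus>\<^bsub>QG\<^esub> h) n) + ereal (r * real n)"
        by (intro add_right_mono quot_val_lattice)
      moreover have "B \<le> - real k + r * real n" using k1(1) k2(1) by (auto simp: k_def max_def)
      ultimately show ?thesis by (metis ereal_less_eq(3) order_trans plus_ereal.simps(1))
    next
      case False
      then have "h n = g n" using E(4)[of n N'] g_low[of n] by (simp add: h_def N'_def)
      then have "(g \<ominus>\<^bsub>QG\<^esub> h) n = \<zero>\<^bsub>Vn n\<^esub>"
        unfolding Ql_group_ring_diff_at[OF hc] using Ql_group_ringD(1)[OF gc, of n] by (simp add: a_minus_def Vn.r_neg)
      then show ?thesis by (simp add: quot_val_zero)
    qed
    then have "convergent_norm l G r (g \<ominus>\<^bsub>QG\<^esub> h) \<le> ereal (real l powr - B)" by (rule convergent_norm_le)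
    also have "\<dots> < ereal \<epsilon>" using B by simp
    finally have norm: "convergent_norm l G r (g \<ominus>\<^bsub>QG\<^esub> h) < ereal \<epsilon>" .
    have "h \<in> Ql_span l G (eigenvectors l G r (Ql_map l G G f))"
      unfolding h_def
    proof (rule Ql_span_sum)
      show "eigenvectors l G r (Ql_map l G G f) \<subseteq> carrier QG"
        by (auto simp: eigenvectors_def convergent_ring_def)
      fix i
      have "E i \<in> convergent_ring l G r" using E(1,2) r(2) by (rule convergent_ringI)
      then show "E i \<in> eigenvectors l G r (Ql_map l G G f) \<or> E i = \<zero>\<^bsub>QG\<^esub>"
        using E(3)[of i] qa_pow_closed[of i] unfolding eigenvectors_def by blast
    qed
    then show ?thesis using norm by blast
  qed
  then show ?thesis using r(1) unfolding topologically_diagonalizable_def by blast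
qed

end

section \<open>Maximal pro-\<open>l\<close> quotients\<close>

locale normal_preimage = A?: group A + B?: group B for A :: "('g, 'm) monoid_scheme" and B :: "('h, 'n) monoid_scheme" +
  fixes f V
  assumes f: "f \<in> hom A B" and V: "V \<lhd> B"
begin

abbreviation "pre \<equiv> {a \<in> carrier A. f a \<in> V}"

sublocale f: group_hom A B f using f by unfold_locales

lemma preimage_normal: "pre \<lhd> A"
proof (rule A.normal_invI)
  interpret V: normal V B by (rule V)
  show "subgroup pre A"
    by (rule A.subgroupI) (auto intro!: exI[of _ "\<one>\<^bsub>A\<^esub>"])
  fix x h assume xh: "x \<in> carrier A" "h \<in> pre"
  then have "f x \<otimes>\<^bsub>B\<^esub> f h \<otimes>\<^bsub>B\<^esub> inv\<^bsub>B\<^esub> f x \<in> V" by (intro V.inv_op_closed2) auto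
  then show "x \<otimes>\<^bsub>A\<^esub> h \<otimes>\<^bsub>A\<^esub> inv\<^bsub>A\<^esub> x \<in> pre" using xh by simp
qed

sublocale q: factor_hom A B f pre V
  by (intro factor_hom.intro factor_hom_axioms.intro A.is_group B.is_group f preimage_normal V) auto

lemma inj_on_factor_map: "inj_on (factor_map B V f) (rcosets\<^bsub>A\<^esub> pre)"
proof (rule inj_onI)
  interpret V: normal V B by (rule V)
  fix C D assume CD: "C \<in> rcosets\<^bsub>A\<^esub> pre" "D \<in> rcosets\<^bsub>A\<^esub> pre" and eq: "factor_map B V f C = factor_map B V f D"
  obtain c where c: "c \<in> carrier A" "C = pre #>\<^bsub>A\<^esub> c" using CD(1) by (auto simp: RCOSETS_def)
  obtain d where d: "d \<in> carrier A" "D = pre #>\<^bsub>A\<^esub> d" using CD(2) by (auto simp: RCOSETS_def)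
  have "V #>\<^bsub>B\<^esub> f c = V #>\<^bsub>B\<^esub> f d" using eq c d by (simp add: q.factor_map_coset)
  moreover have "f d \<in> V #>\<^bsub>B\<^esub> f d" using d V.is_subgroup by (intro B.rcos_self) auto
  ultimately obtain v where v: "v \<in> V" "f d = v \<otimes>\<^bsub>B\<^esub> f c" by (auto simp: r_coset_def)
  have "f (d \<otimes>\<^bsub>A\<^esub> inv\<^bsub>A\<^esub> c) = v" using c d v V.subset by (simp add: B.m_assoc subset_iff)
  then have "d \<otimes>\<^bsub>A\<^esub> inv\<^bsub>A\<^esub> c \<in> pre" using c d v by simp
  moreover have "d = (d \<otimes>\<^bsub>A\<^esub> inv\<^bsub>A\<^esub> c) \<otimes>\<^bsub>A\<^esub> c" using c d by (simp add: A.m_assoc)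
  ultimately have "d \<in> pre #>\<^bsub>A\<^esub> c" unfolding r_coset_def by blast
  then show "C = D"
    using c d preimage_normal by (simp add: A.repr_independence normal_imp_subgroup)
qed

text \<open>The quotient of \<open>A\<close> by the preimage is isomorphic to a subgroup of \<open>B/V\<close>.\<close>

lemma preimage_index:
  assumes fin: "finite (rcosets\<^bsub>B\<^esub> V)"
  shows "finite (rcosets\<^bsub>A\<^esub> pre)" "card (rcosets\<^bsub>A\<^esub> pre) dvd card (rcosets\<^bsub>B\<^esub> V)"
proof -
  have img: "factor_map B V f ` (rcosets\<^bsub>A\<^esub> pre) \<subseteq> rcosets\<^bsub>B\<^esub> V"
    using q.factor_map_closed by (auto simp: carrier_Mod)
  show "finite (rcosets\<^bsub>A\<^esub> pre)"
    using finite_imageD[OF finite_subset[OF img fin] inj_on_factor_map] .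
  interpret M: group "A Mod pre" by (rule normal.factorgroup_is_group[OF preimage_normal])
  interpret N: group "B Mod V" by (rule normal.factorgroup_is_group[OF V])
  interpret h: group_hom "A Mod pre" "B Mod V" "factor_map B V f"
    using q.factor_map_hom by unfold_locales
  have "subgroup (factor_map B V f ` (rcosets\<^bsub>A\<^esub> pre)) (B Mod V)"
    using h.img_is_subgroup by (simp add: carrier_Mod)
  then have "card (factor_map B V f ` (rcosets\<^bsub>A\<^esub> pre)) dvd Coset.order (B Mod V)"
    using N.lagrange_finite fin by (metis carrier_Mod dvd_triv_right)
  then show "card (rcosets\<^bsub>A\<^esub> pre) dvd card (rcosets\<^bsub>B\<^esub> V)"
    by (simp add: card_image[OF inj_on_factor_map] Coset.order_def carrier_Mod)
qed

end

locale group_on_space = group G for G :: "'g topgroup" (structure) +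
  assumes topspace: "topspace (gtop G) = carrier G"
begin

lemma open_carrier: "openin (gtop G) (carrier G)"
  using openin_topspace[of "gtop G"] by (simp add: topspace)

lemma carrier_normal: "carrier G \<lhd> G"
  by (rule normal_invI[OF subgroup_self]) auto

lemma carrier_open_normal: "carrier G \<in> open_normal G"
  by (simp add: open_normal_def carrier_normal open_carrier rcosets_carrier)

lemma pro_kernel_normal: "pro_kernel l G \<lhd> G"
proof (rule normal_invI)
  let ?S = "{U \<in> open_normal G. \<exists>m. card (rcosets U) = l ^ m}"
  have mem: "carrier G \<in> ?S" using carrier_open_normal by (auto simp: rcosets_carrier intro: exI[of _ 0])
  have n: "U \<lhd> G" if "U \<in> ?S" for U using that by (simp add: open_normal_def)
  show "subgroup (pro_kernel l G) G"
    unfolding pro_kernel_def using mem n by (intro subgroups_Inter) (auto dest: normal_imp_subgroup)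
  fix x h assume x: "x \<in> carrier G" and h: "h \<in> pro_kernel l G"
  have "x \<otimes> h \<otimes> inv x \<in> U" if "U \<in> ?S" for U
    using normal.inv_op_closed2[OF n[OF that] x] h that unfolding pro_kernel_def by blast
  then show "x \<otimes> h \<otimes> inv x \<in> pro_kernel l G" unfolding pro_kernel_def by blast
qed

lemma max_pro_simps:
  "carrier (max_pro l G) = carrier (G Mod pro_kernel l G)"
  "x \<otimes>\<^bsub>max_pro l G\<^esub> y = x \<otimes>\<^bsub>G Mod pro_kernel l G\<^esub> y"
  "\<one>\<^bsub>max_pro l G\<^esub> = \<one>\<^bsub>G Mod pro_kernel l G\<^esub>"
  by (simp_all add: max_pro_def Let_def)

text \<open>The formula in the definition of the quotient topology does define a topology: distinct cosets are
  disjoint, so that taking unions of sets of cosets commutes with intersections.\<close>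

lemma openin_max_pro:
  "openin (gtop (max_pro l G)) V \<longleftrightarrow> V \<subseteq> carrier (G Mod pro_kernel l G) \<and> openin (gtop G) (\<Union>V)"
proof -
  let ?N = "pro_kernel l G"
  have "istopology (\<lambda>V. V \<subseteq> carrier (G Mod ?N) \<and> openin (gtop G) (\<Union>V))"
    unfolding istopology_def
  proof (intro conjI allI impI)
    fix S T assume S: "S \<subseteq> carrier (G Mod ?N) \<and> openin (gtop G) (\<Union>S)"
      and T: "T \<subseteq> carrier (G Mod ?N) \<and> openin (gtop G) (\<Union>T)"
    have disj: "pairwise disjnt (rcosets ?N)"
      by (rule rcos_disjoint[OF normal_imp_subgroup[OF pro_kernel_normal]])
    have "\<Union>(S \<inter> T) = \<Union>S \<inter> \<Union>T"
    proof (intro equalityI subsetI)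
      fix x assume "x \<in> \<Union>S \<inter> \<Union>T"
      then obtain C D where CD: "C \<in> S" "x \<in> C" "D \<in> T" "x \<in> D" by blast
      then have "C = D"
        using disj S T unfolding pairwise_def disjnt_def carrier_Mod by blast
      then show "x \<in> \<Union>(S \<inter> T)" using CD by blast
    qed blast
    then show "openin (gtop G) (\<Union>(S \<inter> T))" using S T by auto
    show "S \<inter> T \<subseteq> carrier (G Mod ?N)" using S by blast
  next
    fix K assume K: "\<forall>S\<in>K. S \<subseteq> carrier (G Mod ?N) \<and> openin (gtop G) (\<Union>S)"
    then show "\<Union>K \<subseteq> carrier (G Mod ?N)" by blast
    have "openin (gtop G) (\<Union>S\<in>K. \<Union>S)" using K by (intro openin_Union) auto
    moreover have "(\<Union>S\<in>K. \<Union>S) = \<Union>(\<Union>K)" by blast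
    ultimately show "openin (gtop G) (\<Union>(\<Union>K))" by simp
  qed
  then show ?thesis by (simp add: max_pro_def Let_def topology_inverse')
qed

lemma group_max_pro: "group (max_pro l G)"
proof -
  interpret Q: group "G Mod pro_kernel l G" by (rule normal.factorgroup_is_group[OF pro_kernel_normal])
  show ?thesis
  proof (rule groupI; unfold max_pro_simps)
    fix x assume "x \<in> carrier (G Mod pro_kernel l G)"
    then show "\<exists>y\<in>carrier (G Mod pro_kernel l G). y \<otimes>\<^bsub>G Mod pro_kernel l G\<^esub> x = \<one>\<^bsub>G Mod pro_kernel l G\<^esub>"
      using Q.l_inv Q.inv_closed by blast
  qed (simp_all del: mult_FactGroup one_FactGroup add: Q.m_assoc)
qed

lemma max_pro_on_space: "group_on_space (max_pro l G)"
proof (intro group_on_space.intro group_on_space_axioms.intro group_max_pro)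
  have "\<Union>(carrier (G Mod pro_kernel l G)) = carrier G"
    unfolding carrier_Mod by (rule rcosets_part_G[OF normal_imp_subgroup[OF pro_kernel_normal]])
  then have "openin (gtop (max_pro l G)) (carrier (G Mod pro_kernel l G))"
    by (simp add: openin_max_pro open_carrier)
  moreover have "topspace (gtop (max_pro l G)) \<subseteq> carrier (G Mod pro_kernel l G)"
    using openin_max_pro[of l "topspace (gtop (max_pro l G))"] by simp
  ultimately show "topspace (gtop (max_pro l G)) = carrier (max_pro l G)"
    by (auto simp: max_pro_simps dest: openin_subset)
qed

end

locale continuous_group_hom = A?: group_on_space A + B?: group_on_space B
  for A :: "'g topgroup" and B :: "'h topgroup" +
  fixes f
  assumes f: "f \<in> hom A B" and cont: "continuous_map (gtop A) (gtop B) f"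
begin

lemma normal_preimage: "V \<lhd> B \<Longrightarrow> normal_preimage A B f V"
  by (intro normal_preimage.intro normal_preimage_axioms.intro A.is_group B.is_group f)

lemma preimage_open:
  assumes "openin (gtop B) V"
  shows "openin (gtop A) {a \<in> carrier A. f a \<in> V}"
  using openin_continuous_map_preimage[OF cont assms] by (simp add: A.topspace)

lemma preimage_open_normal:
  assumes "V \<in> open_normal B"
  shows "{a \<in> carrier A. f a \<in> V} \<in> open_normal A"
    and "card (rcosets\<^bsub>A\<^esub> {a \<in> carrier A. f a \<in> V}) dvd card (rcosets\<^bsub>B\<^esub> V)"
proof -
  have Vo: "V \<lhd> B" "openin (gtop B) V" "finite (rcosets\<^bsub>B\<^esub> V)" using assms by (auto simp: open_normal_def)
  interpret normal_preimage A B f V using Vo(1) by (rule normal_preimage)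
  show "pre \<in> open_normal A"
    using preimage_normal preimage_index(1)[OF Vo(3)] preimage_open[OF Vo(2)] by (simp add: open_normal_def)
  show "card (rcosets\<^bsub>A\<^esub> pre) dvd card (rcosets\<^bsub>B\<^esub> V)" using Vo(3) by (rule preimage_index)
qed

text \<open>The preimage of an open normal subgroup of \<open>l\<close>-power index is again such a subgroup.\<close>

lemma pro_kernel_image:
  assumes l: "prime l"
  shows "f ` pro_kernel l A \<subseteq> pro_kernel l B"
proof (clarsimp simp: pro_kernel_def[of l B])
  fix a U m assume a: "a \<in> pro_kernel l A" and U: "U \<in> open_normal B" "card (rcosets\<^bsub>B\<^esub> U) = l ^ m"
  obtain k where "card (rcosets\<^bsub>A\<^esub> {a \<in> carrier A. f a \<in> U}) = l ^ k"
    using preimage_open_normal(2)[OF U(1)] U(2) l by (auto simp: divides_primepow_nat)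
  then show "f a \<in> U" using a preimage_open_normal(1)[OF U(1)] unfolding pro_kernel_def by blast
qed

lemma max_pro_map_hom:
  assumes l: "prime l"
  shows "pro_group_hom l (max_pro l A) (max_pro l B) (max_pro_map l B f)"
proof -
  let ?NA = "pro_kernel l A" and ?NB = "pro_kernel l B"
  interpret q: factor_hom A B f ?NA ?NB
    using pro_kernel_image[OF l]
    by (intro factor_hom.intro factor_hom_axioms.intro A.is_group B.is_group f A.pro_kernel_normal B.pro_kernel_normal)
  have map: "max_pro_map l B f = factor_map B ?NB f"
    by (rule ext) (simp add: max_pro_map_def factor_map_def)
  interpret MA: group_on_space "max_pro l A" by (rule A.max_pro_on_space)
  interpret MB: group_on_space "max_pro l B" by (rule B.max_pro_on_space)
  have hom: "max_pro_map l B f \<in> hom (max_pro l A) (max_pro l B)"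
    using q.factor_map_hom unfolding map hom_def by (simp add: A.max_pro_simps B.max_pro_simps del: mult_FactGroup)
  have pre: "{C \<in> carrier (max_pro l A). max_pro_map l B f C \<in> V} \<in> open_normal (max_pro l A)"
    if V: "V \<in> open_normal (max_pro l B)" for V
  proof -
    interpret n: normal_preimage "max_pro l A" "max_pro l B" "max_pro_map l B f" V
      using V by (intro normal_preimage.intro normal_preimage_axioms.intro MA.is_group MB.is_group hom)
        (simp add: open_normal_def)
    have Vo: "V \<subseteq> rcosets\<^bsub>B\<^esub> ?NB" "openin (gtop B) (\<Union>V)" "finite (rcosets\<^bsub>max_pro l B\<^esub> V)"
      using V B.openin_max_pro[of l V] by (auto simp: open_normal_def carrier_Mod)
    have sub: "subgroup ?NA A" "subgroup ?NB B"
      using A.pro_kernel_normal B.pro_kernel_normal by (auto intro: normal_imp_subgroup)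
    have "\<Union>n.pre = {a \<in> carrier A. f a \<in> \<Union>V}"
    proof (intro equalityI subsetI)
      fix a assume "a \<in> \<Union>n.pre"
      then obtain C where C: "a \<in> C" "C \<in> rcosets\<^bsub>A\<^esub> ?NA" "factor_map B ?NB f C \<in> V"
        by (auto simp: A.max_pro_simps carrier_Mod map)
      have "f ` C \<subseteq> factor_map B ?NB f C"
        using q.factor_map_eq_iff[OF C(2), of "factor_map B ?NB f C"] C(3) Vo(1) by blast
      moreover have "a \<in> carrier A" using C(1,2) A.rcosets_part_G[OF sub(1)] by blast
      ultimately show "a \<in> {a \<in> carrier A. f a \<in> \<Union>V}" using C by blast
    next
      fix a assume "a \<in> {a \<in> carrier A. f a \<in> \<Union>V}"
      then obtain D where a: "a \<in> carrier A" and D: "f a \<in> D" "D \<in> V" by blast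
      obtain b where b: "b \<in> carrier B" "D = ?NB #>\<^bsub>B\<^esub> b" using D(2) Vo(1) by (auto simp: RCOSETS_def)
      have "D = factor_map B ?NB f (?NA #>\<^bsub>A\<^esub> a)"
        unfolding q.factor_map_coset[OF a] b(2)
        using D(1) b sub(2) by (intro B.repr_independence) auto
      moreover have "?NA #>\<^bsub>A\<^esub> a \<in> carrier (max_pro l A)"
        using a by (auto simp: A.max_pro_simps carrier_Mod RCOSETS_def)
      moreover have "a \<in> ?NA #>\<^bsub>A\<^esub> a" using a sub(1) by (rule A.rcos_self)
      ultimately show "a \<in> \<Union>n.pre" using D(2) unfolding map by blast
    qed
    then have "openin (gtop (max_pro l A)) n.pre"
      unfolding A.openin_max_pro using preimage_open[OF Vo(2)] by (auto simp: A.max_pro_simps)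
    then show ?thesis
      using n.preimage_normal n.preimage_index(1)[OF Vo(3)] by (simp add: open_normal_def)
  qed
  show ?thesis
    using MA.carrier_open_normal MB.carrier_open_normal l hom pre
    by (intro pro_group_hom.intro pro_group_hom_axioms.intro pro_group.intro pro_group_axioms.intro
        prime_number.intro MA.is_group MB.is_group)
qed

end

section \<open>Etale fundamental groups\<close>

lemma morphismD:
  assumes "morphism X Y f"
  shows "continuous_map (tp X) (tp Y) (pt f)" "pt f \<in> extensional (pts X)"
    "cm f \<in> extensional {V. openin (tp Y) V}"
    "\<And>V. openin (tp Y) V \<Longrightarrow> cm f V \<in> ring_hom (sec Y V) (sec X (preim X f V))"
    "\<And>V. openin (tp Y) V \<Longrightarrow> cm f V \<in> extensional (carrier (sec Y V))"
    "\<And>V W t. openin (tp Y) V \<Longrightarrow> openin (tp Y) W \<Longrightarrow> W \<subseteq> V \<Longrightarrow> t \<in> carrier (sec Y V) \<Longrightarrow>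
        cm f W (res Y V W t) = res X (preim X f V) (preim X f W) (cm f V t)"
    "\<And>x V t. x \<in> pts X \<Longrightarrow> openin (tp Y) V \<Longrightarrow> pt f x \<in> V \<Longrightarrow> t \<in> carrier (sec Y V) \<Longrightarrow>
        germ X x (preim X f V) (cm f V t) \<in> Units (stalk X x) \<Longrightarrow>
        germ Y (pt f x) V t \<in> Units (stalk Y (pt f x))"
proof -
  note m = assms[unfolded morphism_def]
  note m4 = m[THEN conjunct2, THEN conjunct2, THEN conjunct2]
  show "continuous_map (tp X) (tp Y) (pt f)" by (rule m[THEN conjunct1])
  show "pt f \<in> extensional (pts X)" by (rule m[THEN conjunct2, THEN conjunct1])
  show "cm f \<in> extensional {V. openin (tp Y) V}"
    by (rule m[THEN conjunct2, THEN conjunct2, THEN conjunct1])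
  show "cm f V \<in> ring_hom (sec Y V) (sec X (preim X f V))" if "openin (tp Y) V" for V
    using m4[THEN conjunct1, rule_format, OF that] by (rule IntD1)
  show "cm f V \<in> extensional (carrier (sec Y V))" if "openin (tp Y) V" for V
    using m4[THEN conjunct1, rule_format, OF that] by (rule IntD2)
  show "cm f W (res Y V W t) = res X (preim X f V) (preim X f W) (cm f V t)"
    if "openin (tp Y) V" "openin (tp Y) W" "W \<subseteq> V" "t \<in> carrier (sec Y V)" for V W t
    using that by (intro m4[THEN conjunct2, THEN conjunct1, rule_format] conjI)
  show "germ Y (pt f x) V t \<in> Units (stalk Y (pt f x))"
    if "x \<in> pts X" "openin (tp Y) V" "pt f x \<in> V" "t \<in> carrier (sec Y V)"
      "germ X x (preim X f V) (cm f V t) \<in> Units (stalk X x)" for x V t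
    using that(2-) by (intro m4[THEN conjunct2, THEN conjunct2, rule_format, OF that(1)] conjI)
qed

lemma morphism_pt: "morphism X Y f \<Longrightarrow> x \<in> pts X \<Longrightarrow> pt f x \<in> pts Y"
  using continuous_map_image_subset_topspace[OF morphismD(1)] by blast

lemma openin_preim: "morphism X Y f \<Longrightarrow> openin (tp Y) V \<Longrightarrow> openin (tp X) (preim X f V)"
  unfolding preim_def by (rule openin_continuous_map_preimage[OF morphismD(1)])

lemma preim_mono: "W \<subseteq> V \<Longrightarrow> preim X f W \<subseteq> preim X f V"
  by (auto simp: preim_def)

lemma preim_comp:
  assumes "morphism X Y f"
  shows "preim X (comp_m X Y Z g f) W = preim X f (preim Y g W)"
  using morphism_pt[OF assms] by (auto simp: preim_def comp_m_def)

lemma cm_comp: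
  assumes "openin (tp Z) W" "t \<in> carrier (sec Z W)"
  shows "cm (comp_m X Y Z g f) W t = cm f (preim Y g W) (cm g W t)"
  using assms by (simp add: comp_m_def)

lemma cm_closed:
  "morphism X Y f \<Longrightarrow> openin (tp Y) V \<Longrightarrow> t \<in> carrier (sec Y V) \<Longrightarrow> cm f V t \<in> carrier (sec X (preim X f V))"
  by (rule ring_hom_closed[OF morphismD(4)])

text \<open>Components of morphisms are restricted to their domains, so the argument needs that operations and
  restriction maps of the structure sheaf of \<open>Z\<close> stay within the rings of sections.\<close>

lemma morphism_comp:
  assumes f: "morphism X Y f" and g: "morphism Y Z g" and Z: "ringed_space Z"
  shows "morphism X Z (comp_m X Y Z g f)"
proof -
  let ?h = "comp_m X Y Z g f"
  have sec: "cring (sec Z V)" if "openin (tp Z) V" for V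
    using Z[unfolded ringed_space_def, THEN conjunct1, rule_format, OF that] by (rule conjunct1)
  have res: "res Z V W t \<in> carrier (sec Z W)"
    if "openin (tp Z) V" "openin (tp Z) W" "W \<subseteq> V" "t \<in> carrier (sec Z V)" for V W t
    using Z[unfolded ringed_space_def, THEN conjunct2, THEN conjunct1, rule_format, of V W] that
    by (intro ring_hom_closed[OF _ that(4)]) blast
  note op = openin_preim[OF g]
  have pt: "pt ?h x = pt g (pt f x)" if "x \<in> pts X" for x using that by (simp add: comp_m_def)
  have cont: "continuous_map (tp X) (tp Z) (pt ?h)"
    by (rule continuous_map_eq[OF continuous_map_compose[OF morphismD(1)[OF f] morphismD(1)[OF g]]])
      (simp add: pt)
  have ext: "pt ?h \<in> extensional (pts X)" "cm ?h \<in> extensional {V. openin (tp Z) V}"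
    by (simp_all add: comp_m_def)
  have hom: "cm ?h V \<in> ring_hom (sec Z V) (sec X (preim X ?h V)) \<inter> extensional (carrier (sec Z V))"
    if V: "openin (tp Z) V" for V
  proof
    interpret R: cring "sec Z V" using V by (rule sec)
    note gh = morphismD(4)[OF g V] and fh = morphismD(4)[OF f op[OF V]]
    note cl = cm_closed[OF g V]
    show "cm ?h V \<in> ring_hom (sec Z V) (sec X (preim X ?h V))"
      unfolding preim_comp[OF f]
      by (rule ring_hom_memI)
        (simp_all only: cm_comp[OF V] cl R.m_closed R.a_closed R.one_closed ring_hom_closed[OF fh]
          ring_hom_mult[OF gh] ring_hom_mult[OF fh] ring_hom_add[OF gh] ring_hom_add[OF fh]
          ring_hom_one[OF gh] ring_hom_one[OF fh])
    show "cm ?h V \<in> extensional (carrier (sec Z V))" using V by (simp add: comp_m_def)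
  qed
  have nat: "cm ?h W (res Z V W t) = res X (preim X ?h V) (preim X ?h W) (cm ?h V t)"
    if V: "openin (tp Z) V" and W: "openin (tp Z) W" and sub: "W \<subseteq> V" and t: "t \<in> carrier (sec Z V)" for V W t
    unfolding cm_comp[OF W res[OF V W sub t]] cm_comp[OF V t] preim_comp[OF f] morphismD(6)[OF g V W sub t]
    by (rule morphismD(6)[OF f op[OF V] op[OF W] preim_mono[OF sub] cm_closed[OF g V t]])
  have loc: "germ Z (pt ?h x) V t \<in> Units (stalk Z (pt ?h x))"
    if x: "x \<in> pts X" and V: "openin (tp Z) V" and xV: "pt ?h x \<in> V" and t: "t \<in> carrier (sec Z V)"
      and u: "germ X x (preim X ?h V) (cm ?h V t) \<in> Units (stalk X x)" for x V t
  proof -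
    have fx: "pt f x \<in> pts Y" using f x by (rule morphism_pt)
    have "germ Y (pt f x) (preim Y g V) (cm g V t) \<in> Units (stalk Y (pt f x))"
      using u fx xV unfolding cm_comp[OF V t] preim_comp[OF f] pt[OF x]
      by (intro morphismD(7)[OF f x op[OF V] _ cm_closed[OF g V t]]) (simp_all add: preim_def)
    then show ?thesis using xV unfolding pt[OF x] by (intro morphismD(7)[OF g fx V _ t])
  qed
  show ?thesis
    unfolding morphism_def
    by (intro conjI allI impI ballI cont ext hom; (elim conjE)?; (rule nat loc; assumption)?)
qed

lemma comp_m_assoc:
  assumes f: "morphism X Y f" and g: "morphism Y Z g" and h: "morphism Z W h"
  shows "comp_m X Z W h (comp_m X Y Z g f) = comp_m X Y W (comp_m Y Z W h g) f"
proof (rule morph.equality)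
  show "pt (comp_m X Z W h (comp_m X Y Z g f)) = pt (comp_m X Y W (comp_m Y Z W h g) f)"
    using morphism_pt[OF f] by (auto simp: comp_m_def)
  have "cm (comp_m X Y Z g f) (preim Z h V) (cm h V t) =
      cm f (preim Y (comp_m Y Z W h g) V) (cm (comp_m Y Z W h g) V t)"
    if V: "openin (tp W) V" and t: "t \<in> carrier (sec W V)" for V t
    by (simp only: cm_comp[OF V t] cm_comp[OF openin_preim[OF h V] cm_closed[OF h V t]] preim_comp[OF g])
  then show "cm (comp_m X Z W h (comp_m X Y Z g f)) = cm (comp_m X Y W (comp_m Y Z W h g) f)"
    by (subst (1 3) comp_m_def) (auto intro!: restrict_ext)
qed simp

lemma covers_cover:
  assumes "c \<in> covers X"
  shows "ringed_space (fst c)" "morphism (fst c) X (snd c)"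
  using assms by (auto simp: covers_def finite_etale_def scheme_def locally_ringed_space_def)

lemma fib_cover_map:
  assumes c: "c \<in> covers X" and d: "d \<in> covers X" and h: "h \<in> cover_maps X c d" and y: "y \<in> fib L X xb c"
  shows "comp_m (Spec L) (fst c) (fst d) h y \<in> fib L X xb d"
proof -
  have h': "morphism (fst c) (fst d) h" "comp_m (fst c) (fst d) X (snd d) h = snd c"
    using h by (auto simp: cover_maps_def split: prod.splits)
  have y': "morphism (Spec L) (fst c) y" "comp_m (Spec L) (fst c) X (snd c) y = xb"
    using y by (auto simp: fib_def split: prod.splits)
  have "morphism (Spec L) (fst d) (comp_m (Spec L) (fst c) (fst d) h y)"
    using y'(1) h'(1) covers_cover(1)[OF d] by (rule morphism_comp)
  moreover have "comp_m (Spec L) (fst d) X (snd d) (comp_m (Spec L) (fst c) (fst d) h y) = xb"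
    unfolding comp_m_assoc[OF y'(1) h'(1) covers_cover(2)[OF d]] h'(2) by (rule y'(2))
  ultimately show ?thesis by (auto simp: fib_def split: prod.splits)
qed

lemma fibre_autosI:
  assumes "\<tau> \<in> extensional (covers X)" "\<And>c. c \<in> covers X \<Longrightarrow> \<tau> c \<in> Bij (fib L X xb c)"
    "\<And>c d h y. c \<in> covers X \<Longrightarrow> d \<in> covers X \<Longrightarrow> h \<in> cover_maps X c d \<Longrightarrow> y \<in> fib L X xb c \<Longrightarrow>
      \<tau> d (comp_m (Spec L) (fst c) (fst d) h y) = comp_m (Spec L) (fst c) (fst d) h (\<tau> c y)"
  shows "\<tau> \<in> fibre_autos L X xb"
  using assms unfolding fibre_autos_def by (auto simp: PiE_iff)

lemma fibre_autosD:
  assumes "\<tau> \<in> fibre_autos L X xb"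
  shows "\<tau> \<in> extensional (covers X)" "\<And>c. c \<in> covers X \<Longrightarrow> \<tau> c \<in> Bij (fib L X xb c)"
    "\<And>c d h y. c \<in> covers X \<Longrightarrow> d \<in> covers X \<Longrightarrow> h \<in> cover_maps X c d \<Longrightarrow> y \<in> fib L X xb c \<Longrightarrow>
      \<tau> d (comp_m (Spec L) (fst c) (fst d) h y) = comp_m (Spec L) (fst c) (fst d) h (\<tau> c y)"
  using assms unfolding fibre_autos_def by (auto simp: PiE_iff)

lemma pi1_simps:
  "carrier (pi1 L X xb) = fibre_autos L X xb"
  "\<tau> \<otimes>\<^bsub>pi1 L X xb\<^esub> \<rho> = (\<lambda>c\<in>covers X. \<tau> c \<otimes>\<^bsub>BijGroup (fib L X xb c)\<^esub> \<rho> c)"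
  "\<one>\<^bsub>pi1 L X xb\<^esub> = (\<lambda>c\<in>covers X. \<one>\<^bsub>BijGroup (fib L X xb c)\<^esub>)"
  by (simp_all add: pi1_def)

text \<open>Naturality of identities and inverses uses that maps of covers map fibres to fibres.\<close>

lemma group_pi1: "group (pi1 L X xb)"
proof (rule groupI; unfold pi1_simps)
  let ?B = "\<lambda>c. BijGroup (fib L X xb c)"
  have Bm: "(\<tau> \<otimes>\<^bsub>?B c\<^esub> \<rho>) y = \<tau> (\<rho> y)"
    if "\<tau> \<in> Bij (fib L X xb c)" "\<rho> \<in> Bij (fib L X xb c)" "y \<in> fib L X xb c" for \<tau> \<rho> y c
    using that by (simp add: BijGroup_def compose_def)
  have Bc: "\<tau> \<otimes>\<^bsub>?B c\<^esub> \<rho> \<in> Bij (fib L X xb c)"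
    if "\<tau> \<in> Bij (fib L X xb c)" "\<rho> \<in> Bij (fib L X xb c)" for \<tau> \<rho> c
    using that by (simp add: BijGroup_def compose_Bij)
  have car: "carrier (?B c) = Bij (fib L X xb c)" for c by (simp add: BijGroup_def)
  have Bfun: "\<tau> y \<in> fib L X xb c" if "\<tau> \<in> Bij (fib L X xb c)" "y \<in> fib L X xb c" for \<tau> y c
    using Bij_imp_funcset[OF that(1)] that(2) by auto
  note D = fibre_autosD and cov = fib_cover_map
  interpret B: group "?B c" for c by (rule group_BijGroup)
  show "(\<lambda>c\<in>covers X. \<tau> c \<otimes>\<^bsub>?B c\<^esub> \<rho> c) \<in> fibre_autos L X xb"
    if t: "\<tau> \<in> fibre_autos L X xb" and r: "\<rho> \<in> fibre_autos L X xb" for \<tau> \<rho>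
  proof (rule fibre_autosI)
    fix c d h y assume c: "c \<in> covers X" and d: "d \<in> covers X" and h: "h \<in> cover_maps X c d" and y: "y \<in> fib L X xb c"
    have ry: "\<rho> c y \<in> fib L X xb c" using D(2)[OF r c] y by (rule Bfun)
    have "(\<tau> d \<otimes>\<^bsub>?B d\<^esub> \<rho> d) (comp_m (Spec L) (fst c) (fst d) h y) =
        \<tau> d (\<rho> d (comp_m (Spec L) (fst c) (fst d) h y))"
      by (rule Bm[OF D(2)[OF t d] D(2)[OF r d] cov[OF c d h y]])
    also have "\<dots> = comp_m (Spec L) (fst c) (fst d) h (\<tau> c (\<rho> c y))"
      by (simp only: D(3)[OF r c d h y] D(3)[OF t c d h ry])
    also have "\<tau> c (\<rho> c y) = (\<tau> c \<otimes>\<^bsub>?B c\<^esub> \<rho> c) y"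
      by (rule Bm[OF D(2)[OF t c] D(2)[OF r c] y, symmetric])
    finally show "(\<lambda>c\<in>covers X. \<tau> c \<otimes>\<^bsub>?B c\<^esub> \<rho> c) d (comp_m (Spec L) (fst c) (fst d) h y) =
        comp_m (Spec L) (fst c) (fst d) h ((\<lambda>c\<in>covers X. \<tau> c \<otimes>\<^bsub>?B c\<^esub> \<rho> c) c y)"
      using c d by simp
  qed (use D(2)[OF t] D(2)[OF r] in \<open>auto intro: Bc\<close>)
  show "(\<lambda>c\<in>covers X. \<one>\<^bsub>?B c\<^esub>) \<in> fibre_autos L X xb"
  proof (rule fibre_autosI)
    fix c d h y assume c: "c \<in> covers X" and d: "d \<in> covers X" and h: "h \<in> cover_maps X c d" and y: "y \<in> fib L X xb c"
    show "(\<lambda>c\<in>covers X. \<one>\<^bsub>?B c\<^esub>) d (comp_m (Spec L) (fst c) (fst d) h y) =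
        comp_m (Spec L) (fst c) (fst d) h ((\<lambda>c\<in>covers X. \<one>\<^bsub>?B c\<^esub>) c y)"
      using c d y cov[OF c d h y] by (simp add: BijGroup_def)
  qed (auto simp: BijGroup_def id_Bij)
  show "(\<lambda>c\<in>covers X. (\<lambda>c\<in>covers X. \<tau> c \<otimes>\<^bsub>?B c\<^esub> \<rho> c) c \<otimes>\<^bsub>?B c\<^esub> \<upsilon> c) =
      (\<lambda>c\<in>covers X. \<tau> c \<otimes>\<^bsub>?B c\<^esub> (\<lambda>c\<in>covers X. \<rho> c \<otimes>\<^bsub>?B c\<^esub> \<upsilon> c) c)"
    if "\<tau> \<in> fibre_autos L X xb" "\<rho> \<in> fibre_autos L X xb" "\<upsilon> \<in> fibre_autos L X xb" for \<tau> \<rho> \<upsilon>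
    using D(2)[OF that(1)] D(2)[OF that(2)] D(2)[OF that(3)]
    by (intro restrict_ext) (simp add: B.m_assoc car)
  fix \<tau> assume t: "\<tau> \<in> fibre_autos L X xb"
  show "(\<lambda>c\<in>covers X. (\<lambda>c\<in>covers X. \<one>\<^bsub>?B c\<^esub>) c \<otimes>\<^bsub>?B c\<^esub> \<tau> c) = \<tau>"
    using D(1)[OF t] D(2)[OF t] by (intro extensionalityI[OF restrict_extensional]) (simp_all add: B.l_one car)
  have invc: "inv\<^bsub>?B c\<^esub> \<tau> c \<in> Bij (fib L X xb c)" "inv\<^bsub>?B c\<^esub> \<tau> c \<otimes>\<^bsub>?B c\<^esub> \<tau> c = \<one>\<^bsub>?B c\<^esub>"
      "\<tau> c \<otimes>\<^bsub>?B c\<^esub> inv\<^bsub>?B c\<^esub> \<tau> c = \<one>\<^bsub>?B c\<^esub>"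
    if "c \<in> covers X" for c
    using D(2)[OF t that] B.inv_closed[of "\<tau> c" c] B.l_inv[of "\<tau> c" c] B.r_inv[of "\<tau> c" c] by (simp_all add: car)
  have one: "\<one>\<^bsub>?B c\<^esub> y = y" if "y \<in> fib L X xb c" for c y using that by (simp add: BijGroup_def)
  have inv_l: "(inv\<^bsub>?B c\<^esub> \<tau> c) (\<tau> c y) = y" if c: "c \<in> covers X" and y: "y \<in> fib L X xb c" for c y
    by (simp only: Bm[OF invc(1)[OF c] D(2)[OF t c] y, symmetric] invc(2)[OF c] one[OF y])
  have inv_r: "\<tau> c ((inv\<^bsub>?B c\<^esub> \<tau> c) y) = y" if c: "c \<in> covers X" and y: "y \<in> fib L X xb c" for c y
    by (simp only: Bm[OF D(2)[OF t c] invc(1)[OF c] y, symmetric] invc(3)[OF c] one[OF y])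
  have "(\<lambda>c\<in>covers X. inv\<^bsub>?B c\<^esub> \<tau> c) \<in> fibre_autos L X xb"
  proof (rule fibre_autosI)
    fix c d h y assume c: "c \<in> covers X" and d: "d \<in> covers X" and h: "h \<in> cover_maps X c d" and y: "y \<in> fib L X xb c"
    define y' where "y' = (inv\<^bsub>?B c\<^esub> \<tau> c) y"
    have y': "y' \<in> fib L X xb c" unfolding y'_def using invc(1)[OF c] y by (rule Bfun)
    have "comp_m (Spec L) (fst c) (fst d) h y = comp_m (Spec L) (fst c) (fst d) h (\<tau> c y')"
      unfolding y'_def inv_r[OF c y] ..
    also have "\<dots> = \<tau> d (comp_m (Spec L) (fst c) (fst d) h y')" by (rule D(3)[OF t c d h y', symmetric])
    finally have "(inv\<^bsub>?B d\<^esub> \<tau> d) (comp_m (Spec L) (fst c) (fst d) h y) = comp_m (Spec L) (fst c) (fst d) h y'"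
      by (simp only: inv_l[OF d cov[OF c d h y']])
    then show "(\<lambda>c\<in>covers X. inv\<^bsub>?B c\<^esub> \<tau> c) d (comp_m (Spec L) (fst c) (fst d) h y) =
        comp_m (Spec L) (fst c) (fst d) h ((\<lambda>c\<in>covers X. inv\<^bsub>?B c\<^esub> \<tau> c) c y)"
      using c d by (simp add: y'_def)
  qed (use invc(1) in auto)
  then show "\<exists>\<rho>\<in>fibre_autos L X xb. (\<lambda>c\<in>covers X. \<rho> c \<otimes>\<^bsub>?B c\<^esub> \<tau> c) = (\<lambda>c\<in>covers X. \<one>\<^bsub>?B c\<^esub>)"
    using invc(2) by (intro bexI[of _ "\<lambda>c\<in>covers X. inv\<^bsub>?B c\<^esub> \<tau> c"]) (auto intro!: restrict_ext)
qed

lemma pi1_on_space: "group_on_space (pi1 L X xb)"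
proof (intro group_on_space.intro group_on_space_axioms.intro group_pi1)
  show "topspace (gtop (pi1 L X xb)) = carrier (pi1 L X xb)"
    by (auto simp: pi1_def)
qed

section \<open>The Galois action on the pro-\<open>l\<close> fundamental group\<close>

theorem theorem1p2p3:
  fixes L :: "'a ring" and K :: "'a set"
    and X :: "('p, 's) rspace" and Xb :: "('q, 't) rspace"
    and C :: "('c, 'd) rspace" and Cb :: "('e, 'f) rspace"
    and l :: nat and \<alpha> :: "nat \<Rightarrow> int" and \<sigma> :: "'a \<Rightarrow> 'a"
  assumes "algebraic_closure L K"
    and "finitely_generated_field (sub L K)" and "char_zero (sub L K)"
    and "smooth_geom_connected_curve L K X pX Xb pXb q"
    and "smooth_compactification L K X pX Xb pXb q C pC Cb pCb qC j jb"
    and "rational_point L K X pX x"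
    and "morphism (Spec L) Xb xb" and "comp_m (Spec L) Xb X q xb = geom_point_of L K X x"
    and "comp_m (Spec L) Xb (Spec L) pXb xb = id_m (Spec L)"
    and "prime l"
    and "\<alpha> \<in> Units (Zl l)" and "\<forall>n>0. \<alpha> [^]\<^bsub>Zl l\<^esub> (n::nat) \<noteq> \<one>\<^bsub>Zl l\<^esub>"
    and "\<sigma> \<in> Gal L K"
    and "galois_conjugation L X Xb q xb \<sigma> \<phi>"
    and "pi1_induced L Xb xb Cb jb F"
    and "P = pi1 L Xb xb" and "Q = pi1 L Cb (comp_m (Spec L) Xb Cb jb xb)"
    and "G = max_pro l P" and "H = max_pro l Q"
    and "\<sigma>G = Ql_map l G G (max_pro_map l P \<phi>)"
    and "J = Ql_kernel l G H (max_pro_map l Q F)"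
    and "acts_on_gr_by_powers l G
           (weight_filtration (Ql_group_ring l G) (Ql_aug_ideal l G) J) \<sigma>G \<alpha>"
  shows "\<exists>r>0. topologically_diagonalizable l G r \<sigma>G"
proof -
  note P = assms(16) and Q = assms(17) and G = assms(18) and H = assms(19) and sG = assms(20)
    and J = assms(21)
  interpret P: group_on_space P unfolding P by (rule pi1_on_space)
  interpret Q: group_on_space Q unfolding Q by (rule pi1_on_space)
  have "\<phi> \<in> iso P P" "homeomorphic_map (gtop P) (gtop P) \<phi>"
    using assms(14) unfolding galois_conjugation_def P Let_def by blast+
  then interpret \<phi>: continuous_group_hom P P \<phi>
    by unfold_locales (auto simp: iso_def homeomorphic_imp_continuous_map)
  have "F \<in> hom P Q" "continuous_map (gtop P) (gtop Q) F"
    using assms(15) unfolding pi1_induced_def P Q Let_def by blast+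
  then interpret F: continuous_group_hom P Q F by unfold_locales
  interpret F': pro_group_hom l G H "max_pro_map l Q F"
    unfolding G H using assms(10) by (rule F.max_pro_map_hom)
  have "pro_group_hom l G G (max_pro_map l P \<phi>)"
    unfolding G using assms(10) by (rule \<phi>.max_pro_map_hom)
  then interpret pro_group_endo l G "max_pro_map l P \<phi>" \<alpha> J
    using assms(11,12,22) F'.Ql_kernel_subset unfolding sG J
    by (intro pro_group_endo.intro pro_group_endo_axioms.intro)
  show ?thesis unfolding sG by (rule endo_topologically_diagonalizable)
qed

end
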